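(* Consider a stagewise independent multistage stochastic program with the regularization, standing assumptions, stochastic sampling dual dynamic programming algorithm (with $M\ge1$ sampled scenario paths per iteration) and sampling assumption described in the context. Let $\epsilon>0$, let $\delta=(\delta_t)_{t=0}^{T-1}$ satisfy $\delta_t>0$ and $\sum_{t=0}^{T-1}\delta_t=\epsilon$, and let $\{\mathcal B_{t,k}\subset\mathbb R^{d_t}\}_{1\le k\le K_t,\,0\le t\le T-1}$ be balls (in the norm $\|\cdot\|$) of diameters $D_{t,k}\ge0$ with $\mathcal X_t\subseteq\bigcup_{k=1}^{K_t}\mathcal B_{t,k}$. Put $$I:=\sum_{t=0}^{T-1}\sum_{k=1}^{K_t}\left(1+\frac{2L_tD_{t,k}}{\delta_t}\right)^{d_t},\qquad \nu:=1-(1-1/N)^M,$$ where $N:=\prod_{t=1}^{T-1}N_t$ if $T\ge2$ and $N:=1$ otherwise. Let $\iota$ be the random variable equal to the smallest iteration index such that the root node solution $(x_0^{\iota+1},y_0^{\iota+1})$ produced by the algorithm is $\epsilon$-optimal. Then for any real number $\kappa>1$, $$\mathrm{Prob}\left(\iota\ge1+\frac{\kappa I}{\nu}\right)\le\exp\left(\frac{-I\nu(\kappa-1)^2}{16\kappa}\right).$$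
   Context: **Problem.** $T\ge1$. For each stage $t=1,\dots,T$ there is a finite set $\tilde{\mathcal N}(t)$ of $N_t$ distinct nodes; $\tilde{\mathcal N}(0)=\{r\}$. Node $m\in\tilde{\mathcal N}(t)$, $t\ge1$, is realized with probability $p_{t-1,m}>0$ independently of the past, $\sum_{m\in\tilde{\mathcal N}(t)}p_{t-1,m}=1$. Each node $m\in\tilde{\mathcal N}(t)$ has a compact set $\mathcal F_m$ of pairs $(x,y)$ in a Euclidean space, and for $t\le T-1$ its projection onto the $x$-coordinates is the same set $\mathcal X_t\subset\mathbb R^{d_t}$ for all $m\in\tilde{\mathcal N}(t)$; $\mathcal X_{-1}=\{0\}$ and $x_{-1}=0$. The cost $f_m(z,y,x)\in[0,+\infty]$, defined for $z\in\mathcal X_{t-1}$, $(x,y)\in\mathcal F_m$, is lower semicontinuous. The scenario tree has as stage-$t$ nodes the sequences $n=(n_1,\dots,n_t)$, $n_s\in\tilde{\mathcal N}(s)$ (the root being the empty sequence), with the data of $n_t$, probability $p_n=\prod_{s\le t}p_{s-1,n_s}$ and parent $a(n)=(n_1,\dots,n_{t-1})$; the original problem is to minimize $\sum_n p_nf_n(x_{a(n)},y_n,x_n)$ over $(x_n,y_n)\in\mathcal F_n$ for all tree nodes $n$, and it is assumed to have a feasible solution with finite objective. Fix a norm $\|\cdot\|$ with dual norm $\|\cdot\|_*$. **Regularization.** A penalty function is $\psi:\mathbb R^d\to\mathbb R_+$ with $\psi(x)=0$ iff $x=0$ and with the diameter of $\{\psi\le a\}$ tending to $0$ as $a\to0$.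 For each $m\in\tilde{\mathcal N}(t)$ a penalty function $\psi_m$, 1-Lipschitz on $\mathcal X_{t-1}-\mathcal X_{t-1}$, and $\sigma_m>0$ are given. With $\mathcal Q_T^{\mathrm R}\equiv0$ and $\mathcal Q_t^{\mathrm R}(x)=\sum_{m\in\tilde{\mathcal N}(t+1)}p_{t,m}Q_m^{\mathrm R}(x)$ for $t<T$, define for $m\in\tilde{\mathcal N}(t)$ $$Q_m^{\mathrm R}(x_{t-1})=\min_{(x,y)\in\mathcal F_m,\ z\in\mathcal X_{t-1}}\{f_m(z,y,x)+\sigma_m\psi_m(x_{t-1}-z)+\mathcal Q_t^{\mathrm R}(x)\}.$$ $v^{\mathrm{reg}}=\min_{(x,y)\in\mathcal F_r}\{f_r(0,y,x)+\mathcal Q_0^{\mathrm R}(x)\}$; $(x_0,y_0)\in\mathcal F_r$ is an $\epsilon$-optimal root node solution if $f_r(0,y_0,x_0)+\mathcal Q_0^{\mathrm R}(x_0)\le v^{\mathrm{reg}}+\epsilon$. Standing assumption (exactness): every optimal solution of the problem of minimizing $\sum_n p_n(f_n(z_n,y_n,x_n)+\sigma_n\psi_n(x_{a(n)}-z_n))$ over $(x_n,y_n)\in\mathcal F_n$, $z_n\in\mathcal X_{t(n)-1}$ for all scenario tree nodes $n$ (where $t(n)$ is the stage of $n$) satisfies $z_n=x_{a(n)}$ for all $n$. The problem is called convex if all $\mathcal F_m,f_m,\psi_m$ are convex. For $m\neq r$ let $\mathcal U_m=\{(\lambda,\rho):\|\lambda\|_*\le l_{m,\lambda},\ 0\le\rho\le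 l_{m,\rho}\}$ with given nonnegative bounds satisfying $l_{m,\lambda}\ge\sigma_m,\ l_{m,\rho}=0$ in the convex case with $\psi_m=\|\cdot\|$, and $l_{m,\rho}\ge\sigma_m$ otherwise. Put $L_t=\sum_{m\in\tilde{\mathcal N}(t+1)}p_{t,m}(l_{m,\lambda}+l_{m,\rho})$ for $0\le t\le T-1$. **Stochastic sampling algorithm** (run without a stopping criterion). Optimal solutions below are those returned by given subproblem oracles (functions of the subproblem's inputs, which may be random). Initialize $\underline{\mathcal Q}_t^0\equiv0$ for all $t$ and $\underline{\mathcal Q}_T^i\equiv0$ for all $i$; $(x_0^1,y_0^1)$ is an optimal solution of $\min_{(x,y)\in\mathcal F_r}f_r(0,y,x)$. Iteration $i=1,2,\dots$: sample $M$ scenario paths $P^{i,1},\dots,P^{i,M}\in\prod_{t=1}^T\tilde{\mathcal N}(t)$, $P^{i,j}=(P^{i,j}_1,\dots,P^{i,j}_T)$. (Forward) for each $j$, set $x_0^{i,j}=x_0^i$ and for $t=1,\dots,T-1$, with $n=P_t^{i,j}$, let $(x_t^{i,j},y_t^{i,j},z_t^{i,j})$ be an optimal solution of $\min_{(x,y)\in\mathcal F_n,z\in\mathcal X_{t-1}}\{f_n(z,y,x)+\sigma_n\psi_n(x_{t-1}^{i,j}-z)+\underline{\mathcal Q}_t^{i-1}(x)\}$. (Backward) for $t=T,\dots,1$: if $t<T$, set $\underline{\mathcal Q}_t^i(x)=\max\{\underline{\mathcal Q}_t^{i-1}(x),\ \sum_{m\in\tilde{\mathcal N}(t+1)}p_{t,m}C_m^{i,j}(x),\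 1\le j\le M\}$; then for each $j$ and $n\in\tilde{\mathcal N}(t)$ let $\underline v_n^{i,j}$ be the optimal value and $(\hat\lambda_n^{i,j},\hat\rho_n^{i,j})$ an optimal outer solution of $\max_{(\lambda,\rho)\in\mathcal U_n}\min_{(x,y)\in\mathcal F_n,z\in\mathcal X_{t-1}}\{f_n(z,y,x)+\langle\lambda,x_{t-1}^{i,j}-z\rangle+\rho\psi_n(x_{t-1}^{i,j}-z)+\underline{\mathcal Q}_t^i(x)\}$ and set $C_n^{i,j}(x)=-\langle\hat\lambda_n^{i,j},x_{t-1}^{i,j}-x\rangle-\hat\rho_n^{i,j}\psi_n(x_{t-1}^{i,j}-x)+\underline v_n^{i,j}$. (Root) update $\underline{\mathcal Q}_0^i$ by the same formula with $t=0$, and let $(x_0^{i+1},y_0^{i+1})$ be an optimal solution of $\min_{(x,y)\in\mathcal F_r}\{f_r(0,y,x)+\underline{\mathcal Q}_0^i(x)\}$. **Probabilistic model and sampling assumption.** There is a filtration $\{\Sigma_i^{\mathrm{oracle}}\}_{i\ge0}$ such that the forward and backward subproblem oracles used in iteration $i$ are random functions that are $\Sigma_i^{\mathrm{oracle}}$-measurable; $\Sigma_\infty^{\mathrm{oracle}}$ denotes the $\sigma$-algebra generated by $\bigcup_i\Sigma_i^{\mathrm{oracle}}$. In each iteration the $M$ paths are sampled uniformly with replacement, independently of each other and of the oracle outcomes: for all $i,j,t$ and $n_t\in\tilde{\mathcal N}(t)$, almost surely $$\mathrm{Prob}\big(P_t^{i,j}=n_t\mid\Sigma_\infty^{\mathrm{oracle}},\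 \sigma\{P_{t'}^{i',j'}\}_{(i',j',t')\ne(i,j,t)}\big)=\frac1{N_t}.$$ Iterations are indexed by $1,2,\dots$; $\iota=+\infty$ if no such index exists. *)

theory Defs
  imports "HOL-Probability.Probability"
begin

text \<open>The spaces of dimension \<open>d t\<close> (one for each stage) are modelled as linear subspaces \<open>V\<close> of one
  Euclidean space, so that the dimension may vary with the stage.  Every choice of finitely many
  dimensions arises in this way.  The norm of a stage is an arbitrary norm on its subspace and
  need not be the norm of the type.\<close>

definition norm_on :: "'a::real_vector set \<Rightarrow> ('a \<Rightarrow> real) \<Rightarrow> bool" where
  "norm_on V nm \<longleftrightarrow>
     (\<forall>x\<in>V. 0 \<le> nm x \<and> (nm x = 0 \<longleftrightarrow> x = 0)) \<and>
     (\<forall>x\<in>V. \<forall>c. nm (c *\<^sub>R x) = \<bar>c\<bar> * nm x) \<and>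
     (\<forall>x\<in>V. \<forall>y\<in>V. nm (x + y) \<le> nm x + nm y)"

definition dual_norm :: "'a::real_inner set \<Rightarrow> ('a \<Rightarrow> real) \<Rightarrow> 'a \<Rightarrow> real" where
  "dual_norm V nm l = (SUP x\<in>{x \<in> V. nm x \<le> 1}. l \<bullet> x)"

text \<open>Open and closed balls are both admitted.\<close>

definition ball_of_diameter :: "'a::real_vector set \<Rightarrow> ('a \<Rightarrow> real) \<Rightarrow> real \<Rightarrow> 'a set \<Rightarrow> bool" where
  "ball_of_diameter V nm D B \<longleftrightarrow>
     (\<exists>c\<in>V. B = {x \<in> V. nm (x - c) \<le> D / 2} \<or> B = {x \<in> V. nm (x - c) < D / 2})"

definition lsc_on :: "'a::topological_space set \<Rightarrow> ('a \<Rightarrow> ereal) \<Rightarrow> bool" where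
  "lsc_on S g \<longleftrightarrow> (\<forall>s\<in>S. g s \<le> Liminf (at s within S) g)"

definition convex_ereal_on :: "'a::real_vector set \<Rightarrow> ('a \<Rightarrow> ereal) \<Rightarrow> bool" where
  "convex_ereal_on S g \<longleftrightarrow> convex S \<and>
     (\<forall>u\<in>S. \<forall>v\<in>S. \<forall>\<theta>::real. 0 < \<theta> \<and> \<theta> < 1 \<longrightarrow>
        g ((1 - \<theta>) *\<^sub>R u + \<theta> *\<^sub>R v) \<le> ereal (1 - \<theta>) * g u + ereal \<theta> * g v)"

text \<open>The diameter is taken in the extended reals, as sublevel sets may be unbounded.\<close>

definition penalty_function :: "'a::real_vector set \<Rightarrow> ('a \<Rightarrow> real) \<Rightarrow> ('a \<Rightarrow> real) \<Rightarrow> bool" where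
  "penalty_function V nm \<psi> \<longleftrightarrow>
     (\<forall>x\<in>V. 0 \<le> \<psi> x \<and> (\<psi> x = 0 \<longleftrightarrow> x = 0)) \<and>
     ((\<lambda>a. SUP (x, y)\<in>{x \<in> V. \<psi> x \<le> a} \<times> {x \<in> V. \<psi> x \<le> a}. ereal (nm (x - y)))
        \<longlongrightarrow> 0) (at_right 0)"

text \<open>Stage-\<open>t\<close> nodes carry the data \<open>feas\<close> (pairs \<open>(x, y)\<close>), \<open>cost m z y x\<close>, \<open>pen\<close>, \<open>pen_factor\<close> and the
  multiplier bounds; \<open>node_prob t m\<close> is the probability of the node \<open>m\<close> of stage \<open>t + 1\<close>.  The fields
  \<open>states\<close>, \<open>state_space\<close> and \<open>stage_norm\<close> are only relevant at stages below the horizon.\<close>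

record ('n, 'a, 'b) mssp =
  horizon :: nat
  nodes :: "nat \<Rightarrow> 'n set"
  rootnode :: 'n
  node_prob :: "nat \<Rightarrow> 'n \<Rightarrow> real"
  state_space :: "nat \<Rightarrow> 'a set"
  stage_norm :: "nat \<Rightarrow> 'a \<Rightarrow> real"
  states :: "nat \<Rightarrow> 'a set"
  feas :: "'n \<Rightarrow> ('a \<times> 'b) set"
  cost :: "'n \<Rightarrow> 'a \<Rightarrow> 'b \<Rightarrow> 'a \<Rightarrow> ereal"
  pen :: "'n \<Rightarrow> 'a \<Rightarrow> real"
  pen_factor :: "'n \<Rightarrow> real"
  bound_lambda :: "'n \<Rightarrow> real"
  bound_rho :: "'n \<Rightarrow> real"

text \<open>The quantities of stage \<open>t - 1\<close>; stage \<open>-1\<close> has the single state \<open>0\<close>.\<close>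

definition prev_states :: "('n, 'a::euclidean_space, 'b) mssp \<Rightarrow> nat \<Rightarrow> 'a set" where
  "prev_states P t = (if t = 0 then {0} else states P (t - 1))"

definition prev_space :: "('n, 'a::euclidean_space, 'b) mssp \<Rightarrow> nat \<Rightarrow> 'a set" where
  "prev_space P t = (if t = 0 then {0} else state_space P (t - 1))"

definition prev_norm :: "('n, 'a::euclidean_space, 'b) mssp \<Rightarrow> nat \<Rightarrow> 'a \<Rightarrow> real" where
  "prev_norm P t = (if t = 0 then norm else stage_norm P (t - 1))"

definition tree :: "('n, 'a, 'b) mssp \<Rightarrow> 'n list set" where
  "tree P = {ns. length ns \<le> horizon P \<and> (\<forall>s<length ns. ns ! s \<in> nodes P (Suc s))}"

definition tree_node :: "('n, 'a, 'b) mssp \<Rightarrow> 'n list \<Rightarrow> 'n" where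
  "tree_node P ns = (if ns = [] then rootnode P else last ns)"

definition tree_prob :: "('n, 'a, 'b) mssp \<Rightarrow> 'n list \<Rightarrow> real" where
  "tree_prob P ns = (\<Prod>s<length ns. node_prob P s (ns ! s))"

definition parent_state :: "('n list \<Rightarrow> 'a::zero) \<Rightarrow> 'n list \<Rightarrow> 'a" where
  "parent_state x ns = (if ns = [] then 0 else x (butlast ns))"

definition tree_feasible :: "('n, 'a, 'b) mssp \<Rightarrow> ('n list \<Rightarrow> 'a) \<Rightarrow> ('n list \<Rightarrow> 'b) \<Rightarrow> bool" where
  "tree_feasible P x y \<longleftrightarrow> (\<forall>ns\<in>tree P. (x ns, y ns) \<in> feas P (tree_node P ns))"

definition tree_objective ::
    "('n, 'a::euclidean_space, 'b) mssp \<Rightarrow> ('n list \<Rightarrow> 'a) \<Rightarrow> ('n list \<Rightarrow> 'b) \<Rightarrow> ereal" where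
  "tree_objective P x y =
     (\<Sum>ns\<in>tree P. ereal (tree_prob P ns) *
        cost P (tree_node P ns) (parent_state x ns) (y ns) (x ns))"

definition tree_reg_feasible ::
    "('n, 'a::euclidean_space, 'b) mssp \<Rightarrow> ('n list \<Rightarrow> 'a) \<times> ('n list \<Rightarrow> 'b) \<times> ('n list \<Rightarrow> 'a) \<Rightarrow> bool" where
  "tree_reg_feasible P = (\<lambda>(x, y, z). tree_feasible P x y \<and>
     (\<forall>ns\<in>tree P. z ns \<in> prev_states P (length ns)))"

definition tree_reg_objective ::
    "('n, 'a::euclidean_space, 'b) mssp \<Rightarrow> ('n list \<Rightarrow> 'a) \<times> ('n list \<Rightarrow> 'b) \<times> ('n list \<Rightarrow> 'a) \<Rightarrow> ereal" where
  "tree_reg_objective P = (\<lambda>(x, y, z).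
     (\<Sum>ns\<in>tree P. ereal (tree_prob P ns) *
        (cost P (tree_node P ns) (z ns) (y ns) (x ns) +
         ereal (pen_factor P (tree_node P ns) *
                pen P (tree_node P ns) (parent_state x ns - z ns)))))"

definition convex_problem :: "('n, 'a::euclidean_space, 'b::euclidean_space) mssp \<Rightarrow> bool" where
  "convex_problem P \<longleftrightarrow> (\<forall>t\<le>horizon P. \<forall>m\<in>nodes P t.
     convex (feas P m) \<and>
     convex_ereal_on (prev_states P t \<times> feas P m) (\<lambda>(z, x, y). cost P m z y x) \<and>
     convex_on (prev_space P t) (pen P m))"

text \<open>The conditions on the multiplier bounds distinguish whether the problem is convex and \<^emph>\<open>all\<close>
  penalties are norms: already one other penalty at a later stage makes the approximations nonconvex, and
  then linear cuts alone do not close the duality gap at the earlier nodes.\<close>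

definition norm_penalties :: "('n, 'a::euclidean_space, 'b) mssp \<Rightarrow> bool" where
  "norm_penalties P \<longleftrightarrow>
     (\<forall>t\<in>{1..horizon P}. \<forall>m\<in>nodes P t. \<forall>x\<in>prev_space P t. pen P m x = prev_norm P t x)"

locale multistage_problem =
  fixes P :: "('n, 'a::euclidean_space, 'b::euclidean_space) mssp"
  assumes horizon_pos: "1 \<le> horizon P"
    and finite_nodes: "\<And>t. t \<in> {1..horizon P} \<Longrightarrow> finite (nodes P t)"
    and nodes_0: "nodes P 0 = {rootnode P}"
    and node_prob_pos: "\<And>t m. t < horizon P \<Longrightarrow> m \<in> nodes P (Suc t) \<Longrightarrow> 0 < node_prob P t m"
    and node_prob_sum: "\<And>t. t < horizon P \<Longrightarrow> (\<Sum>m\<in>nodes P (Suc t). node_prob P t m) = 1"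
    and state_space: "\<And>t. t < horizon P \<Longrightarrow> subspace (state_space P t)"
    and stage_norm: "\<And>t. t < horizon P \<Longrightarrow> norm_on (state_space P t) (stage_norm P t)"
    and states: "\<And>t. t < horizon P \<Longrightarrow> states P t \<subseteq> state_space P t"
    and feas_compact: "\<And>t m. t \<le> horizon P \<Longrightarrow> m \<in> nodes P t \<Longrightarrow> compact (feas P m)"
    and feas_proj: "\<And>t m. t < horizon P \<Longrightarrow> m \<in> nodes P t \<Longrightarrow> fst ` feas P m = states P t"
    and cost_nonneg: "\<And>t m z x y. t \<le> horizon P \<Longrightarrow> m \<in> nodes P t \<Longrightarrow>
          z \<in> prev_states P t \<Longrightarrow> (x, y) \<in> feas P m \<Longrightarrow> 0 \<le> cost P m z y x"
    and cost_lsc: "\<And>t m. t \<le> horizon P \<Longrightarrow> m \<in> nodes P t \<Longrightarrow>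
          lsc_on (prev_states P t \<times> feas P m) (\<lambda>(z, x, y). cost P m z y x)"
    and feasible: "\<exists>x y. tree_feasible P x y \<and> tree_objective P x y < \<infinity>"

locale regularized_problem = multistage_problem P
  for P :: "('n, 'a::euclidean_space, 'b::euclidean_space) mssp" +
  assumes penalty: "\<And>t m. t \<le> horizon P \<Longrightarrow> m \<in> nodes P t \<Longrightarrow>
          penalty_function (prev_space P t) (prev_norm P t) (pen P m)"
    and penalty_lipschitz: "\<And>t m u v. t \<le> horizon P \<Longrightarrow> m \<in> nodes P t \<Longrightarrow>
          u \<in> {a - b | a b. a \<in> prev_states P t \<and> b \<in> prev_states P t} \<Longrightarrow>
          v \<in> {a - b | a b. a \<in> prev_states P t \<and> b \<in> prev_states P t} \<Longrightarrow>
          \<bar>pen P m u - pen P m v\<bar> \<le> prev_norm P t (u - v)"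
    and pen_factor_pos: "\<And>t m. t \<le> horizon P \<Longrightarrow> m \<in> nodes P t \<Longrightarrow> 0 < pen_factor P m"
    and exact: "\<And>x y z. is_arg_min (tree_reg_objective P) (tree_reg_feasible P) (x, y, z) \<Longrightarrow>
          \<forall>ns\<in>tree P. z ns = parent_state x ns"
    and bounds_nonneg: "\<And>t m. t \<in> {1..horizon P} \<Longrightarrow> m \<in> nodes P t \<Longrightarrow>
          0 \<le> bound_lambda P m \<and> 0 \<le> bound_rho P m"
    and bounds: "\<And>t m. t \<in> {1..horizon P} \<Longrightarrow> m \<in> nodes P t \<Longrightarrow>
          (if convex_problem P \<and> norm_penalties P
           then pen_factor P m \<le> bound_lambda P m \<and> bound_rho P m = 0
           else pen_factor P m \<le> bound_rho P m)"

definition lipschitz_bound :: "('n, 'a, 'b) mssp \<Rightarrow> nat \<Rightarrow> real" where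
  "lipschitz_bound P t =
     (\<Sum>m\<in>nodes P (Suc t). node_prob P t m * (bound_lambda P m + bound_rho P m))"

definition reg_objective ::
    "('n, 'a::euclidean_space, 'b) mssp \<Rightarrow> 'n \<Rightarrow> 'a \<Rightarrow> ('a \<Rightarrow> ereal) \<Rightarrow> 'a \<times> 'b \<times> 'a \<Rightarrow> ereal" where
  "reg_objective P m xp Q = (\<lambda>(x, y, z).
     cost P m z y x + ereal (pen_factor P m * pen P m (xp - z)) + Q x)"

definition subproblem_feasible ::
    "('n, 'a::euclidean_space, 'b) mssp \<Rightarrow> nat \<Rightarrow> 'n \<Rightarrow> ('a \<times> 'b \<times> 'a) set" where
  "subproblem_feasible P t m = {(x, y, z). (x, y) \<in> feas P m \<and> z \<in> prev_states P t}"

text \<open>The minima are written as infima; they are attained by compactness and semicontinuity.\<close>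

definition node_value ::
    "('n, 'a::euclidean_space, 'b) mssp \<Rightarrow> nat \<Rightarrow> 'n \<Rightarrow> ('a \<Rightarrow> ereal) \<Rightarrow> 'a \<Rightarrow> ereal" where
  "node_value P t m Q xp = (INF u\<in>subproblem_feasible P t m. reg_objective P m xp Q u)"

function QR :: "('n, 'a::euclidean_space, 'b) mssp \<Rightarrow> nat \<Rightarrow> 'a \<Rightarrow> ereal" where
  "QR P t = (if t < horizon P
     then (\<lambda>x. \<Sum>m\<in>nodes P (Suc t). ereal (node_prob P t m) * node_value P (Suc t) m (QR P (Suc t)) x)
     else (\<lambda>_. 0))"
  by pat_completeness auto
termination by (relation "Wellfounded.measure (\<lambda>(P, t). horizon P - t)") auto

declare QR.simps [simp del]

definition root_objective ::
    "('n, 'a::euclidean_space, 'b) mssp \<Rightarrow> ('a \<Rightarrow> ereal) \<Rightarrow> 'a \<times> 'b \<Rightarrow> ereal" where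
  "root_objective P Q = (\<lambda>(x, y). cost P (rootnode P) 0 y x + Q x)"

definition v_reg :: "('n, 'a::euclidean_space, 'b) mssp \<Rightarrow> ereal" where
  "v_reg P = (INF u\<in>feas P (rootnode P). root_objective P (QR P 0) u)"

definition eps_optimal_root :: "('n, 'a::euclidean_space, 'b) mssp \<Rightarrow> real \<Rightarrow> 'a \<times> 'b \<Rightarrow> bool" where
  "eps_optimal_root P \<epsilon> u \<longleftrightarrow>
     u \<in> feas P (rootnode P) \<and> root_objective P (QR P 0) u \<le> v_reg P + ereal \<epsilon>"

definition multipliers :: "('n, 'a::euclidean_space, 'b) mssp \<Rightarrow> nat \<Rightarrow> 'n \<Rightarrow> ('a \<times> real) set" where
  "multipliers P t m = {(l, r). l \<in> prev_space P t \<and>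
     dual_norm (prev_space P t) (prev_norm P t) l \<le> bound_lambda P m \<and> 0 \<le> r \<and> r \<le> bound_rho P m}"

definition inner_value ::
    "('n, 'a::euclidean_space, 'b) mssp \<Rightarrow> nat \<Rightarrow> 'n \<Rightarrow> 'a \<Rightarrow> ('a \<Rightarrow> real) \<Rightarrow> 'a \<times> real \<Rightarrow> ereal" where
  "inner_value P t m xp Q = (\<lambda>(l, r).
     INF (x, y, z)\<in>subproblem_feasible P t m.
       cost P m z y x + ereal (l \<bullet> (xp - z) + r * pen P m (xp - z) + Q x))"

text \<open>The optimal value of the dual subproblem.  It is finite by compactness and by the existence of a
  feasible solution with finite objective, so that passing to the reals loses nothing.\<close>

definition dual_value ::
    "('n, 'a::euclidean_space, 'b) mssp \<Rightarrow> nat \<Rightarrow> 'n \<Rightarrow> 'a \<Rightarrow> ('a \<Rightarrow> real) \<Rightarrow> real" where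
  "dual_value P t m xp Q = real_of_ereal (SUP u\<in>multipliers P t m. inner_value P t m xp Q u)"

definition cut ::
    "('n, 'a::euclidean_space, 'b) mssp \<Rightarrow> 'n \<Rightarrow> 'a \<Rightarrow> 'a \<times> real \<Rightarrow> real \<Rightarrow> 'a \<Rightarrow> real" where
  "cut P m xp = (\<lambda>(l, r) v x. - (l \<bullet> (xp - x)) - r * pen P m (xp - x) + v)"

text \<open>Subproblem oracles.  The arguments are the stage, the node, the state of the previous stage and
  the current approximation of the cost-to-go function of the stage.\<close>

type_synonym ('n, 'a, 'b) fwd_oracle = "nat \<Rightarrow> 'n \<Rightarrow> 'a \<Rightarrow> ('a \<Rightarrow> real) \<Rightarrow> 'a \<times> 'b \<times> 'a"
type_synonym ('n, 'a) bwd_oracle = "nat \<Rightarrow> 'n \<Rightarrow> 'a \<Rightarrow> ('a \<Rightarrow> real) \<Rightarrow> 'a \<times> real"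
type_synonym ('a, 'b) root_oracle = "('a \<Rightarrow> real) \<Rightarrow> 'a \<times> 'b"

primrec forward_state ::
    "('n, 'a, 'b) fwd_oracle \<Rightarrow> (nat \<Rightarrow> 'a \<Rightarrow> real) \<Rightarrow> (nat \<Rightarrow> 'n) \<Rightarrow> 'a \<Rightarrow> nat \<Rightarrow> 'a" where
  "forward_state fo Q scen x0 0 = x0"
| "forward_state fo Q scen x0 (Suc t) =
     fst (fo (Suc t) (scen (Suc t)) (forward_state fo Q scen x0 t) (Q (Suc t)))"

text \<open>Here \<open>xs j t\<close> is the state of the \<open>j\<close>-th forward pass at stage \<open>t\<close>.  The approximations are functions
  on \<open>states P t\<close>; outside of it they are \<open>undefined\<close>, so that an oracle cannot see any other values.\<close>

function backward_approx ::
    "('n, 'a::euclidean_space, 'b) mssp \<Rightarrow> nat \<Rightarrow> ('n, 'a) bwd_oracle \<Rightarrow> (nat \<Rightarrow> 'a \<Rightarrow> real) \<Rightarrow>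
     (nat \<Rightarrow> nat \<Rightarrow> 'a) \<Rightarrow> nat \<Rightarrow> 'a \<Rightarrow> real" where
  "backward_approx P M bo Qold xs t = (if t < horizon P
     then (\<lambda>x\<in>states P t. Max (insert (Qold t x)
       ((\<lambda>j. \<Sum>m\<in>nodes P (Suc t). node_prob P t m *
            cut P m (xs j t)
              (bo (Suc t) m (xs j t) (backward_approx P M bo Qold xs (Suc t)))
              (dual_value P (Suc t) m (xs j t) (backward_approx P M bo Qold xs (Suc t))) x)
        ` {1..M})))
     else (\<lambda>_. 0))"
  by pat_completeness auto
termination by (relation "Wellfounded.measure (\<lambda>(P, M, bo, Qold, xs, t). horizon P - t)") auto

declare backward_approx.simps [simp del]

definition initial_approx :: "('n, 'a, 'b) mssp \<Rightarrow> nat \<Rightarrow> 'a \<Rightarrow> real" where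
  "initial_approx P t = (if t < horizon P then (\<lambda>x\<in>states P t. 0) else (\<lambda>_. 0))"

text \<open>\<open>sddp P M fo bo ro paths i\<close> consists of the approximations after iteration \<open>i\<close> and of the root node
  solution with superscript \<open>i + 1\<close>.  For \<open>i = 0\<close> this is the initialization.\<close>

primrec sddp ::
    "('n, 'a::euclidean_space, 'b) mssp \<Rightarrow> nat \<Rightarrow> (nat \<Rightarrow> ('n, 'a, 'b) fwd_oracle) \<Rightarrow>
     (nat \<Rightarrow> ('n, 'a) bwd_oracle) \<Rightarrow> (nat \<Rightarrow> ('a, 'b) root_oracle) \<Rightarrow> (nat \<Rightarrow> nat \<Rightarrow> nat \<Rightarrow> 'n) \<Rightarrow>
     nat \<Rightarrow> (nat \<Rightarrow> 'a \<Rightarrow> real) \<times> ('a \<times> 'b)" where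
  "sddp P M fo bo ro paths 0 = (initial_approx P, ro 0 (initial_approx P 0))"
| "sddp P M fo bo ro paths (Suc i) =
     (let (Qold, (x0, y0)) = sddp P M fo bo ro paths i;
          xs = (\<lambda>j. forward_state (fo (Suc i)) Qold (paths (Suc i) j) x0);
          Qnew = backward_approx P M (bo (Suc i)) Qold xs
      in (Qnew, ro (Suc i) (Qnew 0)))"

text \<open>The infimum of the empty set is \<open>\<infinity>\<close>.\<close>

definition first_optimal_iteration ::
    "('n, 'a::euclidean_space, 'b) mssp \<Rightarrow> nat \<Rightarrow> (nat \<Rightarrow> ('n, 'a, 'b) fwd_oracle) \<Rightarrow>
     (nat \<Rightarrow> ('n, 'a) bwd_oracle) \<Rightarrow> (nat \<Rightarrow> ('a, 'b) root_oracle) \<Rightarrow> (nat \<Rightarrow> nat \<Rightarrow> nat \<Rightarrow> 'n) \<Rightarrow>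
     real \<Rightarrow> enat" where
  "first_optimal_iteration P M fo bo ro paths \<epsilon> =
     (INF i\<in>{i. 1 \<le> i \<and> eps_optimal_root P \<epsilon> (snd (sddp P M fo bo ro paths i))}. enat i)"

text \<open>The approximations that can occur as inputs of subproblems: maxima of \<open>0\<close> and of finitely many
  averaged cuts.\<close>

definition averaged_cuts :: "('n, 'a::euclidean_space, 'b) mssp \<Rightarrow> nat \<Rightarrow> ('a \<Rightarrow> real) set" where
  "averaged_cuts P t = {\<lambda>x. \<Sum>m\<in>nodes P (Suc t). node_prob P t m * cut P m xp (u m) (v m) x | xp u v.
     xp \<in> states P t \<and> (\<forall>m\<in>nodes P (Suc t). u m \<in> multipliers P (Suc t) m)}"

definition approximations :: "('n, 'a::euclidean_space, 'b) mssp \<Rightarrow> nat \<Rightarrow> ('a \<Rightarrow> real) set" where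
  "approximations P t = (if t < horizon P
     then {\<lambda>x\<in>states P t. Max (insert 0 ((\<lambda>c. c x) ` C)) | C. finite C \<and> C \<subseteq> averaged_cuts P t}
     else {\<lambda>_. 0})"

text \<open>A random function with arguments \<open>x \<in> X\<close> and \<open>Q \<in> \<Q>\<close> (functions on \<open>D\<close>) is measurable if it
  maps measurable random arguments to measurable random elements, where \<open>Q\<close> is a measurable random
  argument if its value at each point of \<open>D\<close> is.  This follows from joint measurability
  in the outcome and the arguments, and holds for every deterministic function if \<open>A\<close> is trivial.
  Measurability for fixed arguments only would not suffice, as the arguments are themselves random.\<close>

definition measurable_oracle ::
    "'w measure \<Rightarrow> 'a::euclidean_space set \<Rightarrow> 'a set \<Rightarrow> ('a \<Rightarrow> real) set \<Rightarrow>
     ('w \<Rightarrow> 'a \<Rightarrow> ('a \<Rightarrow> real) \<Rightarrow> 'c::topological_space) \<Rightarrow> bool" where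
  "measurable_oracle A X D \<Q> orc \<longleftrightarrow>
     (\<forall>x Q. x \<in> borel_measurable A \<and> (\<forall>\<omega>\<in>space A. x \<omega> \<in> X \<and> Q \<omega> \<in> \<Q>) \<and>
            (\<forall>d\<in>D. (\<lambda>\<omega>. Q \<omega> d) \<in> borel_measurable A)
        \<longrightarrow> (\<lambda>\<omega>. orc \<omega> (x \<omega>) (Q \<omega>)) \<in> borel_measurable A)"

locale sddp_oracles =
  prob_space \<mu> + filtration "space \<mu>" \<Sigma>
  for \<mu> :: "'w measure" and \<Sigma> :: "nat \<Rightarrow> 'w measure" +
  fixes P :: "('n, 'a::euclidean_space, 'b::euclidean_space) mssp"
    and fo :: "nat \<Rightarrow> 'w \<Rightarrow> ('n, 'a, 'b) fwd_oracle"
    and bo :: "nat \<Rightarrow> 'w \<Rightarrow> ('n, 'a) bwd_oracle"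
    and ro :: "nat \<Rightarrow> 'w \<Rightarrow> ('a, 'b) root_oracle"
  assumes oracle_subalgebra: "\<And>i. subalgebra \<mu> (\<Sigma> i)"
    and fo_optimal: "\<And>i \<omega> t n xp Q. 1 \<le> i \<Longrightarrow> \<omega> \<in> space \<mu> \<Longrightarrow> t \<in> {1..<horizon P} \<Longrightarrow>
          n \<in> nodes P t \<Longrightarrow> xp \<in> states P (t - 1) \<Longrightarrow> Q \<in> approximations P t \<Longrightarrow>
          is_arg_min (reg_objective P n xp (\<lambda>x. ereal (Q x)))
            (\<lambda>u. u \<in> subproblem_feasible P t n) (fo i \<omega> t n xp Q)"
    and bo_optimal: "\<And>i \<omega> t n xp Q. 1 \<le> i \<Longrightarrow> \<omega> \<in> space \<mu> \<Longrightarrow> t \<in> {1..horizon P} \<Longrightarrow>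
          n \<in> nodes P t \<Longrightarrow> xp \<in> states P (t - 1) \<Longrightarrow> Q \<in> approximations P t \<Longrightarrow>
          is_arg_max (inner_value P t n xp Q) (\<lambda>u. u \<in> multipliers P t n) (bo i \<omega> t n xp Q)"
    and ro_optimal: "\<And>i \<omega> Q. \<omega> \<in> space \<mu> \<Longrightarrow> Q \<in> approximations P 0 \<Longrightarrow>
          is_arg_min (root_objective P (\<lambda>x. ereal (Q x)))
            (\<lambda>u. u \<in> feas P (rootnode P)) (ro i \<omega> Q)"
    and fo_measurable: "\<And>i t n. 1 \<le> i \<Longrightarrow> t \<in> {1..<horizon P} \<Longrightarrow> n \<in> nodes P t \<Longrightarrow>
          measurable_oracle (\<Sigma> i) (states P (t - 1)) (states P t) (approximations P t)
            (\<lambda>\<omega>. fo i \<omega> t n)"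
    and bo_measurable: "\<And>i t n. 1 \<le> i \<Longrightarrow> t \<in> {1..horizon P} \<Longrightarrow> n \<in> nodes P t \<Longrightarrow>
          measurable_oracle (\<Sigma> i) (states P (t - 1)) (states P t) (approximations P t)
            (\<lambda>\<omega>. bo i \<omega> t n)"
    and ro_measurable: "\<And>i. measurable_oracle (\<Sigma> i) {0} (states P 0) (approximations P 0)
            (\<lambda>\<omega> _. ro i \<omega>)"

definition sample_indices :: "('n, 'a, 'b) mssp \<Rightarrow> nat \<Rightarrow> (nat \<times> nat \<times> nat) set" where
  "sample_indices P M = {1..} \<times> {1..M} \<times> {1..horizon P}"

definition other_information ::
    "'w measure \<Rightarrow> (nat \<Rightarrow> 'w measure) \<Rightarrow> ('n, 'a, 'b) mssp \<Rightarrow> nat \<Rightarrow>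
     (nat \<Rightarrow> nat \<Rightarrow> nat \<Rightarrow> 'w \<Rightarrow> 'n) \<Rightarrow> nat \<times> nat \<times> nat \<Rightarrow> 'w measure" where
  "other_information \<mu> \<Sigma> P M scen k = sigma (space \<mu>)
     ((\<Union>i. sets (\<Sigma> i)) \<union>
      {scen i j t -` A \<inter> space \<mu> | i j t A. (i, j, t) \<in> sample_indices P M - {k} \<and> A \<subseteq> nodes P t})"

locale uniform_sampling = sddp_oracles \<mu> \<Sigma> P fo bo ro
  for \<mu> :: "'w measure" and \<Sigma> :: "nat \<Rightarrow> 'w measure"
    and P :: "('n, 'a::euclidean_space, 'b::euclidean_space) mssp"
    and fo bo ro +
  fixes M :: nat
    and scen :: "nat \<Rightarrow> nat \<Rightarrow> nat \<Rightarrow> 'w \<Rightarrow> 'n"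
  assumes path_measurable: "\<And>i j t. (i, j, t) \<in> sample_indices P M \<Longrightarrow>
          scen i j t \<in> measurable \<mu> (count_space (nodes P t))"
    and path_uniform: "\<And>i j t n. (i, j, t) \<in> sample_indices P M \<Longrightarrow> n \<in> nodes P t \<Longrightarrow>
          AE \<omega> in \<mu>. real_cond_exp \<mu> (other_information \<mu> \<Sigma> P M scen (i, j, t))
            (indicator {\<omega> \<in> space \<mu>. scen i j t \<omega> = n}) \<omega> = 1 / real (card (nodes P t))"

end

(* The gap of an approximation at a state is the amount by which it underestimates the cost-to-go QR.
   If the root node solution is not eps-optimal, its gap exceeds eps = delta_0 + ... + delta_(T-1), since
   by exactness the approximate optimal value is at most v_reg.  Descending from there to children with
   gap more than delta_t + ... + delta_(T-1) as long as possible, one meets a state at some stage t with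
   a gap above this threshold whose children have gaps at most delta_(t+1) + ... + delta_(T-1); when a
   sampled path leads there, the backward pass lowers the gap to at most the latter.  By Lipschitz
   continuity the states of stage t improved in this way are delta_t / (2 L_t) apart, so a volume argument
   allows at most I successful iterations.  Each iteration with a root node solution that is not yet
   eps-optimal is successful with probability at least nu, because one of at most N path prefixes has to
   be hit by one of M paths.

   The probabilistic part is reduced to counting: the oracles are independent of the uniform paths, so
   it suffices to bound, for every fixed outcome of the oracles, the number of path arrays along
   which the algorithm has not yet succeeded.  This is done with the generating function of the number
   of successes (a Chernoff bound). *)

theory Submission
  imports Defs
begin

section \<open>Norms on subspaces and packing\<close>

text \<open>Cuts underestimate the original cost-to-go functions but need not stay below
  \<open>QR\<close>, since the multiplier bounds may exceed the penalty factors; so some gaps may be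
  negative, and these simply count as small. Only at the root is an upper bound by
  \<open>v_reg\<close> required. Exactness supplies it by turning an optimal policy of the
  regularized tree problem into an equally cheap solution of the original problem.

  The \<open>1 +\<close> in the tail bound is a shift of indices: iteration \<open>k\<close> starts
  from the root solution of iteration \<open>k - 1\<close>, and \<iota> ignores the initial one, so
  \<open>m\<close> solutions that are not yet optimal make iterations \<open>2\<close> to
  \<open>m + 1\<close> active. The factor 2 in \<open>2 * L t\<close> arises because the gap is a
  difference of two \<open>L t\<close>-Lipschitz functions.

  Oracles may break ties in any way and may be correlated over iterations. Exchanging the count over
  arrays with the average over outcomes requires that, along every fixed array, non-optimality is an
  event of the oracle filtration. The obstacle there is the dual value, a supremum of infima over
  uncountable sets.\<close>

context
  fixes V :: "'a::euclidean_space set" and nm :: "'a \<Rightarrow> real"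
  assumes sub: "subspace V" and nm: "norm_on V nm"
begin

lemma norm_on_nonneg: "x \<in> V \<Longrightarrow> 0 \<le> nm x"
  using nm by (auto simp: norm_on_def)

lemma norm_on_eq_0_iff: "x \<in> V \<Longrightarrow> nm x = 0 \<longleftrightarrow> x = 0"
  using nm by (auto simp: norm_on_def)

lemma norm_on_zero: "nm 0 = 0"
  using norm_on_eq_0_iff subspace_0[OF sub] by blast

lemma norm_on_scaleR: "x \<in> V \<Longrightarrow> nm (c *\<^sub>R x) = \<bar>c\<bar> * nm x"
  using nm by (auto simp: norm_on_def)

lemma norm_on_add: "x \<in> V \<Longrightarrow> y \<in> V \<Longrightarrow> nm (x + y) \<le> nm x + nm y"
  using nm by (auto simp: norm_on_def)

lemma norm_on_minus: "x \<in> V \<Longrightarrow> nm (- x) = nm x"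
  using norm_on_scaleR[of x "-1"] by simp

lemma norm_on_minus_commute: "x \<in> V \<Longrightarrow> y \<in> V \<Longrightarrow> nm (x - y) = nm (y - x)"
  using norm_on_minus[of "x - y"] subspace_diff[OF sub] by simp

lemma norm_on_triangle: "x \<in> V \<Longrightarrow> y \<in> V \<Longrightarrow> z \<in> V \<Longrightarrow> nm (x - z) \<le> nm (x - y) + nm (y - z)"
  using norm_on_add[of "x - y" "y - z"] subspace_diff[OF sub] by simp

lemma norm_on_abs_diff_le: "x \<in> V \<Longrightarrow> y \<in> V \<Longrightarrow> \<bar>nm x - nm y\<bar> \<le> nm (x - y)"
  using norm_on_triangle[of x y 0] norm_on_triangle[of y x 0] norm_on_minus_commute[of x y]
    subspace_0[OF sub] by auto

lemma norm_on_sum: "finite A \<Longrightarrow> (\<And>a. a \<in> A \<Longrightarrow> f a \<in> V) \<Longrightarrow> nm (sum f A) \<le> (\<Sum>a\<in>A. nm (f a))"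
proof (induction A rule: finite_induct)
  case (insert a A)
  have "sum f A \<in> V" using insert by (intro subspace_sum[OF sub]) auto
  then have "nm (f a + sum f A) \<le> nm (f a) + nm (sum f A)"
    using insert by (intro norm_on_add) auto
  then show ?case using insert by auto
qed (simp add: norm_on_zero)

text \<open>Coordinates in an orthonormal basis of \<open>V\<close> are bounded by the Euclidean
  norm. The summand 1 in the constant keeps it positive for the trivial subspace, whose basis is
  empty.\<close>

lemma norm_on_upper: obtains C where "0 < C" "\<And>x. x \<in> V \<Longrightarrow> nm x \<le> C * norm x"
proof -
  obtain B where B: "B \<subseteq> V" "pairwise orthogonal B" "\<And>x. x \<in> B \<Longrightarrow> norm x = 1"
    "independent B" "card B = dim V" "span B = V"
    using orthonormal_basis_subspace[OF sub] by blast
  have fin: "finite B" using B(4) by (rule independent_imp_finite)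
  have bound: "nm x \<le> ((\<Sum>b\<in>B. nm b) + 1) * norm x" if x: "x \<in> V" for x
  proof -
    have "x = (\<Sum>b\<in>B. (x \<bullet> b) *\<^sub>R b)"
      using orthonormal_basis_expand[OF B(2) B(3) _ fin] x B(6) by metis
    then have "nm x \<le> (\<Sum>b\<in>B. nm ((x \<bullet> b) *\<^sub>R b))"
      using norm_on_sum[OF fin, of "\<lambda>b. (x \<bullet> b) *\<^sub>R b"] B(1) subspace_scale[OF sub] by (metis subsetD)
    also have "\<dots> = (\<Sum>b\<in>B. \<bar>x \<bullet> b\<bar> * nm b)"
      using B(1) by (intro sum.cong refl norm_on_scaleR) auto
    also have "\<dots> \<le> (\<Sum>b\<in>B. norm x * nm b)"
    proof (intro sum_mono mult_right_mono)
      fix b assume b: "b \<in> B"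
      then show "\<bar>x \<bullet> b\<bar> \<le> norm x" using Cauchy_Schwarz_ineq2[of x b] B(3) by simp
      show "0 \<le> nm b" using b B(1) norm_on_nonneg by auto
    qed
    also have "\<dots> = (\<Sum>b\<in>B. nm b) * norm x" by (simp add: sum_distrib_left mult.commute)
    also have "\<dots> \<le> ((\<Sum>b\<in>B. nm b) + 1) * norm x" by (intro mult_right_mono) auto
    finally show ?thesis .
  qed
  have "0 \<le> (\<Sum>b\<in>B. nm b)" using B(1) norm_on_nonneg by (intro sum_nonneg) auto
  then show ?thesis using that[of "(\<Sum>b\<in>B. nm b) + 1"] bound by simp
qed

lemma norm_on_continuous: "continuous_on V nm"
proof -
  obtain C where C: "0 < C" "\<And>x. x \<in> V \<Longrightarrow> nm x \<le> C * norm x" using norm_on_upper by blast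
  have "C-lipschitz_on V nm"
  proof (rule lipschitz_onI)
    fix x y assume "x \<in> V" "y \<in> V"
    then show "dist (nm x) (nm y) \<le> C * dist x y"
      using norm_on_abs_diff_le[of x y] C(2)[of "x - y"] subspace_diff[OF sub]
      by (fastforce simp: dist_norm)
  qed (use C in simp)
  then show ?thesis by (rule lipschitz_on_continuous_on)
qed

text \<open>The continuous function \<open>nm\<close> attains a positive minimum on the compact unit
  sphere of \<open>V\<close>; homogeneity does the rest. The trivial subspace has an empty sphere
  and is treated apart.\<close>

lemma norm_on_lower: obtains c where "0 < c" "\<And>x. x \<in> V \<Longrightarrow> c * norm x \<le> nm x"
proof (cases "V \<subseteq> {0}")
  case True
  then have "1 * norm x \<le> nm x" if "x \<in> V" for x using that norm_on_zero by auto
  then show ?thesis using that[of 1] by simp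
next
  case False
  then obtain v where v: "v \<in> V" "v \<noteq> 0" by blast
  let ?S = "sphere 0 1 \<inter> V"
  have "compact ?S" using closed_subspace[OF sub] by (intro compact_Int_closed) auto
  moreover have "(1 / norm v) *\<^sub>R v \<in> ?S" using v subspace_scale[OF sub] by auto
  ultimately obtain s where s: "s \<in> ?S" "\<And>x. x \<in> ?S \<Longrightarrow> nm s \<le> nm x"
    using continuous_attains_inf[of ?S nm] continuous_on_subset[OF norm_on_continuous, of ?S] by blast
  have pos: "0 < nm s" using s(1) norm_on_nonneg[of s] norm_on_eq_0_iff[of s] by force
  have "nm s * norm x \<le> nm x" if x: "x \<in> V" for x
  proof (cases "x = 0")
    case False
    have "(1 / norm x) *\<^sub>R x \<in> ?S" using x False subspace_scale[OF sub] by auto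
    then have "nm s \<le> nm ((1 / norm x) *\<^sub>R x)" by (rule s(2))
    also have "\<dots> = nm x / norm x" using x norm_on_scaleR by simp
    finally show ?thesis using False by (simp add: field_simps)
  qed (simp add: norm_on_zero)
  then show ?thesis using that pos by blast
qed

text \<open>A supremum of reals is informative only when bounded. The lower estimate of
  \<open>nm\<close> confines its unit ball to a Euclidean ball.\<close>

lemma dual_norm_bdd: "bdd_above ((\<lambda>x. l \<bullet> x) ` {x \<in> V. nm x \<le> 1})"
proof -
  obtain c where c: "0 < c" "\<And>x. x \<in> V \<Longrightarrow> c * norm x \<le> nm x" using norm_on_lower by blast
  show ?thesis
  proof (rule bdd_aboveI2)
    fix x assume x: "x \<in> {x \<in> V. nm x \<le> 1}"
    then have "norm x \<le> 1 / c" using c(2)[of x] c(1) by (simp add: field_simps)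
    then show "l \<bullet> x \<le> norm l * (1 / c)"
      using norm_cauchy_schwarz[of l x] mult_left_mono[of "norm x" "1 / c" "norm l"] by simp
  qed
qed

lemma inner_le_dual_norm:
  assumes x: "x \<in> V" and l: "dual_norm V nm l \<le> b"
  shows "\<bar>l \<bullet> x\<bar> \<le> b * nm x"
proof -
  have *: "l \<bullet> y \<le> b * nm y" if y: "y \<in> V" for y
  proof (cases "y = 0")
    case False
    then have pos: "0 < nm y" using y norm_on_nonneg[of y] norm_on_eq_0_iff[of y] by force
    have "nm ((1 / nm y) *\<^sub>R y) \<le> 1" using pos y norm_on_scaleR by simp
    then have "l \<bullet> ((1 / nm y) *\<^sub>R y) \<le> dual_norm V nm l"
      unfolding dual_norm_def using y subspace_scale[OF sub]
      by (intro cSUP_upper dual_norm_bdd) auto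
    then have "(l \<bullet> y) / nm y \<le> b" using l by simp
    then show ?thesis using pos by (simp add: field_simps)
  qed (simp add: norm_on_zero)
  show ?thesis using *[OF x] *[of "-x"] x subspace_neg[OF sub] norm_on_minus by fastforce
qed

lemma dual_norm_leI:
  assumes "\<And>x. x \<in> V \<Longrightarrow> l \<bullet> x \<le> b * nm x" and "0 \<le> b"
  shows "dual_norm V nm l \<le> b"
  unfolding dual_norm_def
proof (rule cSUP_least)
  show "{x \<in> V. nm x \<le> 1} \<noteq> {}" using norm_on_zero subspace_0[OF sub] by force
  fix x assume x: "x \<in> {x \<in> V. nm x \<le> 1}"
  have "l \<bullet> x \<le> b * nm x" using x assms by auto
  also have "\<dots> \<le> b * 1" using x assms(2) by (intro mult_left_mono) auto
  finally show "l \<bullet> x \<le> b" by simp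
qed

text \<open>The volume is taken in the whole space: the coordinates of a subset of the standard basis
  parametrize \<open>V\<close>, the remaining ones are confined to a unit cube.\<close>

lemma packing_bound:
  assumes fin: "finite X" and c: "c \<in> V" and X: "X \<subseteq> {x \<in> V. nm (x - c) \<le> D / 2}"
    and r: "0 < r" and D: "0 \<le> D"
    and sep: "\<And>x y. x \<in> X \<Longrightarrow> y \<in> X \<Longrightarrow> x \<noteq> y \<Longrightarrow> r \<le> nm (x - y)"
  shows "real (card X) \<le> (1 + D / r) ^ dim V"
proof -
  obtain B where B: "B \<subseteq> V" "pairwise orthogonal B" "\<And>x. x \<in> B \<Longrightarrow> norm x = 1"
    "independent B" "card B = dim V" "span B = V"
    using orthonormal_basis_subspace[OF sub] by blast
  have finB: "finite B" using B(4) by (rule independent_imp_finite)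
  have "dim V \<le> card (Basis :: 'a set)" using dim_subset_UNIV[of V] by simp
  then obtain B' where B': "B' \<subseteq> (Basis :: 'a set)" "card B' = dim V"
    by (meson obtain_subset_with_card_n)
  have finB': "finite B'" using B'(1) finite_Basis finite_subset by blast
  obtain \<phi> where \<phi>: "bij_betw \<phi> B' B"
    using finite_same_card_bij[OF finB' finB] B'(2) B(5) by auto
  \<comment> \<open>\<open>h\<close> transports the \<open>B'\<close> coordinates isometrically to
    \<open>V\<close> and forgets the others; \<open>g\<close> is a right inverse of it on
    \<open>V\<close>.\<close>
  define h where "h = (\<lambda>x. \<Sum>b\<in>B'. (x \<bullet> b) *\<^sub>R \<phi> b)"
  define g where "g = (\<lambda>v. \<Sum>b\<in>B'. (v \<bullet> \<phi> b) *\<^sub>R b)"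
  have \<phi>V: "b \<in> B' \<Longrightarrow> \<phi> b \<in> V" for b using \<phi> B(1) by (auto simp: bij_betw_def)
  have hV: "h x \<in> V" for x unfolding h_def using \<phi>V by (intro subspace_sum[OF sub] subspace_scale[OF sub])
  have hdiff: "h (x - y) = h x - h y" for x y
    by (simp add: h_def algebra_simps sum_subtractf)
  have hscale: "h (\<Sum>b\<in>Basis. ((if b \<in> B' then \<rho> else 1) * (x \<bullet> b)) *\<^sub>R b) = \<rho> *\<^sub>R h x" for x \<rho>
  proof -
    have "(\<Sum>b\<in>Basis. ((if b \<in> B' then \<rho> else 1) * (x \<bullet> b)) *\<^sub>R b) \<bullet> b' = \<rho> * (x \<bullet> b')"
      if "b' \<in> B'" for b'
      using that B'(1) by (simp add: inner_sum_left inner_Basis if_distrib[of "\<lambda>u. _ * u"] subset_iff cong: if_cong)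
    then show ?thesis by (simp add: h_def scaleR_sum_right)
  qed
  have gB: "g v \<bullet> b = (if b \<in> B' then v \<bullet> \<phi> b else 0)" if "b \<in> Basis" for v b
  proof -
    have "g v \<bullet> b = (\<Sum>b'\<in>B'. (if b' = b then v \<bullet> \<phi> b else 0))"
      unfolding g_def inner_sum_left using that B'(1)
      by (intro sum.cong) (auto simp: inner_Basis)
    then show ?thesis using finB' by simp
  qed
  have hg: "h (g v) = v" if "v \<in> V" for v
  proof -
    have "h (g v) = (\<Sum>b\<in>B'. (v \<bullet> \<phi> b) *\<^sub>R \<phi> b)"
      unfolding h_def using gB B'(1) by (intro sum.cong) auto
    also have "\<dots> = (\<Sum>b\<in>B. (v \<bullet> b) *\<^sub>R b)" by (rule sum.reindex_bij_betw[OF \<phi>])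
    also have "\<dots> = v" using orthonormal_basis_expand[OF B(2) B(3) _ finB] that B(6) by metis
    finally show ?thesis .
  qed
  have hinner: "h x \<bullet> \<phi> b = x \<bullet> b" if b: "b \<in> B'" for x b
  proof -
    have "\<phi> b' \<bullet> \<phi> b = (if b' = b then 1 else 0)" if b': "b' \<in> B'" for b'
    proof (cases "b' = b")
      case True then show ?thesis using B(3)[of "\<phi> b"] b \<phi> by (auto simp: bij_betw_def norm_eq_1)
    next
      case False
      then have "\<phi> b' \<noteq> \<phi> b" "\<phi> b' \<in> B" "\<phi> b \<in> B" using \<phi> b b' by (auto simp: bij_betw_def inj_on_def)
      then show ?thesis using B(2) False by (auto simp: pairwise_def orthogonal_def)
    qed
    then have "h x \<bullet> \<phi> b = (\<Sum>b'\<in>B'. if b' = b then x \<bullet> b else 0)"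
      unfolding h_def inner_sum_left by (intro sum.cong) auto
    then show ?thesis using finB' b by simp
  qed
  have h_cont: "continuous_on UNIV h" unfolding h_def by (intro continuous_intros)
  have nmh_cont: "continuous_on UNIV (\<lambda>x. nm (h x - u))" if "u \<in> V" for u
    by (rule continuous_on_compose2[OF norm_on_continuous])
      (use that hV h_cont subspace_diff[OF sub] in \<open>auto intro!: continuous_intros\<close>)
  \<comment> \<open>A cylinder over the open ball of radius \<rho> around \<open>u\<close>. Without
    the cube in the complementary coordinates its volume would be infinite for a proper
    subspace.\<close>
  define U where "U = (\<lambda>u \<rho>. {x. nm (h x - u) < \<rho> \<and> (\<forall>b\<in>Basis - B'. \<bar>x \<bullet> b\<bar> < 1)})"
  have open_U: "open (U u \<rho>)" if "u \<in> V" for u \<rho>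
  proof -
    have "U u \<rho> = {x. nm (h x - u) < \<rho>} \<inter> (\<Inter>b\<in>Basis - B'. {x. \<bar>x \<bullet> b\<bar> < 1})"
      by (auto simp: U_def)
    then show ?thesis
      by (auto intro!: open_Int open_INT open_Collect_less nmh_cont that continuous_intros)
  qed
  have meas_U: "U u \<rho> \<in> sets lborel" if "u \<in> V" for u \<rho> using open_U[OF that] by simp
  obtain k where k: "0 < k" "\<And>x. x \<in> V \<Longrightarrow> k * norm x \<le> nm x" using norm_on_lower by blast
  have 0: "0 \<in> V" using subspace_0[OF sub] .
  have bounded_U: "bounded (U 0 1)"
  proof (rule boundedI)
    fix x assume x: "x \<in> U 0 1"
    have "\<bar>x \<bullet> b\<bar> \<le> 1 / k + 1" if b: "b \<in> Basis" for b
    proof (cases "b \<in> B'")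
      case True
      have "k * norm (h x) \<le> 1" using k(2)[OF hV[of x]] x by (simp add: U_def)
      moreover have "\<bar>x \<bullet> b\<bar> \<le> norm (h x)"
        using hinner[OF True, of x] Cauchy_Schwarz_ineq2[of "h x" "\<phi> b"] B(3) \<phi> True
        by (auto simp: bij_betw_def)
      ultimately show ?thesis using k(1) by (simp add: field_simps) (smt (verit) mult_mono)
    next
      case False
      then have "\<bar>x \<bullet> b\<bar> < 1" using x b by (auto simp: U_def)
      moreover have "0 \<le> 1 / k" using k(1) by simp
      ultimately show ?thesis by linarith
    qed
    then have "(\<Sum>b\<in>Basis. \<bar>x \<bullet> b\<bar>) \<le> (\<Sum>b\<in>(Basis :: 'a set). 1 / k + 1)" by (rule sum_mono)
    then show "norm x \<le> (\<Sum>b\<in>(Basis :: 'a set). 1 / k + 1)" using norm_le_l1[of x] by linarith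
  qed
  have "0 \<in> U 0 1" by (simp add: U_def h_def norm_on_zero)
  then have "\<not> negligible (U 0 1)" using open_U[OF 0, of 1] open_not_negligible by blast
  then have "emeasure lborel (U 0 1) \<noteq> 0"
    using meas_U[OF 0, of 1] null_sets_completionI[of "U 0 1" lborel]
    by (auto simp: negligible_iff_null_sets null_sets_def)
  moreover have finU1: "emeasure lborel (U 0 1) < \<infinity>" using emeasure_bounded_finite[OF bounded_U] by simp
  ultimately have pos1: "0 < measure lborel (U 0 1)"
    by (simp add: measure_def enn2real_positive_iff zero_less_iff_neq_zero)
  have scale: "emeasure lborel (U u \<rho>) = ennreal (\<rho> ^ dim V * measure lborel (U 0 1))"
    if \<rho>: "0 < \<rho>" and u: "u \<in> V" for \<rho> u
  proof -
    \<comment> \<open>The affine map \<open>?T\<close> stretches only the \<open>B'\<close>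
      coordinates and thus leaves the cube alone. It pulls \<open>U u \<rho>\<close> back to
      \<open>U 0 1\<close>, and its Jacobian determinant is \<open>\<rho> ^ dim V\<close>.\<close>
    let ?c = "\<lambda>b. if b \<in> B' then \<rho> else 1"
    let ?T = "\<lambda>x. g u + (\<Sum>b\<in>Basis. (?c b * (x \<bullet> b)) *\<^sub>R b)"
    have hT: "h (?T x) = u + \<rho> *\<^sub>R h x" for x
      using hdiff[of "?T x" "g u"] hscale[of \<rho> x] hg[OF u] by (simp add: algebra_simps)
    have TB: "?T x \<bullet> b = x \<bullet> b" if "b \<in> Basis - B'" for x b
      using that gB[of b u] by (simp add: inner_add_left inner_sum_left inner_Basis if_distrib[of "\<lambda>u. _ * u"] cong: if_cong)
    have vim: "?T -` U u \<rho> = U 0 1"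
      using hT TB \<rho> norm_on_scaleR[OF hV] by (auto simp: U_def)
    have "emeasure lborel (U u \<rho>) = emeasure (density (distr lborel borel ?T) (\<lambda>_. \<Prod>j\<in>Basis. \<bar>?c j\<bar>)) (U u \<rho>)"
      using lborel_affine_euclidean[of ?c "g u"] \<rho> by (simp add: ennreal_1)
    also have "\<dots> = (\<Prod>j\<in>Basis. ennreal \<bar>?c j\<bar>) * emeasure (distr lborel borel ?T) (U u \<rho>)"
      using meas_U[OF u, of \<rho>] by (subst emeasure_density_const) (auto simp: prod_ennreal)
    also have "emeasure (distr lborel borel ?T) (U u \<rho>) = emeasure lborel (U 0 1)"
      using meas_U[OF u, of \<rho>] vim by (subst emeasure_distr) auto
    also have "(\<Prod>j\<in>Basis. ennreal \<bar>?c j\<bar>) = ennreal (\<Prod>j\<in>Basis. \<bar>?c j\<bar>)" by (simp add: prod_ennreal)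
    also have "(\<Prod>j\<in>Basis. \<bar>?c j\<bar>) = (\<Prod>j\<in>Basis. if j \<in> B' then \<rho> else 1)"
      using \<rho> by (intro prod.cong) auto
    also have "\<dots> = (\<Prod>j\<in>B'. \<rho>)" using B'(1) by (simp add: prod.If_cases Int_absorb1)
    also have "\<dots> = \<rho> ^ dim V" using B'(2) by simp
    finally show ?thesis using \<rho> finU1 by (simp add: emeasure_eq_ennreal_measure ennreal_mult)
  qed
  \<comment> \<open>The cylinders use strict inequalities, so they are disjoint even for centres at
    distance exactly \<open>r\<close>.\<close>
  have disj: "disjoint_family_on (\<lambda>x. U x (r / 2)) X"
    unfolding disjoint_family_on_def
  proof (intro ballI impI)
    fix x y assume xy: "x \<in> X" "y \<in> X" "x \<noteq> y"
    show "U x (r / 2) \<inter> U y (r / 2) = {}"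
    proof (rule ccontr)
      assume "U x (r / 2) \<inter> U y (r / 2) \<noteq> {}"
      then obtain w where "nm (h w - x) < r / 2" "nm (h w - y) < r / 2" by (auto simp: U_def)
      then show False using norm_on_triangle[of x "h w" y] norm_on_minus_commute[of x "h w"] hV[of w] xy X sep[of x y]
        by fastforce
    qed
  qed
  \<comment> \<open>All cylinders of radius \<open>r / 2\<close> fit into one of radius
    \<open>D / 2 + r / 2\<close>; the quotient of the radii is \<open>1 + D / r\<close>, the base of
    the bound.\<close>
  have incl: "(\<Union>x\<in>X. U x (r / 2)) \<subseteq> U c (D / 2 + r / 2)"
  proof
    fix w assume "w \<in> (\<Union>x\<in>X. U x (r / 2))"
    then obtain x where x: "x \<in> X" "w \<in> U x (r / 2)" by blast
    have "nm (h w - c) \<le> nm (h w - x) + nm (x - c)"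
      using x X c hV[of w] by (intro norm_on_triangle) auto
    also have "\<dots> < D / 2 + r / 2" using x X by (auto simp: U_def add_strict_mono)
    finally show "w \<in> U c (D / 2 + r / 2)" using x by (auto simp: U_def)
  qed
  have "(\<Sum>x\<in>X. emeasure lborel (U x (r / 2))) = emeasure lborel (\<Union>x\<in>X. U x (r / 2))"
    using X meas_U disj fin by (intro sum_emeasure) auto
  also have "\<dots> \<le> emeasure lborel (U c (D / 2 + r / 2))"
    using incl meas_U[OF c] by (intro emeasure_mono) auto
  also have "(\<Sum>x\<in>X. emeasure lborel (U x (r / 2))) = (\<Sum>x\<in>X. ennreal ((r / 2) ^ dim V * measure lborel (U 0 1)))"
    using X r by (intro sum.cong scale) auto
  also have "\<dots> = ennreal (real (card X) * ((r / 2) ^ dim V * measure lborel (U 0 1)))"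
    using r pos1 by (simp add: ennreal_mult ennreal_of_nat_eq_real_of_nat)
  also have "emeasure lborel (U c (D / 2 + r / 2)) = ennreal ((D / 2 + r / 2) ^ dim V * measure lborel (U 0 1))"
    using c r D by (intro scale) auto
  finally have "(real (card X) * (r / 2) ^ dim V) * measure lborel (U 0 1)
      \<le> (D / 2 + r / 2) ^ dim V * measure lborel (U 0 1)"
    using r D pos1 by (subst (asm) ennreal_le_iff) (auto simp: mult.assoc)
  then have "real (card X) * (r / 2) ^ dim V \<le> (D / 2 + r / 2) ^ dim V"
    using pos1 by (rule mult_right_le_imp_le)
  then have "real (card X) \<le> (D / 2 + r / 2) ^ dim V / (r / 2) ^ dim V"
    using r by (subst pos_le_divide_eq) auto
  also have "\<dots> = (1 + D / r) ^ dim V" using r 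
    by (subst power_divide[symmetric]) (simp add: add_divide_distrib add.commute)
  finally show ?thesis .
qed

end

section \<open>Lower semicontinuity and counting\<close>

lemma lsc_on_iff:
  "lsc_on S g \<longleftrightarrow> (\<forall>s\<in>S. \<forall>c<g s. \<forall>\<^sub>F u in at s within S. c < g u)"
  by (simp add: lsc_on_def le_Liminf_iff)

lemma lsc_on_closed_sublevel:
  fixes S :: "'a::first_countable_topology set"
  assumes "closed S" "lsc_on S g"
  shows "closed {s \<in> S. g s \<le> c}"
  unfolding closed_sequential_limits
proof (intro allI impI)
  fix x l assume x: "(\<forall>n. x n \<in> {s \<in> S. g s \<le> c}) \<and> x \<longlonglongrightarrow> l"
  then have l: "l \<in> S" using assms(1) closed_sequentially[of S x l] by auto
  show "l \<in> {s \<in> S. g s \<le> c}"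
  proof (rule ccontr)
    assume "l \<notin> {s \<in> S. g s \<le> c}"
    then have gl: "c < g l" using l by auto
    then have "\<forall>\<^sub>F u in at l within S. c < g u" using assms(2) l by (auto simp: lsc_on_iff)
    \<comment> \<open>The filter \<open>at l within S\<close> omits \<open>l\<close> itself, a value
      that the sequence may take; \<open>gl\<close> covers this point.\<close>
    then have "\<forall>\<^sub>F u in nhds l. u \<in> S \<longrightarrow> c < g u"
      unfolding eventually_at_filter using gl by (auto elim!: eventually_mono)
    then have "\<forall>\<^sub>F n in sequentially. x n \<in> S \<longrightarrow> c < g (x n)"
      using x by (auto simp: filterlim_iff)
    then obtain n where "x n \<in> S \<longrightarrow> c < g (x n)" by (auto simp: eventually_sequentially)
    then show False using x leD by auto
  qed
qed

text \<open>A point common to all sublevel sets at attained values is a minimizer. Finitely many of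
  these sets always share the best of the chosen points, so compactness gives a common point of
  all.\<close>

lemma lsc_on_attains_inf:
  fixes S :: "'a::{first_countable_topology, t2_space} set"
  assumes "compact S" "S \<noteq> {}" "lsc_on S g"
  obtains s where "s \<in> S" "\<And>u. u \<in> S \<Longrightarrow> g s \<le> g u"
proof -
  have "S \<inter> (\<Inter>u\<in>S. {s \<in> S. g s \<le> g u}) \<noteq> {}"
  proof (rule compact_imp_fip_image[OF assms(1)])
    show "closed {s \<in> S. g s \<le> g u}" for u
      using assms compact_imp_closed by (intro lsc_on_closed_sublevel) auto
    fix I assume I: "finite I" "I \<subseteq> S"
    show "S \<inter> (\<Inter>u\<in>I. {s \<in> S. g s \<le> g u}) \<noteq> {}"
    proof (cases "I = {}")
      case False
      then obtain s where "s \<in> I" "\<And>u. u \<in> I \<Longrightarrow> g s \<le> g u"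
        using I by (metis arg_min_if_finite(1) arg_min_least)
      then show ?thesis using I by blast
    qed (use assms in auto)
  qed
  then show ?thesis using that by blast
qed

lemma lsc_on_add_continuous:
  fixes h :: "'a::topological_space \<Rightarrow> real"
  assumes "lsc_on S g" "continuous_on S h"
  shows "lsc_on S (\<lambda>s. g s + ereal (h s))"
  unfolding lsc_on_iff
proof (intro ballI allI impI)
  fix s c assume s: "s \<in> S" and c: "c < g s + ereal (h s)"
  have "c - ereal (h s) < g s" using c by (simp add: ereal_minus_less)
  \<comment> \<open>The reals \<open>d\<close> and \<open>c' - d\<close> are bounds for the two
    summands separately; this also works when \<open>g s\<close> is infinite.\<close>
  then obtain d where d: "c - ereal (h s) < ereal d" "ereal d < g s" using ereal_dense2 by blast
  have "c < ereal (d + h s)" using d(1) by (simp add: ereal_minus_less)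
  then obtain c' where c': "c < ereal c'" "ereal c' < ereal (d + h s)" using ereal_dense2 by blast
  have "\<forall>\<^sub>F u in at s within S. d < g u" using assms(1) s d(2) by (auto simp: lsc_on_iff)
  moreover have "\<forall>\<^sub>F u in at s within S. c' - d < h u"
    using assms(2) s c'(2) by (auto simp: continuous_on_def intro!: order_tendstoD(1))
  ultimately show "\<forall>\<^sub>F u in at s within S. c < g u + ereal (h u)"
  proof eventually_elim
    case (elim u)
    have "ereal c' = ereal d + ereal (c' - d)" by simp
    also have "\<dots> < g u + ereal (h u)" using elim by (intro ereal_add_strict_mono2) auto
    finally show ?case using c'(1) by auto
  qed
qed

text \<open>The inner infimum is the Lipschitz regularization of \<open>c\<close>.  In contrast to \<open>c\<close> it is determined by
  its values on a dense set, so the right-hand side is a countable infimum and hence measurable in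
  every parameter of \<open>g\<close>.\<close>

lemma INF_lipschitz_regularization:
  fixes S :: "'a::metric_space set" and c :: "'a \<Rightarrow> ereal" and g :: "'a \<Rightarrow> real"
  assumes D: "D \<subseteq> S" "S \<subseteq> closure D" and R: "0 < R"
    and g: "\<And>u v. u \<in> S \<Longrightarrow> v \<in> S \<Longrightarrow> \<bar>g u - g v\<bar> \<le> R * dist u v"
  shows "(INF u\<in>S. c u + ereal (g u)) = (INF v\<in>D. (INF u\<in>S. c u + ereal (R * dist u v)) + ereal (g v))"
    (is "?l = ?r")
proof (rule antisym)
  show "?l \<le> ?r"
  proof (rule INF_greatest)
    fix v assume v: "v \<in> D"
    have "?l - ereal (g v) \<le> (INF u\<in>S. c u + ereal (R * dist u v))"
    proof (rule INF_greatest)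
      fix u assume u: "u \<in> S"
      have "?l \<le> c u + ereal (g u)" using u by (rule INF_lower)
      also have "\<dots> \<le> c u + (ereal (R * dist u v) + ereal (g v))"
        using g[of u v] u v D(1) by (intro add_left_mono) auto
      finally show "?l - ereal (g v) \<le> c u + ereal (R * dist u v)"
        by (subst ereal_minus_le) (auto simp: add.assoc)
    qed
    then show "?l \<le> (INF u\<in>S. c u + ereal (R * dist u v)) + ereal (g v)"
      by (subst (asm) ereal_minus_le) auto
  qed
  show "?r \<le> ?l"
  proof (rule INF_greatest)
    fix u assume u: "u \<in> S"
    show "?r \<le> c u + ereal (g u)"
    proof (rule ereal_le_epsilon2)
      fix e :: real assume e: "0 < e"
      \<comment> \<open>Half of \<open>e / R\<close>, because \<open>R\<close> times the distance is
        paid twice: as regularization term and in replacing \<open>g u\<close> by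
        \<open>g v\<close>.\<close>
      then have "0 < e / (2 * R)" using R by simp
      then obtain v where v: "v \<in> D" "dist v u < e / (2 * R)"
        using u D(2) closure_approachable[of u D] by blast
      have "?r \<le> (INF u\<in>S. c u + ereal (R * dist u v)) + ereal (g v)" using v(1) by (rule INF_lower)
      also have "\<dots> \<le> (c u + ereal (R * dist u v)) + ereal (g v)"
        using u by (intro add_right_mono INF_lower)
      also have "\<dots> = c u + ereal (R * dist u v + g v)" by (simp add: add.assoc)
      also have "\<dots> \<le> c u + ereal (g u + e)"
      proof -
        have "R * dist v u \<le> e / 2" using v(2) R by (simp add: field_simps)
        then show ?thesis using g[of v u] v D(1) u by (intro add_left_mono) (auto simp: dist_commute)
      qed
      also have "\<dots> = c u + ereal (g u) + ereal e" by (simp add: add.assoc)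
      finally show "?r \<le> c u + ereal (g u) + ereal e" .
    qed
  qed
qed

lemma sum_PiE_insert:
  assumes "x \<notin> S"
  shows "sum h (Pi\<^sub>E (insert x S) T) = (\<Sum>f\<in>Pi\<^sub>E S T. \<Sum>y\<in>T x. h (f(x := y)))"
proof -
  have "sum h (Pi\<^sub>E (insert x S) T) = (\<Sum>(y, f)\<in>T x \<times> Pi\<^sub>E S T. h (f(x := y)))"
    unfolding PiE_insert_eq
    by (subst sum.reindex[OF inj_combinator[OF assms]]) (auto simp: case_prod_unfold)
  also have "\<dots> = (\<Sum>y\<in>T x. \<Sum>f\<in>Pi\<^sub>E S T. h (f(x := y)))" by (simp add: sum.cartesian_product)
  finally show ?thesis by (simp add: sum.swap[of _ "T x"])
qed

section \<open>A Chernoff bound by counting arrays with few successes\<close>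

context
  fixes W :: "'w set" and act suc :: "nat \<Rightarrow> (nat \<Rightarrow> 'w) \<Rightarrow> bool" and q :: real
  assumes fin: "finite W"
    and act_cong: "\<And>k f g. (\<And>i. i \<in> {1..<k} \<Longrightarrow> f i = g i) \<Longrightarrow> act k f = act k g"
    and suc_cong: "\<And>k f g. 1 \<le> k \<Longrightarrow> (\<And>i. i \<in> {1..k} \<Longrightarrow> f i = g i) \<Longrightarrow> suc k f = suc k g"
    and fail: "\<And>k f. 2 \<le> k \<Longrightarrow> (\<And>i. i \<in> {1..<k} \<Longrightarrow> f i \<in> W) \<Longrightarrow> act k f \<Longrightarrow>
                 real (card {w \<in> W. \<not> suc k (f(k := w))}) \<le> q * real (card W)"
begin

text \<open>After an active history at most a fraction \<open>q\<close> of the choices for the next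
  coordinate fails. A success weighs \<theta> and a failure 1, so this coordinate contributes at
  most \<open>card W\<close> times \<open>\<theta> + (1 - \<theta>) * q\<close>. Arrays with an
  inactive index weigh nothing, and coordinate 1 contributes only \<open>card W\<close>.\<close>

lemma success_generating_function_le:
  assumes \<theta>: "0 \<le> \<theta>" "\<theta> \<le> 1" and q: "0 \<le> q"
  shows "(\<Sum>f\<in>Pi\<^sub>E {1..Suc m} (\<lambda>_. W).
            if \<forall>k\<in>{2..Suc m}. act k f then \<theta> ^ card {k \<in> {2..Suc m}. suc k f} else 0)
         \<le> real (card W) ^ Suc m * (\<theta> + (1 - \<theta>) * q) ^ m"
    (is "?F m \<le> _")
proof (induction m)
  case 0
  then show ?case by (simp add: card_PiE)
next
  case (Suc m)
  let ?n = "Suc (Suc m)"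
  let ?g = "\<lambda>m f. if \<forall>k\<in>{2..Suc m}. act k f then \<theta> ^ card {k \<in> {2..Suc m}. suc k f} else 0"
  have ins: "{1..?n} = insert ?n {1..Suc m}" "{2..?n} = insert ?n {2..Suc m}" by auto
  have step: "(\<Sum>w\<in>W. ?g (Suc m) (f(?n := w))) \<le> ?g m f * (real (card W) * (\<theta> + (1 - \<theta>) * q))"
    if f: "f \<in> Pi\<^sub>E {1..Suc m} (\<lambda>_. W)" for f
  proof -
    have act: "act k (f(?n := w)) = act k f" if "k \<in> {2..?n}" for k w
      by (rule act_cong) (use that in auto)
    have suc: "suc k (f(?n := w)) = suc k f" if "k \<in> {2..Suc m}" for k w
      by (rule suc_cong) (use that in auto)
    have nonneg: "0 \<le> \<theta> + (1 - \<theta>) * q" using \<theta> q by simp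
    show ?thesis
    proof (cases "\<forall>k\<in>{2..?n}. act k f")
      case True
      let ?S = "{k \<in> {2..Suc m}. suc k f}"
      have card: "card {k \<in> {2..?n}. suc k (f(?n := w))} = card ?S + (if suc ?n (f(?n := w)) then 1 else 0)" for w
      proof -
        have "{k \<in> {2..?n}. suc k (f(?n := w))} =
            (if suc ?n (f(?n := w)) then insert ?n ?S else ?S)"
          using suc unfolding ins(2) by auto
        then show ?thesis by simp
      qed
      have "?g (Suc m) (f(?n := w)) = \<theta> ^ card ?S * (if suc ?n (f(?n := w)) then \<theta> else 1)" for w
        using True act card[of w] by (auto simp del: fun_upd_apply)
      then have "(\<Sum>w\<in>W. ?g (Suc m) (f(?n := w))) =
          \<theta> ^ card ?S * (\<Sum>w\<in>W. if suc ?n (f(?n := w)) then \<theta> else 1)"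
        unfolding sum_distrib_left by (rule sum.cong[OF refl])
      moreover have "(\<Sum>w\<in>W. if suc ?n (f(?n := w)) then \<theta> else 1)
          \<le> real (card W) * (\<theta> + (1 - \<theta>) * q)"
      proof -
        have "(\<Sum>w\<in>W. if suc ?n (f(?n := w)) then \<theta> else 1) =
            (\<Sum>w\<in>W. \<theta> + (1 - \<theta>) * (if \<not> suc ?n (f(?n := w)) then 1 else 0))"
          by (intro sum.cong) auto
        also have "\<dots> = \<theta> * real (card W) + (1 - \<theta>) * real (card {w \<in> W. \<not> suc ?n (f(?n := w))})"
          using fin by (simp add: sum.distrib sum_distrib_left[symmetric] sum.inter_filter[symmetric] del: fun_upd_apply)
        also have "\<dots> \<le> \<theta> * real (card W) + (1 - \<theta>) * (q * real (card W))"
        proof (intro add_left_mono mult_left_mono)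
          show "real (card {w \<in> W. \<not> suc ?n (f(?n := w))}) \<le> q * real (card W)"
            by (rule fail) (use f True in \<open>auto simp: PiE_iff\<close>)
        qed (use \<theta> in simp)
        finally show ?thesis by (simp add: algebra_simps)
      qed
      moreover have "?g m f = \<theta> ^ card ?S" using True by simp
      ultimately show ?thesis using \<theta>(1) by (simp only: mult_left_mono zero_le_power)
    next
      case False
      then have "?g (Suc m) (f(?n := w)) = 0" for w using act by auto
      then show ?thesis using nonneg \<theta> by simp
    qed
  qed
  have "?F (Suc m) = (\<Sum>f\<in>Pi\<^sub>E {1..Suc m} (\<lambda>_. W). \<Sum>w\<in>W. ?g (Suc m) (f(?n := w)))"
    unfolding ins(1) by (rule sum_PiE_insert) auto
  also have "\<dots> \<le> (\<Sum>f\<in>Pi\<^sub>E {1..Suc m} (\<lambda>_. W). ?g m f * (real (card W) * (\<theta> + (1 - \<theta>) * q)))"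
    by (rule sum_mono[OF step])
  also have "\<dots> = ?F m * (real (card W) * (\<theta> + (1 - \<theta>) * q))" by (simp add: sum_distrib_right)
  also have "\<dots> \<le> (real (card W) ^ Suc m * (\<theta> + (1 - \<theta>) * q) ^ m) * (real (card W) * (\<theta> + (1 - \<theta>) * q))"
    using \<theta> q by (intro mult_right_mono Suc.IH) auto
  finally show ?case by (simp add: mult_ac)
qed

text \<open>Markov's inequality for the weight of the previous lemma: with at most \<open>I\<close>
  successes every array that is active throughout weighs at least
  \<open>\<theta> powr I\<close>.\<close>

lemma few_successes_bound:
  assumes \<nu>: "q = 1 - \<nu>" "0 < \<nu>" "\<nu> \<le> 1" and \<kappa>: "1 < \<kappa>" and I: "0 \<le> I"
    and m: "\<kappa> * I / \<nu> \<le> real m"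
    and few: "\<And>f. f \<in> Pi\<^sub>E {1..Suc m} (\<lambda>_. W) \<Longrightarrow> real (card {k \<in> {2..Suc m}. suc k f}) \<le> I"
  shows "real (card {f \<in> Pi\<^sub>E {1..Suc m} (\<lambda>_. W). \<forall>k\<in>{2..Suc m}. act k f})
    \<le> real (card W) ^ Suc m * exp (- (I * \<nu> * (\<kappa> - 1)\<^sup>2) / (16 * \<kappa>))"
proof -
  \<comment> \<open>The choice \<open>1 / \<kappa>\<close> minimizes
    \<open>exp (- (1 - \<theta>) * \<kappa> * I) / \<theta> powr I\<close>, the bound that results
    from \<open>\<kappa> * I \<le> \<nu> * m\<close>.\<close>
  let ?F = "Pi\<^sub>E {1..Suc m} (\<lambda>_. W)" and ?\<theta> = "1 / \<kappa>"
  have finF: "finite ?F" using fin by (intro finite_PiE) auto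
  have "real (card {f \<in> ?F. \<forall>k\<in>{2..Suc m}. act k f}) * ?\<theta> powr I =
      (\<Sum>f\<in>?F. if \<forall>k\<in>{2..Suc m}. act k f then ?\<theta> powr I else 0)"
    using finF by (simp add: sum.inter_filter[symmetric])
  also have "\<dots> \<le> (\<Sum>f\<in>?F. if \<forall>k\<in>{2..Suc m}. act k f then ?\<theta> ^ card {k \<in> {2..Suc m}. suc k f} else 0)"
  proof (rule sum_mono)
    fix f assume "f \<in> ?F"
    then have "?\<theta> powr I \<le> ?\<theta> powr real (card {k \<in> {2..Suc m}. suc k f})"
      using \<kappa> few by (intro powr_mono') auto
    then show "(if \<forall>k\<in>{2..Suc m}. act k f then ?\<theta> powr I else 0) \<le>
        (if \<forall>k\<in>{2..Suc m}. act k f then ?\<theta> ^ card {k \<in> {2..Suc m}. suc k f} else 0)"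
      using \<kappa> by (simp add: powr_realpow)
  qed
  also have "\<dots> \<le> real (card W) ^ Suc m * (?\<theta> + (1 - ?\<theta>) * q) ^ m"
    using \<kappa> \<nu> by (intro success_generating_function_le) auto
  finally have 1: "real (card {f \<in> ?F. \<forall>k\<in>{2..Suc m}. act k f}) * ?\<theta> powr I
      \<le> real (card W) ^ Suc m * (?\<theta> + (1 - ?\<theta>) * q) ^ m" .
  have "?\<theta> + (1 - ?\<theta>) * q = 1 + (- ((1 - ?\<theta>) * \<nu>))" unfolding \<nu>(1) using \<kappa> by (simp add: field_simps)
  also have "\<dots> \<le> exp (- ((1 - ?\<theta>) * \<nu>))" by (rule exp_ge_add_one_self)
  finally have "(?\<theta> + (1 - ?\<theta>) * q) ^ m \<le> exp (- ((1 - ?\<theta>) * \<nu>)) ^ m"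
    using \<kappa> \<nu> by (intro power_mono) auto
  also have "\<dots> = exp (- ((1 - ?\<theta>) * (\<nu> * real m)))" by (simp add: exp_of_nat_mult[symmetric] mult_ac)
  also have "\<dots> \<le> exp (- ((1 - ?\<theta>) * (\<kappa> * I)))"
  proof -
    have "\<kappa> * I \<le> \<nu> * real m" using m \<nu>(2) by (simp add: field_simps)
    then show ?thesis using \<kappa> by (auto intro!: mult_left_mono)
  qed
  also have "(1 - ?\<theta>) * (\<kappa> * I) = (\<kappa> - 1) * I" using \<kappa> by (simp add: field_simps)
  finally have 2: "(?\<theta> + (1 - ?\<theta>) * q) ^ m \<le> exp (- ((\<kappa> - 1) * I))" .
  have 3: "?\<theta> powr I = exp (- (I * ln \<kappa>))" using \<kappa> by (simp add: powr_def ln_div)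
  have "real (card {f \<in> ?F. \<forall>k\<in>{2..Suc m}. act k f}) * exp (- (I * ln \<kappa>))
      \<le> real (card W) ^ Suc m * exp (- ((\<kappa> - 1) * I))"
    using 1 2 unfolding 3 by (meson mult_left_mono of_nat_0_le_iff order.trans zero_le_power)
  then have "real (card {f \<in> ?F. \<forall>k\<in>{2..Suc m}. act k f}) * exp (- (I * ln \<kappa>)) * exp (I * ln \<kappa>)
      \<le> real (card W) ^ Suc m * exp (- ((\<kappa> - 1) * I)) * exp (I * ln \<kappa>)"
    by (intro mult_right_mono) auto
  moreover have "exp (- (I * ln \<kappa>)) * exp (I * ln \<kappa>) = 1"
    "exp (- ((\<kappa> - 1) * I)) * exp (I * ln \<kappa>) = exp (- (I * (\<kappa> - 1 - ln \<kappa>)))"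
    by (simp_all add: exp_add[symmetric] algebra_simps)
  ultimately have 4: "real (card {f \<in> ?F. \<forall>k\<in>{2..Suc m}. act k f})
      \<le> real (card W) ^ Suc m * exp (- (I * (\<kappa> - 1 - ln \<kappa>)))"
    by (simp only: mult.assoc mult_1_right)
  \<comment> \<open>The square root sharpens the logarithm estimate:
    \<open>ln \<kappa> = 2 * ln s \<le> 2 * (s - 1)\<close> leaves the full square
    \<open>(s - 1)\<^sup>2\<close> in the exponent.\<close>
  define s where "s = sqrt \<kappa>"
  have s: "1 < s" "s\<^sup>2 = \<kappa>" using \<kappa> by (auto simp: s_def)
  have "ln \<kappa> = 2 * ln s" using s by (metis ln_realpow order.strict_trans zero_less_one of_nat_numeral)
  also have "\<dots> \<le> 2 * (s - 1)" using s ln_le_minus_one[of s] by simp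
  finally have "(s - 1)\<^sup>2 \<le> \<kappa> - 1 - ln \<kappa>" using s(2) by (simp add: power2_eq_square algebra_simps)
  \<comment> \<open>Origin of the constant 16: \<open>\<kappa> - 1 = (s - 1) * (s + 1)\<close> and
    \<open>s + 1 \<le> 4 * s\<close>. The factor \<nu>, at most 1, only weakens the bound.\<close>
  moreover have "\<nu> * (\<kappa> - 1)\<^sup>2 / (16 * \<kappa>) \<le> (s - 1)\<^sup>2"
  proof -
    have "(s + 1)\<^sup>2 \<le> (4 * s)\<^sup>2" using s by (intro power_mono) auto
    then have "(s - 1)\<^sup>2 * (s + 1)\<^sup>2 \<le> (s - 1)\<^sup>2 * (16 * \<kappa>)"
      using s(2) by (intro mult_left_mono) (auto simp: power_mult_distrib)
    moreover have "(\<kappa> - 1)\<^sup>2 = (s - 1)\<^sup>2 * (s + 1)\<^sup>2"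
      using s(2) by (simp add: power_mult_distrib[symmetric] power2_eq_square algebra_simps)
    moreover have "\<nu> * (\<kappa> - 1)\<^sup>2 \<le> 1 * (\<kappa> - 1)\<^sup>2" using \<nu> by (intro mult_right_mono) auto
    ultimately show ?thesis using \<kappa> by (simp add: pos_divide_le_eq)
  qed
  ultimately have "I * (\<nu> * (\<kappa> - 1)\<^sup>2 / (16 * \<kappa>)) \<le> I * (\<kappa> - 1 - ln \<kappa>)"
    using I by (intro mult_left_mono) auto
  then have "exp (- (I * (\<kappa> - 1 - ln \<kappa>))) \<le> exp (- (I * \<nu> * (\<kappa> - 1)\<^sup>2) / (16 * \<kappa>))"
    by (simp add: mult.assoc)
  then show ?thesis using 4 by (meson mult_left_mono of_nat_0_le_iff order.trans zero_le_power)
qed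

end

section \<open>The scenario tree\<close>

text \<open>Penalties and cost-to-go functions are Lipschitz in a stage norm, whereas topology
  refers to the norm of the type; equivalence of the norms on \<open>V\<close> mediates.\<close>

lemma continuous_on_norm_on_lipschitz:
  fixes V :: "'a::euclidean_space set" and f :: "'a \<Rightarrow> real"
  assumes V: "subspace V" "norm_on V nm" and S: "S \<subseteq> V"
    and f: "\<And>x y. x \<in> S \<Longrightarrow> y \<in> S \<Longrightarrow> \<bar>f x - f y\<bar> \<le> K * nm (x - y)"
  shows "continuous_on S f"
proof -
  obtain C where C: "0 < C" "\<And>x. x \<in> V \<Longrightarrow> nm x \<le> C * norm x" using norm_on_upper[OF V] by blast
  have "(\<bar>K\<bar> * C)-lipschitz_on S f"
  proof (rule lipschitz_onI)
    fix x y assume xy: "x \<in> S" "y \<in> S"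
    then have V': "x - y \<in> V" using S subspace_diff[OF V(1)] by auto
    have "\<bar>f x - f y\<bar> \<le> \<bar>K\<bar> * nm (x - y)"
      using f[OF xy] mult_right_mono[OF abs_ge_self norm_on_nonneg[OF V V'], of K] by linarith
    also have "\<dots> \<le> \<bar>K\<bar> * (C * norm (x - y))" using C(2)[OF V'] by (intro mult_left_mono) auto
    finally show "dist (f x) (f y) \<le> \<bar>K\<bar> * C * dist x y" by (simp add: dist_norm mult.assoc)
  qed (use C in simp)
  then show ?thesis by (rule lipschitz_on_continuous_on)
qed

context multistage_problem
begin

lemma nodes_nonempty: "t \<le> horizon P \<Longrightarrow> nodes P t \<noteq> {}"
  using nodes_0 node_prob_sum[of "t - 1"] by (cases t) force+

lemma finite_nodes': "t \<le> horizon P \<Longrightarrow> finite (nodes P t)"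
  using nodes_0 finite_nodes[of t] by (cases "t = 0") auto

lemma prev_space: "t \<le> horizon P \<Longrightarrow> subspace (prev_space P t)"
  using state_space[of "t - 1"] by (auto simp: prev_space_def)

lemma prev_norm: "t \<le> horizon P \<Longrightarrow> norm_on (prev_space P t) (prev_norm P t)"
  using stage_norm[of "t - 1"] by (auto simp: prev_space_def prev_norm_def norm_on_def)

lemma prev_states_subset: "t \<le> horizon P \<Longrightarrow> prev_states P t \<subseteq> prev_space P t"
  using states[of "t - 1"] by (auto simp: prev_space_def prev_states_def)

lemma prev_states_diff:
  "t \<le> horizon P \<Longrightarrow> x \<in> prev_states P t \<Longrightarrow> y \<in> prev_states P t \<Longrightarrow> x - y \<in> prev_space P t"
  using prev_states_subset prev_space subspace_diff by blast

lemma states_diff: "t < horizon P \<Longrightarrow> x \<in> states P t \<Longrightarrow> y \<in> states P t \<Longrightarrow> x - y \<in> state_space P t"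
  using states state_space subspace_diff by blast

lemma compact_states: "t < horizon P \<Longrightarrow> compact (states P t)"
proof -
  assume t: "t < horizon P"
  then obtain m where m: "m \<in> nodes P t" using nodes_nonempty[of t] by auto
  have "compact (fst ` feas P m)"
    using t m by (intro compact_continuous_image feas_compact[of t] continuous_intros) auto
  then show ?thesis using feas_proj[OF t m] by simp
qed

lemma compact_prev_states: "t \<le> horizon P \<Longrightarrow> compact (prev_states P t)"
  using compact_states[of "t - 1"] by (auto simp: prev_states_def)

lemma feas_states: "t < horizon P \<Longrightarrow> m \<in> nodes P t \<Longrightarrow> (x, y) \<in> feas P m \<Longrightarrow> x \<in> states P t"
  using feas_proj by (metis fst_conv image_eqI)

lemma prev_simps [simp]:
  "prev_states P (Suc t) = states P t" "prev_space P (Suc t) = state_space P t"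
  "prev_norm P (Suc t) = stage_norm P t" "prev_states P 0 = {0}" "prev_space P 0 = {0}"
  by (auto simp: prev_states_def prev_space_def prev_norm_def)

definition tree_level :: "nat \<Rightarrow> 'n list set" where
  "tree_level k = {ns \<in> tree P. length ns = k}"

lemma tree_level_0 [simp]: "tree_level 0 = {[]}"
  by (auto simp: tree_level_def tree_def)

lemma tree_level_Suc:
  assumes "k < horizon P"
  shows "tree_level (Suc k) = (\<lambda>(ns, m). ns @ [m]) ` (tree_level k \<times> nodes P (Suc k))"
proof (intro equalityI subsetI)
  fix ns assume ns: "ns \<in> tree_level (Suc k)"
  then obtain ms m where *: "ns = ms @ [m]" "length ms = k"
    by (metis (mono_tags, lifting) length_Suc_conv_rev mem_Collect_eq tree_level_def)
  have "ns ! s \<in> nodes P (Suc s)" if "s < Suc k" for s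
    using ns that by (auto simp: tree_level_def tree_def)
  from this[of k] this have "m \<in> nodes P (Suc k)" "\<forall>s<k. ms ! s \<in> nodes P (Suc s)"
    using * by (auto simp: nth_append less_SucI split: if_splits) (metis less_SucI nth_append)
  then show "ns \<in> (\<lambda>(ns, m). ns @ [m]) ` (tree_level k \<times> nodes P (Suc k))"
    using * assms by (auto simp: tree_level_def tree_def)
next
  fix ns assume "ns \<in> (\<lambda>(ns, m). ns @ [m]) ` (tree_level k \<times> nodes P (Suc k))"
  then show "ns \<in> tree_level (Suc k)"
    using assms by (auto simp: tree_level_def tree_def nth_append less_Suc_eq)
qed

lemma finite_tree_level: "k \<le> horizon P \<Longrightarrow> finite (tree_level k)"
proof (induction k)
  case (Suc k)
  then show ?case using finite_nodes'[of "Suc k"] by (simp add: tree_level_Suc)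
qed simp

lemma tree_UN: "tree P = (\<Union>k\<le>horizon P. tree_level k)"
  by (auto simp: tree_level_def tree_def)

lemma finite_tree: "finite (tree P)"
  unfolding tree_UN using finite_tree_level by auto

lemma tree_prob_snoc: "tree_prob P (ns @ [m]) = tree_prob P ns * node_prob P (length ns) m"
  by (simp add: tree_prob_def nth_append)

lemma tree_prob_pos: "ns \<in> tree P \<Longrightarrow> 0 < tree_prob P ns"
  unfolding tree_prob_def tree_def by (intro prod_pos) (auto intro!: node_prob_pos)

lemma tree_cases:
  assumes "ns \<in> tree P"
  obtains "ns = []" | ms m where "ns = ms @ [m]" "ms \<in> tree P" "m \<in> nodes P (Suc (length ms))" "length ms < horizon P"
proof (cases ns rule: rev_cases)
  case (snoc ms m)
  then have "ns \<in> tree_level (Suc (length ms))" "length ms < horizon P"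
    using assms by (auto simp: tree_level_def tree_def)
  then show ?thesis using that(2) snoc by (auto simp: tree_level_Suc) (auto simp: tree_level_def)
qed (use that in simp)

lemma tree_node_in_nodes: "ns \<in> tree P \<Longrightarrow> tree_node P ns \<in> nodes P (length ns)"
  by (erule tree_cases) (auto simp: tree_node_def nodes_0)

lemma tree_length_le: "ns \<in> tree P \<Longrightarrow> length ns \<le> horizon P"
  by (auto simp: tree_def)

lemma parent_state_in_prev_states:
  assumes "tree_feasible P x y" "ns \<in> tree P"
  shows "parent_state x ns \<in> prev_states P (length ns)"
  using assms(2)
proof (cases rule: tree_cases)
  case (2 ms m)
  then have "(x ms, y ms) \<in> feas P (tree_node P ms)" using assms(1) by (auto simp: tree_feasible_def)
  then have "x ms \<in> states P (length ms)" using 2 tree_node_in_nodes feas_states by blast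
  then show ?thesis using 2 by (simp add: parent_state_def)
qed (simp add: parent_state_def)

text \<open>Every node occurs at some tree node, as earlier entries can be chosen freely. In the
  given solution of finite objective all terms are nonnegative and all probabilities positive, so no
  single cost is infinite.\<close>

lemma finite_cost_point:
  assumes t: "t \<le> horizon P" and m: "m \<in> nodes P t"
  obtains x y z where "z \<in> prev_states P t" "(x, y) \<in> feas P m" "cost P m z y x < \<infinity>"
proof -
  obtain x y where xy: "tree_feasible P x y" "tree_objective P x y < \<infinity>" using feasible by blast
  have "\<exists>ns\<in>tree P. length ns = t \<and> tree_node P ns = m"
  proof (cases t)
    case 0
    then show ?thesis using m nodes_0 by (intro bexI[of _ "[]"]) (auto simp: tree_node_def tree_def)
  next
    case (Suc s)
    define c where "c = (\<lambda>k. SOME n. n \<in> nodes P (Suc k))"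
    have "c k \<in> nodes P (Suc k)" if "k < horizon P" for k
      using nodes_nonempty[of "Suc k"] that by (auto simp: c_def some_in_eq)
    then show ?thesis using Suc m t
      by (intro bexI[of _ "map c [0..<s] @ [m]"])
        (auto simp: tree_node_def tree_def nth_append less_Suc_eq)
  qed
  then obtain ns where ns: "ns \<in> tree P" "length ns = t" "tree_node P ns = m" by blast
  let ?h = "\<lambda>ns. ereal (tree_prob P ns) * cost P (tree_node P ns) (parent_state x ns) (y ns) (x ns)"
  have cn: "0 \<le> cost P (tree_node P ms) (parent_state x ms) (y ms) (x ms)" if "ms \<in> tree P" for ms
    using that xy(1) parent_state_in_prev_states[OF xy(1) that] tree_length_le tree_node_in_nodes
    by (intro cost_nonneg[of "length ms"]) (auto simp: tree_feasible_def)
  have "?h ns \<le> (\<Sum>ms\<in>tree P. ?h ms)"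
    using finite_tree ns(1)
    by (intro sum_nonneg_leq_bound[OF _ _ refl] ereal_0_le_mult cn) (auto intro: less_imp_le tree_prob_pos)
  then have "?h ns < \<infinity>" using xy(2) unfolding tree_objective_def by (rule order.strict_trans1)
  then have "cost P m (parent_state x ns) (y ns) (x ns) < \<infinity>"
    using tree_prob_pos[OF ns(1)] ns(3) by (auto simp: less_top[symmetric] ereal_mult_eq_PInfty)
  then show ?thesis
    using that ns xy(1) parent_state_in_prev_states[OF xy(1) ns(1)] by (auto simp: tree_feasible_def)
qed

text \<open>Below, \<open>G\<close> is a cost-to-go function evaluated along a policy with node costs \<open>c\<close>.\<close>

context
  fixes c G :: "'n list \<Rightarrow> ereal"
  assumes c_nonneg: "\<And>ns. ns \<in> tree P \<Longrightarrow> 0 \<le> c ns"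
    and G_nonneg: "\<And>ns. ns \<in> tree P \<Longrightarrow> 0 \<le> G ns"
    and G_leaf: "\<And>ns. ns \<in> tree P \<Longrightarrow> length ns = horizon P \<Longrightarrow> G ns = 0"
begin

text \<open>Interpolates between the dynamic programming value and the tree objective: true costs up
  to stage \<open>k\<close>, the cost-to-go function for everything later.\<close>

definition partial_sum :: "nat \<Rightarrow> ereal" where
  "partial_sum k = (\<Sum>j\<le>k. \<Sum>ns\<in>tree_level j. ereal (tree_prob P ns) * c ns) +
     (\<Sum>ns\<in>tree_level k. ereal (tree_prob P ns) * G ns)"

lemma partial_sum_0: "partial_sum 0 = c [] + G []"
  by (simp add: partial_sum_def tree_prob_def one_ereal_def[symmetric])

lemma partial_sum_horizon: "partial_sum (horizon P) = (\<Sum>ns\<in>tree P. ereal (tree_prob P ns) * c ns)"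
proof -
  have "(\<Sum>ns\<in>tree P. ereal (tree_prob P ns) * c ns) =
      (\<Sum>j\<le>horizon P. \<Sum>ns\<in>tree_level j. ereal (tree_prob P ns) * c ns)"
    unfolding tree_UN
    by (rule sum.UNION_disjoint) (use finite_tree_level in \<open>auto simp: tree_level_def\<close>)
  moreover have "(\<Sum>ns\<in>tree_level (horizon P). ereal (tree_prob P ns) * G ns) = 0"
    by (rule sum.neutral) (auto simp: G_leaf tree_level_def)
  ultimately show ?thesis by (simp add: partial_sum_def)
qed

text \<open>Groups level \<open>Suc k\<close> by parents, so that consecutive partial sums differ
  only in one term per node of level \<open>k\<close>. Values may be infinite, hence distributivity
  is justified by nonnegativity and nothing is cancelled.\<close>

lemma partial_sum_Suc:
  assumes k: "k < horizon P"
  shows "partial_sum (Suc k) = (\<Sum>j\<le>k. \<Sum>ns\<in>tree_level j. ereal (tree_prob P ns) * c ns) +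
     (\<Sum>ns\<in>tree_level k. ereal (tree_prob P ns) *
        (\<Sum>m\<in>nodes P (Suc k). ereal (node_prob P k m) * (c (ns @ [m]) + G (ns @ [m]))))"
proof -
  have mem: "ns @ [m] \<in> tree P" if "ns \<in> tree_level k" "m \<in> nodes P (Suc k)" for ns m
    using tree_level_Suc[OF k] that by (auto simp: tree_level_def)
  have "(\<Sum>ns\<in>tree_level (Suc k). ereal (tree_prob P ns) * (c ns + G ns)) =
     (\<Sum>(ns, m)\<in>tree_level k \<times> nodes P (Suc k). ereal (tree_prob P (ns @ [m])) * (c (ns @ [m]) + G (ns @ [m])))"
    unfolding tree_level_Suc[OF k]
    by (subst sum.reindex) (auto simp: inj_on_def case_prod_unfold)
  also have "\<dots> = (\<Sum>ns\<in>tree_level k. \<Sum>m\<in>nodes P (Suc k).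
      ereal (tree_prob P (ns @ [m])) * (c (ns @ [m]) + G (ns @ [m])))"
    by (simp add: sum.cartesian_product)
  also have "\<dots> = (\<Sum>ns\<in>tree_level k. ereal (tree_prob P ns) *
        (\<Sum>m\<in>nodes P (Suc k). ereal (node_prob P k m) * (c (ns @ [m]) + G (ns @ [m]))))"
  proof (rule sum.cong[OF refl])
    fix ns assume ns: "ns \<in> tree_level k"
    have "(\<Sum>m\<in>nodes P (Suc k). ereal (tree_prob P (ns @ [m])) * (c (ns @ [m]) + G (ns @ [m]))) =
        (\<Sum>m\<in>nodes P (Suc k). ereal (tree_prob P ns) * (ereal (node_prob P k m) * (c (ns @ [m]) + G (ns @ [m]))))"
      using ns by (intro sum.cong) (auto simp: tree_prob_snoc tree_level_def mult.assoc times_ereal.simps(1)[symmetric] simp del: times_ereal.simps)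
    also have "\<dots> = ereal (tree_prob P ns) *
        (\<Sum>m\<in>nodes P (Suc k). ereal (node_prob P k m) * (c (ns @ [m]) + G (ns @ [m])))"
      using mem[OF ns] k
      by (intro sum_ereal_right_distrib[symmetric] ereal_0_le_mult add_nonneg_nonneg c_nonneg G_nonneg)
        (auto intro: less_imp_le node_prob_pos)
    finally show "(\<Sum>m\<in>nodes P (Suc k). ereal (tree_prob P (ns @ [m])) * (c (ns @ [m]) + G (ns @ [m]))) =
        ereal (tree_prob P ns) * (\<Sum>m\<in>nodes P (Suc k). ereal (node_prob P k m) * (c (ns @ [m]) + G (ns @ [m])))" .
  qed
  finally have *: "(\<Sum>ns\<in>tree_level (Suc k). ereal (tree_prob P ns) * (c ns + G ns)) = \<dots>" .
  have "(\<Sum>ns\<in>tree_level (Suc k). ereal (tree_prob P ns) * (c ns + G ns)) =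
      (\<Sum>ns\<in>tree_level (Suc k). ereal (tree_prob P ns) * c ns + ereal (tree_prob P ns) * G ns)"
    by (intro sum.cong refl ereal_pos_distrib) 
      (auto simp: tree_level_def c_nonneg G_nonneg less_imp_le tree_prob_pos)
  then show ?thesis using * by (simp add: partial_sum_def sum.distrib add.assoc)
qed

text \<open>The one-step inequalities telescope: the partial sums increase with \<open>k\<close>.
  This serves both for \<open>QR\<close> along an arbitrary policy and for the approximations along
  a solution of the original problem.\<close>

lemma tree_sum_ge:
  assumes "\<And>ns. ns \<in> tree P \<Longrightarrow> length ns < horizon P \<Longrightarrow>
      G ns \<le> (\<Sum>m\<in>nodes P (Suc (length ns)). ereal (node_prob P (length ns) m) * (c (ns @ [m]) + G (ns @ [m])))"
  shows "c [] + G [] \<le> (\<Sum>ns\<in>tree P. ereal (tree_prob P ns) * c ns)"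
proof -
  have "k \<le> horizon P \<Longrightarrow> partial_sum 0 \<le> partial_sum k" for k
  proof (induction k)
    case (Suc k)
    have "partial_sum k \<le> partial_sum (Suc k)"
      unfolding partial_sum_Suc[OF Suc_le_lessD[OF Suc.prems]] unfolding partial_sum_def
      using Suc.prems assms
      by (intro add_left_mono sum_mono ereal_mult_left_mono) (auto simp: tree_level_def less_imp_le tree_prob_pos)
    then show ?case using Suc by simp
  qed simp
  then show ?thesis unfolding partial_sum_0[symmetric] partial_sum_horizon[symmetric] by simp
qed

lemma tree_sum_le:
  assumes "\<And>ns. ns \<in> tree P \<Longrightarrow> length ns < horizon P \<Longrightarrow>
      (\<Sum>m\<in>nodes P (Suc (length ns)). ereal (node_prob P (length ns) m) * (c (ns @ [m]) + G (ns @ [m]))) \<le> G ns"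
  shows "(\<Sum>ns\<in>tree P. ereal (tree_prob P ns) * c ns) \<le> c [] + G []"
proof -
  have "k \<le> horizon P \<Longrightarrow> partial_sum k \<le> partial_sum 0" for k
  proof (induction k)
    case (Suc k)
    have "partial_sum (Suc k) \<le> partial_sum k"
      unfolding partial_sum_Suc[OF Suc_le_lessD[OF Suc.prems]] unfolding partial_sum_def
      using Suc.prems assms
      by (intro add_left_mono sum_mono ereal_mult_left_mono) (auto simp: tree_level_def less_imp_le tree_prob_pos)
    then show ?case using Suc by simp
  qed simp
  then show ?thesis unfolding partial_sum_0[symmetric] partial_sum_horizon[symmetric] by simp
qed

end

end

section \<open>Regularized cost-to-go functions\<close>

context regularized_problem
begin

lemma pen_nonneg: "t \<le> horizon P \<Longrightarrow> m \<in> nodes P t \<Longrightarrow> x \<in> prev_space P t \<Longrightarrow> 0 \<le> pen P m x"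
  using penalty[of t m] by (auto simp: penalty_function_def)

lemma pen_zero: "t \<le> horizon P \<Longrightarrow> m \<in> nodes P t \<Longrightarrow> pen P m 0 = 0"
  using penalty[of t m] subspace_0[OF prev_space[of t]] by (auto simp: penalty_function_def)

lemma pen_diff_lipschitz:
  assumes "t \<le> horizon P" "m \<in> nodes P t" "a \<in> prev_states P t" "b \<in> prev_states P t"
    "c \<in> prev_states P t" "d \<in> prev_states P t"
  shows "\<bar>pen P m (a - b) - pen P m (c - d)\<bar> \<le> prev_norm P t ((a - b) - (c - d))"
  using assms by (intro penalty_lipschitz) auto

lemma continuous_on_pen:
  assumes t: "t \<le> horizon P" "m \<in> nodes P t"
  shows "continuous_on {a - b | a b. a \<in> prev_states P t \<and> b \<in> prev_states P t} (pen P m)"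
proof (rule continuous_on_norm_on_lipschitz[OF prev_space[OF t(1)] prev_norm[OF t(1)]])
  show "{a - b | a b. a \<in> prev_states P t \<and> b \<in> prev_states P t} \<subseteq> prev_space P t"
    using prev_states_diff[OF t(1)] by blast
  show "\<bar>pen P m u - pen P m v\<bar> \<le> 1 * prev_norm P t (u - v)"
    if "u \<in> {a - b | a b. a \<in> prev_states P t \<and> b \<in> prev_states P t}"
      "v \<in> {a - b | a b. a \<in> prev_states P t \<and> b \<in> prev_states P t}" for u v
    using penalty_lipschitz[OF t that] by simp
qed

lemma pen_factor_le: "t \<in> {1..horizon P} \<Longrightarrow> m \<in> nodes P t \<Longrightarrow> pen_factor P m \<le> bound_lambda P m + bound_rho P m"
  using bounds[of t m] bounds_nonneg[of t m] by (auto split: if_splits)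

text \<open>Exactness speaks of optimal solutions, so minimizers have to exist: the cost is
  semicontinuous, the remaining terms are continuous, and the feasible set is compact and
  nonempty.\<close>

lemma reg_objective_attains_min:
  assumes t: "t \<le> horizon P" and m: "m \<in> nodes P t" and xp: "xp \<in> prev_states P t"
    and h: "continuous_on (fst ` feas P m) h" "\<And>x. x \<in> fst ` feas P m \<Longrightarrow> Q x = ereal (h x)"
  obtains u where "u \<in> subproblem_feasible P t m" "node_value P t m Q xp = reg_objective P m xp Q u"
proof -
  let ?S = "prev_states P t \<times> feas P m"
  let ?g = "\<lambda>(z, x, y). cost P m z y x"
  let ?h = "\<lambda>(z, x, y). pen_factor P m * pen P m (xp - z) + h x"
  have "(\<lambda>s. xp - fst s) ` ?S \<subseteq> {a - b | a b. a \<in> prev_states P t \<and> b \<in> prev_states P t}"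
    using xp by force
  then have "continuous_on ?S (\<lambda>s. pen P m (xp - fst s))"
    by (intro continuous_on_compose2[OF continuous_on_pen[OF t m]] continuous_intros)
  moreover have "continuous_on ?S (\<lambda>s. h (fst (snd s)))"
    by (rule continuous_on_compose2[OF h(1)]) (auto intro!: continuous_intros imageI)
  ultimately have "continuous_on ?S ?h" by (auto simp: case_prod_unfold intro!: continuous_intros)
  then have lsc: "lsc_on ?S (\<lambda>s. ?g s + ereal (?h s))"
    by (intro lsc_on_add_continuous cost_lsc[OF t m])
  have "compact ?S" using compact_prev_states[OF t] feas_compact[OF t m] by (rule compact_Times)
  moreover have "?S \<noteq> {}" by (rule finite_cost_point[OF t m]) auto
  ultimately obtain s where s: "s \<in> ?S" "\<And>u. u \<in> ?S \<Longrightarrow> ?g s + ereal (?h s) \<le> ?g u + ereal (?h u)"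
    using lsc_on_attains_inf[OF _ _ lsc] by blast
  have eq: "reg_objective P m xp Q (x, y, z) = ?g (z, x, y) + ereal (?h (z, x, y))"
    if "(z, x, y) \<in> ?S" for x y z
  proof -
    have "(x, y) \<in> feas P m" using that by simp
    then have "Q x = ereal (h x)" using h(2) by (metis fst_conv image_eqI)
    then show ?thesis by (simp add: reg_objective_def add.assoc)
  qed
  obtain z x y where szxy: "s = (z, x, y)" by (cases s)
  have "reg_objective P m xp Q (x, y, z) \<le> reg_objective P m xp Q v" if "v \<in> subproblem_feasible P t m" for v
  proof -
    obtain x' y' z' where v: "v = (x', y', z')" by (cases v)
    then have "(z', x', y') \<in> ?S" using that by (auto simp: subproblem_feasible_def)
    from s(2)[OF this] eq[OF this] eq[OF s(1)[unfolded szxy]] show ?thesis unfolding v szxy by (simp only: prod.case)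
  qed
  moreover have "(x, y, z) \<in> subproblem_feasible P t m" using s(1) szxy by (auto simp: subproblem_feasible_def)
  ultimately have "node_value P t m Q xp = reg_objective P m xp Q (x, y, z)"
    unfolding node_value_def by (intro antisym INF_lower INF_greatest) auto
  then show ?thesis using that \<open>(x, y, z) \<in> _\<close> by blast
qed

lemma reg_objective_nonneg:
  assumes "t \<le> horizon P" "m \<in> nodes P t" "xp \<in> prev_states P t"
    "\<And>x. x \<in> fst ` feas P m \<Longrightarrow> 0 \<le> Q x" "u \<in> subproblem_feasible P t m"
  shows "0 \<le> reg_objective P m xp Q u"
proof -
  obtain x y z where u: "u = (x, y, z)" by (cases u)
  then have *: "z \<in> prev_states P t" "(x, y) \<in> feas P m" using assms(5) by (auto simp: subproblem_feasible_def)
  then have "0 \<le> pen_factor P m * pen P m (xp - z)"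
    using assms pen_factor_pos[of t m] prev_states_diff[of t xp z] pen_nonneg[of t m "xp - z"] by simp
  moreover have "0 \<le> Q x" using * assms(4) by force
  ultimately show ?thesis using cost_nonneg[OF assms(1,2) *] u by (simp add: reg_objective_def)
qed

lemma node_value_nonneg:
  assumes "t \<le> horizon P" "m \<in> nodes P t" "xp \<in> prev_states P t"
    "\<And>x. x \<in> fst ` feas P m \<Longrightarrow> 0 \<le> Q x"
  shows "0 \<le> node_value P t m Q xp"
  unfolding node_value_def by (intro INF_greatest reg_objective_nonneg[OF assms])

text \<open>The copy \<open>z\<close> need not equal the previous state, so one point of finite cost
  serves all previous states at the price of a finite penalty.\<close>

lemma node_value_finite:
  assumes t: "t \<le> horizon P" and m: "m \<in> nodes P t" and Q: "\<And>x. x \<in> fst ` feas P m \<Longrightarrow> Q x < \<infinity>"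
  shows "node_value P t m Q xp < \<infinity>"
proof -
  obtain x y z where *: "z \<in> prev_states P t" "(x, y) \<in> feas P m" "cost P m z y x < \<infinity>"
    by (rule finite_cost_point[OF t m])
  have "node_value P t m Q xp \<le> reg_objective P m xp Q (x, y, z)"
    unfolding node_value_def using * by (intro INF_lower) (auto simp: subproblem_feasible_def)
  also have "\<dots> < \<infinity>" using * Q[of x] by (force simp: reg_objective_def)
  finally show ?thesis .
qed

lemma node_value_mono:
  assumes "\<And>x. x \<in> fst ` feas P m \<Longrightarrow> Q x \<le> Q' x"
  shows "node_value P t m Q xp \<le> node_value P t m Q' xp"
  unfolding node_value_def
proof (rule INF_mono, rule bexI)
  fix u assume u: "u \<in> subproblem_feasible P t m"
  then show "u \<in> subproblem_feasible P t m" .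
  show "reg_objective P m xp Q u \<le> reg_objective P m xp Q' u"
    using u assms by (cases u) (force simp: reg_objective_def subproblem_feasible_def intro!: add_left_mono)
qed

text \<open>The state \<open>xp\<close> enters only through the penalty, so this is an infimum of
  functions that are all Lipschitz with constant \<open>pen_factor P m\<close>.\<close>

lemma node_value_lipschitz:
  assumes t: "t \<le> horizon P" and m: "m \<in> nodes P t" and x: "x \<in> prev_states P t" "x' \<in> prev_states P t"
  shows "node_value P t m Q x \<le> node_value P t m Q x' + ereal (pen_factor P m * prev_norm P t (x - x'))"
proof -
  have "node_value P t m Q x - ereal (pen_factor P m * prev_norm P t (x - x')) \<le> reg_objective P m x' Q u"
    if u: "u \<in> subproblem_feasible P t m" for u
  proof -
    obtain a b z where uz: "u = (a, b, z)" by (cases u)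
    then have z: "z \<in> prev_states P t" using u by (auto simp: subproblem_feasible_def)
    have "pen P m (x - z) \<le> pen P m (x' - z) + prev_norm P t (x - x')"
      using pen_diff_lipschitz[OF t m x(1) z x(2) z] by simp
    then have "pen_factor P m * pen P m (x - z) \<le> pen_factor P m * pen P m (x' - z) + pen_factor P m * prev_norm P t (x - x')"
      using pen_factor_pos[OF t m] by (simp add: distrib_left[symmetric] mult_left_mono)
    then have "reg_objective P m x Q u \<le> cost P m z b a + (ereal (pen_factor P m * pen P m (x' - z)) + ereal (pen_factor P m * prev_norm P t (x - x'))) + Q a"
      using uz by (auto simp: reg_objective_def intro!: add_right_mono add_left_mono)
    also have "\<dots> = reg_objective P m x' Q u + ereal (pen_factor P m * prev_norm P t (x - x'))"
      using uz by (simp add: reg_objective_def ac_simps del: plus_ereal.simps)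
    finally have "reg_objective P m x Q u \<le> \<dots>" .
    then have "node_value P t m Q x \<le> reg_objective P m x' Q u + ereal (pen_factor P m * prev_norm P t (x - x'))"
      unfolding node_value_def using u by (auto intro: INF_lower order.trans)
    then show ?thesis by (subst ereal_minus_le) auto
  qed
  then have "node_value P t m Q x - ereal (pen_factor P m * prev_norm P t (x - x')) \<le> node_value P t m Q x'"
    unfolding node_value_def[of P t m Q x'] by (intro INF_greatest)
  then show ?thesis by (subst (asm) ereal_minus_le) auto
qed

lemma QR_horizon: "QR P (horizon P) = (\<lambda>_. 0)"
  by (simp add: QR.simps)

lemma QR_step:
  "t < horizon P \<Longrightarrow> QR P t x =
     (\<Sum>m\<in>nodes P (Suc t). ereal (node_prob P t m) * node_value P (Suc t) m (QR P (Suc t)) x)"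
  by (simp add: QR.simps)

text \<open>Gaps are differences, so a real-valued version is wanted; on feasible states
  \<open>QR\<close> is finite and nothing is lost.\<close>

definition qr :: "nat \<Rightarrow> 'a \<Rightarrow> real" where
  "qr t x = real_of_ereal (QR P t x)"

text \<open>Backward induction from the horizon. The point \<open>x\<close> is tied to a single node
  because at the last stage the nodes need not share a projection.\<close>

lemma QR_qr_aux:
  assumes "t \<le> horizon P" "m \<in> nodes P t" "x \<in> fst ` feas P m"
  shows "0 \<le> QR P t x \<and> QR P t x < \<infinity>"
  using assms
proof (induction "horizon P - t" arbitrary: t m x)
  case 0
  then have "t = horizon P" by simp
  then show ?case by (simp only: QR_horizon) simp
next
  case (Suc k)
  then have t: "t < horizon P" by simp
  then have x: "x \<in> prev_states P (Suc t)" using Suc.prems feas_proj by auto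
  have summand: "0 \<le> ereal (node_prob P t m') * node_value P (Suc t) m' (QR P (Suc t)) x \<and>
      ereal (node_prob P t m') * node_value P (Suc t) m' (QR P (Suc t)) x \<noteq> \<infinity>"
    if m': "m' \<in> nodes P (Suc t)" for m'
  proof -
    have "0 \<le> QR P (Suc t) x \<and> QR P (Suc t) x < \<infinity>" if "x \<in> fst ` feas P m'" for x
      using Suc.hyps t m' that by (intro Suc.hyps(1)) auto
    then have "0 \<le> node_value P (Suc t) m' (QR P (Suc t)) x" "node_value P (Suc t) m' (QR P (Suc t)) x < \<infinity>"
      using t m' x node_value_nonneg[of "Suc t" m' x "QR P (Suc t)"]
        node_value_finite[of "Suc t" m' "QR P (Suc t)" x] by simp_all
    then show ?thesis
      using node_prob_pos[OF t m'] by (cases "node_value P (Suc t) m' (QR P (Suc t)) x") auto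
  qed
  have "(\<Sum>m'\<in>nodes P (Suc t). ereal (node_prob P t m') * node_value P (Suc t) m' (QR P (Suc t)) x) \<noteq> \<infinity>"
    using summand unfolding sum_Pinfty by blast
  moreover have "0 \<le> (\<Sum>m'\<in>nodes P (Suc t). ereal (node_prob P t m') * node_value P (Suc t) m' (QR P (Suc t)) x)"
    using summand by (intro sum_nonneg) blast
  ultimately show ?case unfolding QR_step[OF t] by auto
qed

lemma QR_eq_qr: "t \<le> horizon P \<Longrightarrow> m \<in> nodes P t \<Longrightarrow> x \<in> fst ` feas P m \<Longrightarrow> QR P t x = ereal (qr t x)"
  using QR_qr_aux[of t m x] unfolding qr_def by (cases "QR P t x") auto

lemma QR_eq_qr': "t < horizon P \<Longrightarrow> x \<in> states P t \<Longrightarrow> QR P t x = ereal (qr t x)"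
  by (metis QR_eq_qr all_not_in_conv feas_proj less_imp_le nodes_nonempty)

lemma node_value_QR_real:
  assumes t: "t < horizon P" and m: "m \<in> nodes P (Suc t)" and x: "x \<in> states P t"
  shows "node_value P (Suc t) m (QR P (Suc t)) x = ereal (real_of_ereal (node_value P (Suc t) m (QR P (Suc t)) x))"
proof -
  have "0 \<le> node_value P (Suc t) m (QR P (Suc t)) x" "node_value P (Suc t) m (QR P (Suc t)) x < \<infinity>"
    using assms QR_qr_aux[of "Suc t" m] node_value_nonneg[of "Suc t" m x "QR P (Suc t)"]
      node_value_finite[of "Suc t" m "QR P (Suc t)" x] by simp_all
  then show ?thesis by (cases "node_value P (Suc t) m (QR P (Suc t)) x") auto
qed

lemma qr_step:
  assumes t: "t < horizon P" and x: "x \<in> states P t"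
  shows "qr t x = (\<Sum>m\<in>nodes P (Suc t). node_prob P t m * real_of_ereal (node_value P (Suc t) m (QR P (Suc t)) x))"
proof -
  have "QR P t x = (\<Sum>m\<in>nodes P (Suc t). ereal (node_prob P t m * real_of_ereal (node_value P (Suc t) m (QR P (Suc t)) x)))"
    unfolding QR_step[OF t] using node_value_QR_real[OF t _ x]
    by (intro sum.cong refl) (metis times_ereal.simps(1))
  then show ?thesis by (simp add: qr_def)
qed

lemma lipschitz_bound_pos: "t < horizon P \<Longrightarrow> 0 < lipschitz_bound P t"
  unfolding lipschitz_bound_def
proof (rule sum_pos)
  fix m assume t: "t < horizon P" "m \<in> nodes P (Suc t)"
  then show "0 < node_prob P t m * (bound_lambda P m + bound_rho P m)"
    using node_prob_pos[OF t] pen_factor_pos[of "Suc t" m] pen_factor_le[of "Suc t" m] by auto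
qed (use nodes_nonempty finite_nodes' in auto)

text \<open>In both cases of the assumption on the bounds, the penalty factor is at most
  \<open>bound_lambda P m + bound_rho P m\<close>; averaging the node constants gives
  \<open>lipschitz_bound P t\<close>.\<close>

lemma qr_lipschitz:
  assumes t: "t < horizon P" and x: "x \<in> states P t" "x' \<in> states P t"
  shows "\<bar>qr t x - qr t x'\<bar> \<le> lipschitz_bound P t * stage_norm P t (x - x')"
proof -
  have *: "qr t x - qr t x' \<le> lipschitz_bound P t * stage_norm P t (x - x')"
    if x: "x \<in> states P t" "x' \<in> states P t" for x x'
  proof -
    let ?nv = "\<lambda>m x. real_of_ereal (node_value P (Suc t) m (QR P (Suc t)) x)"
    have "qr t x - qr t x' = (\<Sum>m\<in>nodes P (Suc t). node_prob P t m * (?nv m x - ?nv m x'))"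
      using x by (simp add: qr_step[OF t] sum_subtractf algebra_simps)
    also have "\<dots> \<le> (\<Sum>m\<in>nodes P (Suc t). node_prob P t m * ((bound_lambda P m + bound_rho P m) * stage_norm P t (x - x')))"
    proof (intro sum_mono mult_left_mono)
      fix m assume m: "m \<in> nodes P (Suc t)"
      show "0 \<le> node_prob P t m" using node_prob_pos[OF t m] by simp
      have "ereal (?nv m x) \<le> ereal (?nv m x') + ereal (pen_factor P m * stage_norm P t (x - x'))"
        using node_value_lipschitz[of "Suc t" m x x' "QR P (Suc t)"] t m x
        by (simp only: node_value_QR_real[OF t m, symmetric] prev_simps Suc_leI)
      then have "?nv m x - ?nv m x' \<le> pen_factor P m * stage_norm P t (x - x')" by simp
      also have "\<dots> \<le> (bound_lambda P m + bound_rho P m) * stage_norm P t (x - x')"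
        using pen_factor_le[of "Suc t" m] t m x states_diff[OF t]
          norm_on_nonneg[OF state_space[OF t] stage_norm[OF t]]
        by (intro mult_right_mono) auto
      finally show "?nv m x - ?nv m x' \<le> (bound_lambda P m + bound_rho P m) * stage_norm P t (x - x')" .
    qed
    also have "\<dots> = lipschitz_bound P t * stage_norm P t (x - x')"
      by (simp add: lipschitz_bound_def sum_distrib_right mult.assoc)
    finally show ?thesis .
  qed
  have "stage_norm P t (x - x') = stage_norm P t (x' - x)"
    using x states[OF t] by (intro norm_on_minus_commute[OF state_space[OF t] stage_norm[OF t]]) auto
  then show ?thesis using *[OF x] *[of x' x] x by auto
qed

lemma continuous_on_qr:
  assumes t: "t \<le> horizon P" and m: "m \<in> nodes P t"
  shows "continuous_on (fst ` feas P m) (qr t)"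
proof (cases "t = horizon P")
  case True
  then show ?thesis by (simp add: qr_def QR_horizon)
next
  case False
  then have t: "t < horizon P" using t by simp
  show ?thesis unfolding feas_proj[OF t m]
    by (rule continuous_on_norm_on_lipschitz[OF state_space[OF t] stage_norm[OF t] states[OF t] qr_lipschitz[OF t]])
qed

lemma root_node: "rootnode P \<in> nodes P 0"
  by (simp add: nodes_0)

lemma root_objective_eq: "root_objective P Q (x, y) = reg_objective P (rootnode P) 0 Q (x, y, 0)"
  using pen_zero[OF _ root_node] by (simp add: root_objective_def reg_objective_def)

text \<open>At the root the copy can only be 0, where the penalty vanishes, so the root is treated
  like any other node.\<close>

lemma v_reg_eq_node_value: "v_reg P = node_value P 0 (rootnode P) (QR P 0) 0"
proof -
  have "subproblem_feasible P 0 (rootnode P) = (\<lambda>(x, y). (x, y, 0)) ` feas P (rootnode P)"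
    by (auto simp: subproblem_feasible_def)
  then show ?thesis
    by (simp add: v_reg_def node_value_def image_image case_prod_unfold root_objective_eq[symmetric])
qed

text \<open>The decision of a policy at a node is one competitor in the minimum defining
  \<open>node_value\<close>, which yields the one-step inequalities for
  \<open>tree_sum_ge\<close>.\<close>

lemma v_reg_le_tree_reg_objective:
  assumes f: "tree_reg_feasible P (x, y, z)"
  shows "v_reg P \<le> tree_reg_objective P (x, y, z)"
proof -
  define c where "c = (\<lambda>ns. cost P (tree_node P ns) (z ns) (y ns) (x ns) +
         ereal (pen_factor P (tree_node P ns) * pen P (tree_node P ns) (parent_state x ns - z ns)))"
  have tf: "tree_feasible P x y" and z: "\<And>ns. ns \<in> tree P \<Longrightarrow> z ns \<in> prev_states P (length ns)"
    using f by (auto simp: tree_reg_feasible_def)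
  have sf: "(x ns, y ns, z ns) \<in> subproblem_feasible P (length ns) (tree_node P ns)" if "ns \<in> tree P" for ns
    using that tf z by (auto simp: subproblem_feasible_def tree_feasible_def)
  have c_eq: "c ns + Q (x ns) = reg_objective P (tree_node P ns) (parent_state x ns) Q (x ns, y ns, z ns)" for ns Q
    by (simp add: c_def reg_objective_def)
  have c0: "0 \<le> c ns" if "ns \<in> tree P" for ns
    using reg_objective_nonneg[OF tree_length_le[OF that] tree_node_in_nodes[OF that]
        parent_state_in_prev_states[OF tf that] _ sf[OF that], of "\<lambda>_. 0"] c_eq[of ns "\<lambda>_. 0"] by simp
  have xf: "x ns \<in> fst ` feas P (tree_node P ns)" if "ns \<in> tree P" for ns
    using tf that by (force simp: tree_feasible_def)
  have "v_reg P \<le> c [] + QR P 0 (x [])"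
    unfolding v_reg_eq_node_value c_eq node_value_def using sf[of "[]"]
    by (intro INF_lower2[of "(x [], y [], z [])"]) (auto simp: tree_def tree_node_def parent_state_def)
  also have "\<dots> = c [] + QR P (length ([]::'n list)) (x [])" by simp
  also have "\<dots> \<le> (\<Sum>ns\<in>tree P. ereal (tree_prob P ns) * c ns)"
  proof (rule tree_sum_ge[OF c0])
    fix ns assume ns: "ns \<in> tree P"
    show "0 \<le> QR P (length ns) (x ns)"
      using QR_qr_aux[OF tree_length_le[OF ns] tree_node_in_nodes[OF ns] xf[OF ns]] by simp
    show "length ns = horizon P \<Longrightarrow> QR P (length ns) (x ns) = 0" by (simp add: QR_horizon)
    assume l: "length ns < horizon P"
    show "QR P (length ns) (x ns) \<le> (\<Sum>m\<in>nodes P (Suc (length ns)). ereal (node_prob P (length ns) m) *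
        (c (ns @ [m]) + QR P (length (ns @ [m])) (x (ns @ [m]))))"
      unfolding QR_step[OF l]
    proof (intro sum_mono ereal_mult_left_mono)
      fix m assume m: "m \<in> nodes P (Suc (length ns))"
      show "0 \<le> ereal (node_prob P (length ns) m)" using node_prob_pos[OF l m] by simp
      have "ns @ [m] \<in> tree P" using ns l m by (auto simp: tree_def nth_append less_Suc_eq)
      from sf[OF this] show "node_value P (Suc (length ns)) m (QR P (Suc (length ns))) (x ns)
          \<le> c (ns @ [m]) + QR P (length (ns @ [m])) (x (ns @ [m]))"
        unfolding c_eq node_value_def by (intro INF_lower2) (auto simp: tree_node_def parent_state_def)
    qed
  qed
  also have "\<dots> = tree_reg_objective P (x, y, z)" by (simp add: tree_reg_objective_def c_def)
  finally show ?thesis .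
qed

text \<open>Taking a minimizer at every tree node turns the one-step inequalities into
  equalities.\<close>

lemma optimal_policy:
  obtains x y z where "tree_reg_feasible P (x, y, z)" "tree_reg_objective P (x, y, z) \<le> v_reg P"
proof -
  have "\<exists>u\<in>subproblem_feasible P t m. node_value P t m (QR P t) xp = reg_objective P m xp (QR P t) u"
    if "t \<le> horizon P" "m \<in> nodes P t" "xp \<in> prev_states P t" for t m xp
    by (rule reg_objective_attains_min[OF that continuous_on_qr[OF that(1,2)] QR_eq_qr[OF that(1,2)]]) auto
  then obtain A where A: "\<And>t m xp. t \<le> horizon P \<Longrightarrow> m \<in> nodes P t \<Longrightarrow> xp \<in> prev_states P t \<Longrightarrow>
      A t m xp \<in> subproblem_feasible P t m \<and> node_value P t m (QR P t) xp = reg_objective P m xp (QR P t) (A t m xp)"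
    by metis
  \<comment> \<open>Tree nodes grow at the end of the list, so the recursion runs over the reversed
    list; the first component of the parent's decision is the incoming state.\<close>
  define pol where "pol = (\<lambda>ns. rec_list (A 0 (rootnode P) 0) (\<lambda>m ms u. A (Suc (length ms)) m (fst u)) (rev ns))"
  define x where "x = (\<lambda>ns. fst (pol ns))"
  define y where "y = (\<lambda>ns. fst (snd (pol ns)))"
  define z where "z = (\<lambda>ns. snd (snd (pol ns)))"
  have pol: "pol ns = (x ns, y ns, z ns)" for ns by (simp add: x_def y_def z_def)
  have pol_eq: "pol ns = A (length ns) (tree_node P ns) (parent_state x ns)" for ns
    by (cases ns rule: rev_cases) (auto simp: pol_def x_def tree_node_def parent_state_def)
  have *: "parent_state x ns \<in> prev_states P (length ns) \<and> pol ns \<in> subproblem_feasible P (length ns) (tree_node P ns)"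
    if "ns \<in> tree P" for ns
    using that
  proof (induction ns rule: rev_induct)
    case Nil
    then show ?case using A[of 0 "rootnode P" 0] root_node by (simp add: pol_eq parent_state_def tree_node_def)
  next
    case (snoc m ns)
    then have ns: "ns \<in> tree P" "length ns < horizon P" "m \<in> nodes P (Suc (length ns))"
      using snoc.prems by (auto elim: tree_cases)
    then have "(x ns, y ns) \<in> feas P (tree_node P ns)" using snoc.IH by (auto simp: pol subproblem_feasible_def)
    then have "x ns \<in> states P (length ns)" using ns tree_node_in_nodes feas_states by blast
    then have "parent_state x (ns @ [m]) \<in> prev_states P (length (ns @ [m]))" by (simp add: parent_state_def)
    then show ?case using A tree_length_le[OF snoc.prems] tree_node_in_nodes[OF snoc.prems] by (simp add: pol_eq)
  qed
  have feas: "tree_reg_feasible P (x, y, z)"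
    using * by (auto simp: tree_reg_feasible_def tree_feasible_def pol subproblem_feasible_def)
  then have tf: "tree_feasible P x y" by (auto simp: tree_reg_feasible_def)
  define c where "c = (\<lambda>ns. cost P (tree_node P ns) (z ns) (y ns) (x ns) +
         ereal (pen_factor P (tree_node P ns) * pen P (tree_node P ns) (parent_state x ns - z ns)))"
  have c_eq: "c ns + Q (x ns) = reg_objective P (tree_node P ns) (parent_state x ns) Q (pol ns)" for ns Q
    by (simp add: c_def reg_objective_def pol)
  have c_opt: "c ns + QR P (length ns) (x ns) = node_value P (length ns) (tree_node P ns) (QR P (length ns)) (parent_state x ns)"
    if "ns \<in> tree P" for ns
    unfolding c_eq pol_eq using A[OF tree_length_le tree_node_in_nodes] * that by simp
  have c0: "0 \<le> c ns" if "ns \<in> tree P" for ns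
    using reg_objective_nonneg[OF tree_length_le[OF that] tree_node_in_nodes[OF that]
        parent_state_in_prev_states[OF tf that] _, of "\<lambda>_. 0"] * that c_eq[of ns "\<lambda>_. 0"] by simp
  have xf: "x ns \<in> fst ` feas P (tree_node P ns)" if "ns \<in> tree P" for ns
    using tf that by (force simp: tree_feasible_def)
  have "tree_reg_objective P (x, y, z) = (\<Sum>ns\<in>tree P. ereal (tree_prob P ns) * c ns)"
    by (simp add: tree_reg_objective_def c_def)
  also have "\<dots> \<le> c [] + QR P (length ([]::'n list)) (x [])"
  proof (rule tree_sum_le[OF c0])
    fix ns assume ns: "ns \<in> tree P"
    show "0 \<le> QR P (length ns) (x ns)"
      using QR_qr_aux[OF tree_length_le[OF ns] tree_node_in_nodes[OF ns] xf[OF ns]] by simp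
    show "length ns = horizon P \<Longrightarrow> QR P (length ns) (x ns) = 0" by (simp add: QR_horizon)
    assume l: "length ns < horizon P"
    have "c (ns @ [m]) + QR P (length (ns @ [m])) (x (ns @ [m])) =
        node_value P (Suc (length ns)) m (QR P (Suc (length ns))) (x ns)"
      if m: "m \<in> nodes P (Suc (length ns))" for m
    proof -
      have "ns @ [m] \<in> tree P" using ns l m by (auto simp: tree_def nth_append less_Suc_eq)
      from c_opt[OF this] show ?thesis by (simp add: tree_node_def parent_state_def)
    qed
    then show "(\<Sum>m\<in>nodes P (Suc (length ns)). ereal (node_prob P (length ns) m) *
        (c (ns @ [m]) + QR P (length (ns @ [m])) (x (ns @ [m])))) \<le> QR P (length ns) (x ns)"
      unfolding QR_step[OF l] by (simp cong: sum.cong)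
  qed
  also have "\<dots> = v_reg P"
    using c_opt[of "[]"] by (simp add: v_reg_eq_node_value tree_def tree_node_def parent_state_def)
  finally show ?thesis using that feas by blast
qed

text \<open>This is where exactness enters: in an optimal policy every copy equals the parent state,
  so all penalties vanish and the policy solves the original problem at the same cost.\<close>

lemma tree_objective_le_v_reg:
  obtains x y where "tree_feasible P x y" "tree_objective P x y \<le> v_reg P"
proof -
  obtain x y z where f: "tree_reg_feasible P (x, y, z)" and o: "tree_reg_objective P (x, y, z) \<le> v_reg P"
    by (rule optimal_policy)
  have "is_arg_min (tree_reg_objective P) (tree_reg_feasible P) (x, y, z)"
    using f o v_reg_le_tree_reg_objective by (fastforce simp: is_arg_min_linorder)
  then have z: "\<forall>ns\<in>tree P. z ns = parent_state x ns" by (rule exact)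
  have "tree_objective P x y = tree_reg_objective P (x, y, z)"
    unfolding tree_objective_def tree_reg_objective_def
    using z pen_zero[OF tree_length_le tree_node_in_nodes]
    by (auto intro!: sum.cong)
  then show ?thesis using that f o by (auto simp: tree_reg_feasible_def)
qed

end

section \<open>Cuts and duality\<close>

lemma Max_insert_image_le:
  fixes a :: "'c \<Rightarrow> real"
  assumes "finite C" "\<And>c. c \<in> C \<Longrightarrow> a c \<le> b c + K" "a0 \<le> b0 + K"
  shows "Max (insert a0 (a ` C)) \<le> Max (insert b0 (b ` C)) + K"
proof (rule Max.boundedI)
  fix v assume "v \<in> insert a0 (a ` C)"
  then consider "v = a0" | c where "c \<in> C" "v = a c" by blast
  then show "v \<le> Max (insert b0 (b ` C)) + K"
  proof cases
    case 1
    have "b0 \<le> Max (insert b0 (b ` C))" using assms(1) by (intro Max_ge) auto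
    then show ?thesis using 1 assms(3) by simp
  next
    case (2 c)
    have "b c \<le> Max (insert b0 (b ` C))" using assms(1) 2 by (intro Max_ge) auto
    then show ?thesis using assms(2)[of c] 2 by simp
  qed
qed (use assms(1) in auto)

lemma Max_insert_image_lipschitz:
  fixes a :: "'c \<Rightarrow> real"
  assumes "finite C" "\<And>c. c \<in> C \<Longrightarrow> \<bar>a c - b c\<bar> \<le> K" "\<bar>a0 - b0\<bar> \<le> K"
  shows "\<bar>Max (insert a0 (a ` C)) - Max (insert b0 (b ` C))\<bar> \<le> K"
proof -
  have "Max (insert a0 (a ` C)) \<le> Max (insert b0 (b ` C)) + K"
    using assms by (intro Max_insert_image_le) (auto simp: abs_le_iff algebra_simps)
  moreover have "Max (insert b0 (b ` C)) \<le> Max (insert a0 (a ` C)) + K"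
    using assms by (intro Max_insert_image_le) (auto simp: abs_le_iff algebra_simps)
  ultimately show ?thesis by (simp add: abs_le_iff)
qed

lemma convex_on_Max_insert:
  fixes f :: "'c \<Rightarrow> 'a::real_vector \<Rightarrow> real"
  assumes "finite C" "convex S" "\<And>c. c \<in> C \<Longrightarrow> convex_on S (f c)"
  shows "convex_on S (\<lambda>x. Max (insert 0 ((\<lambda>c. f c x) ` C)))"
proof (rule convex_onI)
  fix x y and u :: real
  assume xy: "x \<in> S" "y \<in> S" and u: "0 < u" "u < 1"
  let ?m = "\<lambda>x. Max (insert 0 ((\<lambda>c. f c x) ` C))"
  have ge: "f c z \<le> ?m z" "0 \<le> ?m z" if "c \<in> C" for c z using that assms(1) by (auto intro!: Max_ge)
  show "?m ((1 - u) *\<^sub>R x + u *\<^sub>R y) \<le> (1 - u) * ?m x + u * ?m y"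
  proof (rule Max.boundedI)
    fix v assume "v \<in> insert 0 ((\<lambda>c. f c ((1 - u) *\<^sub>R x + u *\<^sub>R y)) ` C)"
    then consider "v = 0" | c where "c \<in> C" "v = f c ((1 - u) *\<^sub>R x + u *\<^sub>R y)" by blast
    then show "v \<le> (1 - u) * ?m x + u * ?m y"
    proof cases
      case 1
      have "0 \<le> ?m z" for z using assms(1) by (auto intro!: Max_ge)
      then show ?thesis using 1 u by simp
    next
      case (2 c)
      have "v \<le> (1 - u) * f c x + u * f c y"
        using convex_onD[OF assms(3)[OF 2(1)]] xy u unfolding 2(2) by simp
      also have "\<dots> \<le> (1 - u) * ?m x + u * ?m y"
        using ge[OF 2(1)] u by (intro add_mono mult_left_mono) auto
      finally show ?thesis .
    qed
  qed (use assms(1) in auto)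
qed (rule assms(2))

lemma convex_on_norm_on:
  fixes V :: "'a::euclidean_space set"
  assumes "subspace V" "norm_on V nm"
  shows "convex_on V nm"
proof (rule convex_onI)
  fix x y and u :: real
  assume xy: "x \<in> V" "y \<in> V" and u: "0 < u" "u < 1"
  then have "nm ((1 - u) *\<^sub>R x + u *\<^sub>R y) \<le> nm ((1 - u) *\<^sub>R x) + nm (u *\<^sub>R y)"
    by (intro norm_on_add[OF assms] subspace_scale[OF assms(1)])
  also have "\<dots> = (1 - u) * nm x + u * nm y"
    using xy u norm_on_scaleR[OF assms] by simp
  finally show "nm ((1 - u) *\<^sub>R x + u *\<^sub>R y) \<le> (1 - u) * nm x + u * nm y" .
qed (rule subspace_imp_convex[OF assms(1)])

context regularized_problem
begin

lemma multipliers_bounds: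
  assumes "t \<in> {1..horizon P}" "(l, r) \<in> multipliers P t m" "x \<in> prev_space P t"
  shows "\<bar>l \<bullet> x\<bar> \<le> bound_lambda P m * prev_norm P t x"
  using assms inner_le_dual_norm[OF prev_space[of t] prev_norm[of t]] by (auto simp: multipliers_def)

text \<open>The dual norm bounds the slope of the linear part, the Lipschitz penalty that of the
  other. The estimate is used twice: for cuts as functions of the state and for inner problems as
  functions of the copy.\<close>

lemma multiplier_term_lipschitz:
  assumes t: "t \<in> {1..horizon P}" and m: "m \<in> nodes P t" and u: "(l, r) \<in> multipliers P t m"
    and x: "xp \<in> prev_states P t" "a \<in> prev_states P t" "b \<in> prev_states P t"
  shows "\<bar>(l \<bullet> (xp - a) + r * pen P m (xp - a)) - (l \<bullet> (xp - b) + r * pen P m (xp - b))\<bar>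
    \<le> (bound_lambda P m + bound_rho P m) * prev_norm P t (a - b)"
proof -
  have t': "t \<le> horizon P" using t by simp
  have ab: "a - b \<in> prev_space P t" by (rule prev_states_diff[OF t' x(2,3)])
  have r: "0 \<le> r" "r \<le> bound_rho P m" using u by (auto simp: multipliers_def)
  have "\<bar>pen P m (xp - a) - pen P m (xp - b)\<bar> \<le> prev_norm P t (b - a)"
    using pen_diff_lipschitz[OF t' m x(1,2,1,3)] by simp
  also have "\<dots> = prev_norm P t (a - b)"
    using x prev_states_subset[OF t'] by (intro norm_on_minus_commute[OF prev_space[OF t'] prev_norm[OF t']]) auto
  finally have "\<bar>r * (pen P m (xp - a) - pen P m (xp - b))\<bar> \<le> bound_rho P m * prev_norm P t (a - b)"
    unfolding abs_mult using r by (intro mult_mono) auto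
  moreover have "\<bar>l \<bullet> (a - b)\<bar> \<le> bound_lambda P m * prev_norm P t (a - b)"
    by (rule multipliers_bounds[OF t u ab])
  moreover have "(l \<bullet> (xp - a) + r * pen P m (xp - a)) - (l \<bullet> (xp - b) + r * pen P m (xp - b)) =
      r * (pen P m (xp - a) - pen P m (xp - b)) - l \<bullet> (a - b)"
    by (simp add: algebra_simps inner_diff_right)
  ultimately show ?thesis by (simp add: distrib_right)
qed

lemma cut_lipschitz:
  assumes t: "t < horizon P" and m: "m \<in> nodes P (Suc t)" and u: "u \<in> multipliers P (Suc t) m"
    and x: "xp \<in> states P t" "a \<in> states P t" "b \<in> states P t"
  shows "\<bar>cut P m xp u v a - cut P m xp u v b\<bar> \<le> (bound_lambda P m + bound_rho P m) * stage_norm P t (a - b)"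
  using multiplier_term_lipschitz[of "Suc t" m "fst u" "snd u" xp a b] assms
  by (simp add: cut_def case_prod_unfold)

lemma averaged_cut_lipschitz:
  assumes t: "t < horizon P" and c: "c \<in> averaged_cuts P t" and x: "a \<in> states P t" "b \<in> states P t"
  shows "\<bar>c a - c b\<bar> \<le> lipschitz_bound P t * stage_norm P t (a - b)"
proof -
  obtain xp u v where c: "c = (\<lambda>x. \<Sum>m\<in>nodes P (Suc t). node_prob P t m * cut P m xp (u m) (v m) x)"
    and xp: "xp \<in> states P t" and u: "\<And>m. m \<in> nodes P (Suc t) \<Longrightarrow> u m \<in> multipliers P (Suc t) m"
    using c by (auto simp: averaged_cuts_def)
  have "\<bar>c a - c b\<bar> = \<bar>\<Sum>m\<in>nodes P (Suc t). node_prob P t m * (cut P m xp (u m) (v m) a - cut P m xp (u m) (v m) b)\<bar>"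
    by (simp add: c sum_subtractf algebra_simps)
  also have "\<dots> \<le> (\<Sum>m\<in>nodes P (Suc t). node_prob P t m * ((bound_lambda P m + bound_rho P m) * stage_norm P t (a - b)))"
  proof (intro order.trans[OF sum_abs] sum_mono)
    fix m assume m: "m \<in> nodes P (Suc t)"
    show "\<bar>node_prob P t m * (cut P m xp (u m) (v m) a - cut P m xp (u m) (v m) b)\<bar>
        \<le> node_prob P t m * ((bound_lambda P m + bound_rho P m) * stage_norm P t (a - b))"
      using cut_lipschitz[OF t m u[OF m] xp x, of "v m"] node_prob_pos[OF t m]
      by (simp add: abs_mult mult_left_mono)
  qed
  also have "\<dots> = lipschitz_bound P t * stage_norm P t (a - b)"
    by (simp add: lipschitz_bound_def sum_distrib_right mult.assoc)
  finally show ?thesis .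
qed

lemma approximations_nonneg:
  assumes "t \<le> horizon P" "Q \<in> approximations P t" "m \<in> nodes P t" "x \<in> fst ` feas P m"
  shows "0 \<le> Q x"
  using assms feas_proj[of t m] by (auto simp: approximations_def split: if_splits)

lemma approximations_horizon: "approximations P (horizon P) = {\<lambda>_. 0}"
  by (simp add: approximations_def)

lemma approximations_lipschitz:
  assumes t: "t < horizon P" and Q: "Q \<in> approximations P t" and x: "a \<in> states P t" "b \<in> states P t"
  shows "\<bar>Q a - Q b\<bar> \<le> lipschitz_bound P t * stage_norm P t (a - b)"
proof -
  obtain C where C: "finite C" "C \<subseteq> averaged_cuts P t" "Q = (\<lambda>x\<in>states P t. Max (insert 0 ((\<lambda>c. c x) ` C)))"
    using Q t by (auto simp: approximations_def)
  have "0 \<le> lipschitz_bound P t * stage_norm P t (a - b)"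
    using lipschitz_bound_pos[OF t] norm_on_nonneg[OF state_space[OF t] stage_norm[OF t] states_diff[OF t x]] by simp
  then show ?thesis
    using x C averaged_cut_lipschitz[OF t _ x] by (auto intro!: Max_insert_image_lipschitz)
qed

lemma convex_states:
  assumes "convex_problem P" "t < horizon P"
  shows "convex (states P t)"
proof -
  obtain m where m: "m \<in> nodes P t" using nodes_nonempty[of t] assms by auto
  then have "convex (feas P m)" using assms by (metis convex_problem_def less_imp_le)
  then have "convex (fst ` feas P m)" by (intro convex_linear_image linear_fst)
  then show ?thesis using feas_proj[OF assms(2) m] by simp
qed

text \<open>Here \<open>bound_rho\<close> is 0, so every cut is affine and maxima and averages of
  cuts stay convex.\<close>

lemma approximations_convex:
  assumes cp: "convex_problem P" "norm_penalties P" and t: "t \<le> horizon P" and m: "m \<in> nodes P t"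
    and Q: "Q \<in> approximations P t"
  shows "convex_on (fst ` feas P m) Q"
proof (cases "t = horizon P")
  case True
  have "convex (fst ` feas P m)"
    using cp(1) t m by (intro convex_linear_image linear_fst) (auto simp: convex_problem_def)
  then show ?thesis using Q True by (simp add: approximations_horizon convex_on_const)
next
  case False
  then have t: "t < horizon P" using t by simp
  obtain C where C: "finite C" "C \<subseteq> averaged_cuts P t" "Q = (\<lambda>x\<in>states P t. Max (insert 0 ((\<lambda>c. c x) ` C)))"
    using Q t by (auto simp: approximations_def)
  have cvx: "convex (states P t)" by (rule convex_states[OF cp(1) t])
  have "convex_on (states P t) c" if cC: "c \<in> C" for c
  proof -
    obtain xp u v where c: "c = (\<lambda>x. \<Sum>m\<in>nodes P (Suc t). node_prob P t m * cut P m xp (u m) (v m) x)"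
      and xp: "xp \<in> states P t" and u: "\<And>m. m \<in> nodes P (Suc t) \<Longrightarrow> u m \<in> multipliers P (Suc t) m"
      using subsetD[OF C(2) cC] unfolding averaged_cuts_def by blast
    have "snd (u m) = 0" if "m \<in> nodes P (Suc t)" for m
      using u[OF that] bounds[of "Suc t" m] t that cp by (auto simp: multipliers_def)
    then have "c x = (\<Sum>m\<in>nodes P (Suc t). node_prob P t m * (v m - fst (u m) \<bullet> (xp - x)))" for x
      unfolding c by (intro sum.cong) (auto simp: cut_def case_prod_unfold)
    then have c': "c = (\<lambda>x. \<Sum>m\<in>nodes P (Suc t). node_prob P t m * (v m - fst (u m) \<bullet> (xp - x)))" by auto
    show ?thesis
    proof (rule convex_onI)
      fix x y and w :: real
      have "c ((1 - w) *\<^sub>R x + w *\<^sub>R y) = (1 - w) * c x + w * c y"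
        unfolding c' sum_distrib_left sum.distrib[symmetric]
        by (intro sum.cong) (auto simp: algebra_simps inner_diff_right inner_add_right)
      then show "c ((1 - w) *\<^sub>R x + w *\<^sub>R y) \<le> (1 - w) * c x + w * c y" by simp
    qed (rule cvx)
  qed
  then have "convex_on (states P t) (\<lambda>x. Max (insert 0 ((\<lambda>c. c x) ` C)))"
    using convex_on_Max_insert[OF C(1) cvx, of "\<lambda>c. c"] by simp
  then have cm: "(1 - u) *\<^sub>R x + u *\<^sub>R y \<in> states P t \<and>
      Max (insert 0 ((\<lambda>c. c ((1 - u) *\<^sub>R x + u *\<^sub>R y)) ` C))
      \<le> (1 - u) * Max (insert 0 ((\<lambda>c. c x) ` C)) + u * Max (insert 0 ((\<lambda>c. c y) ` C))"
    if "0 < u" "u < 1" "x \<in> states P t" "y \<in> states P t" for u x y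
    using convex_onD[OF _ _ _ that(3,4), of _ u] convexD_alt[OF cvx that(3,4), of u] that(1,2) by auto
  have "convex_on (states P t) Q"
    by (rule convex_onI) (use cm cvx in \<open>simp_all add: C(3)\<close>)
  then show ?thesis using feas_proj[OF t m] by simp
qed

text \<open>The separating hyperplane of the strict epigraph of the infimal convolution of the cost with \<open>\<sigma>\<close> times
  the norm yields the multiplier; its dual norm is at most \<open>\<sigma>\<close> because the infimal convolution grows
  at most with slope \<open>\<sigma>\<close> in every direction of the state space.\<close>

lemma strong_duality_convex:
  assumes cp: "convex_problem P" "norm_penalties P" and t: "t \<in> {1..horizon P}" and m: "m \<in> nodes P t"
    and xp: "xp \<in> prev_states P t" and Q: "Q \<in> approximations P t"
  obtains u where "u \<in> multipliers P t m" "node_value P t m (\<lambda>x. ereal (Q x)) xp \<le> inner_value P t m xp Q u"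
proof -
  let ?V = "prev_space P t" and ?nm = "prev_norm P t" and ?\<sigma> = "pen_factor P m"
  have t': "t \<le> horizon P" using t by simp
  note sub = prev_space[OF t'] and nm = prev_norm[OF t']
  have xpV: "xp \<in> ?V" using xp prev_states_subset[OF t'] by auto
  have Q0: "0 \<le> Q x" if "x \<in> fst ` feas P m" for x using approximations_nonneg[OF t' Q m that] .
  have "0 \<le> node_value P t m (\<lambda>x. ereal (Q x)) xp" "node_value P t m (\<lambda>x. ereal (Q x)) xp < \<infinity>"
    using Q0 node_value_nonneg[OF t' m xp, of "\<lambda>x. ereal (Q x)"]
      node_value_finite[OF t' m, of "\<lambda>x. ereal (Q x)" xp] by simp_all
  then obtain v where v: "node_value P t m (\<lambda>x. ereal (Q x)) xp = ereal v"
    by (cases "node_value P t m (\<lambda>x. ereal (Q x)) xp") auto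
  have pen_eq: "pen P m x = ?nm x" if "x \<in> ?V" for x
    using cp(2) t m that by (auto simp: norm_penalties_def)
  \<comment> \<open>The origin corresponds to the state \<open>xp\<close> and the value
    \<open>v\<close>. The perturbation \<open>q\<close> ranges over the whole subspace, which is
    possible because the norm, unlike the cost, is defined there.\<close>
  define E where "E = {(q, s). q \<in> ?V \<and> (\<exists>x y z c. (x, y) \<in> feas P m \<and> z \<in> prev_states P t \<and>
      cost P m z y x = ereal c \<and> c + Q x + ?\<sigma> * ?nm (xp + q - z) < v + s)}"
  have cost_real: "\<exists>c. cost P m z y x = ereal c" if "z \<in> prev_states P t" "(x, y) \<in> feas P m" "cost P m z y x < \<infinity>" for x y z
    using cost_nonneg[OF t' m that(1,2)] that(3) by (cases "cost P m z y x") auto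
  obtain x0 y0 z0 c0 where pt: "z0 \<in> prev_states P t" "(x0, y0) \<in> feas P m" "cost P m z0 y0 x0 = ereal c0"
    using finite_cost_point[OF t' m] cost_real by metis
  have "convex E"
    unfolding convex_alt
  proof (intro ballI allI impI)
    fix p1 p2 and \<theta> :: real
    assume p: "p1 \<in> E" "p2 \<in> E" and \<theta>: "0 \<le> \<theta> \<and> \<theta> \<le> 1"
    show "(1 - \<theta>) *\<^sub>R p1 + \<theta> *\<^sub>R p2 \<in> E"
    proof (cases "\<theta> = 0 \<or> \<theta> = 1")
      case True
      then show ?thesis using p by auto
    next
      case False
      then have \<theta>: "0 < \<theta>" "\<theta> < 1" using \<theta> by auto
      obtain q1 s1 x1 y1 z1 c1 where 1: "p1 = (q1, s1)" "q1 \<in> ?V" "(x1, y1) \<in> feas P m" "z1 \<in> prev_states P t"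
        "cost P m z1 y1 x1 = ereal c1" "c1 + Q x1 + ?\<sigma> * ?nm (xp + q1 - z1) < v + s1"
        using p(1) by (auto simp: E_def)
      obtain q2 s2 x2 y2 z2 c2 where 2: "p2 = (q2, s2)" "q2 \<in> ?V" "(x2, y2) \<in> feas P m" "z2 \<in> prev_states P t"
        "cost P m z2 y2 x2 = ereal c2" "c2 + Q x2 + ?\<sigma> * ?nm (xp + q2 - z2) < v + s2"
        using p(2) by (auto simp: E_def)
      define mix where "mix = (\<lambda>a b :: 'a. (1 - \<theta>) *\<^sub>R a + \<theta> *\<^sub>R b)"
      let ?y = "(1 - \<theta>) *\<^sub>R y1 + \<theta> *\<^sub>R y2"
      have cvx: "convex (feas P m)" "convex_ereal_on (prev_states P t \<times> feas P m) (\<lambda>(z, x, y). cost P m z y x)"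
        using cp(1) t' m by (auto simp: convex_problem_def)
      have cvx_prev: "convex (prev_states P t)" using convex_states[OF cp(1), of "t - 1"] t by (auto simp: prev_states_def)
      have feas: "(mix x1 x2, ?y) \<in> feas P m"
        using convexD_alt[OF cvx(1) 1(3) 2(3), of \<theta>] \<theta> by (simp add: mix_def)
      have z: "mix z1 z2 \<in> prev_states P t"
        using convexD_alt[OF cvx_prev 1(4) 2(4), of \<theta>] \<theta> by (simp add: mix_def)
      have q: "mix q1 q2 \<in> ?V" using 1(2) 2(2) subspace_add[OF sub] subspace_scale[OF sub] by (simp add: mix_def)
      have "cost P m (mix z1 z2) ?y (mix x1 x2) \<le> ereal (1 - \<theta>) * ereal c1 + ereal \<theta> * ereal c2"
      proof -
        have "(z1, x1, y1) \<in> prev_states P t \<times> feas P m" "(z2, x2, y2) \<in> prev_states P t \<times> feas P m"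
          using 1 2 by auto
        with cvx(2)[unfolded convex_ereal_on_def] \<theta>
        have "(case (1 - \<theta>) *\<^sub>R (z1, x1, y1) + \<theta> *\<^sub>R (z2, x2, y2) of (z, x, y) \<Rightarrow> cost P m z y x)
            \<le> ereal (1 - \<theta>) * (case (z1, x1, y1) of (z, x, y) \<Rightarrow> cost P m z y x) +
              ereal \<theta> * (case (z2, x2, y2) of (z, x, y) \<Rightarrow> cost P m z y x)"
          by blast
        then show ?thesis using 1(5) 2(5) by (simp add: mix_def)
      qed
      then have cle: "cost P m (mix z1 z2) ?y (mix x1 x2) \<le> ereal ((1 - \<theta>) * c1 + \<theta> * c2)" by simp
      then have "cost P m (mix z1 z2) ?y (mix x1 x2) < \<infinity>" by (rule le_less_trans) simp
      then obtain c where c: "cost P m (mix z1 z2) ?y (mix x1 x2) = ereal c" using cost_real z feas by blast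
      have Qle: "Q (mix x1 x2) \<le> (1 - \<theta>) * Q x1 + \<theta> * Q x2"
      proof -
        have "x1 \<in> fst ` feas P m" "x2 \<in> fst ` feas P m" using 1(3) 2(3) by (metis fst_conv image_eqI)+
        then show ?thesis using convex_onD[OF approximations_convex[OF cp t' m Q], of \<theta> x1 x2] \<theta>
          by (simp add: mix_def)
      qed
      have d: "xp + q1 - z1 \<in> ?V" "xp + q2 - z2 \<in> ?V"
        using 1 2 xpV prev_states_subset[OF t'] by (auto intro!: subspace_diff[OF sub] subspace_add[OF sub])
      have "xp + mix q1 q2 - mix z1 z2 = mix (xp + q1 - z1) (xp + q2 - z2)"
        by (simp add: mix_def algebra_simps)
      then have "?nm (xp + mix q1 q2 - mix z1 z2) \<le> (1 - \<theta>) * ?nm (xp + q1 - z1) + \<theta> * ?nm (xp + q2 - z2)"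
        using convex_onD[OF convex_on_norm_on[OF sub nm], of \<theta>] d \<theta> by (simp add: mix_def)
      then have "?\<sigma> * ?nm (xp + mix q1 q2 - mix z1 z2) \<le> ?\<sigma> * ((1 - \<theta>) * ?nm (xp + q1 - z1) + \<theta> * ?nm (xp + q2 - z2))"
        using pen_factor_pos[OF t' m] by (intro mult_left_mono) auto
      then have "c + Q (mix x1 x2) + ?\<sigma> * ?nm (xp + mix q1 q2 - mix z1 z2) \<le>
          (1 - \<theta>) * (c1 + Q x1 + ?\<sigma> * ?nm (xp + q1 - z1)) + \<theta> * (c2 + Q x2 + ?\<sigma> * ?nm (xp + q2 - z2))"
        using Qle cle unfolding c by (simp add: algebra_simps)
      also have "\<dots> < (1 - \<theta>) * (v + s1) + \<theta> * (v + s2)"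
        by (rule add_strict_mono; rule mult_strict_left_mono) (use 1(6) 2(6) \<theta> in simp_all)
      also have "\<dots> = v + ((1 - \<theta>) * s1 + \<theta> * s2)" by (simp add: algebra_simps)
      finally show ?thesis using feas z q c unfolding 1(1) 2(1) E_def by (auto simp: mix_def)
    qed
  qed
  moreover have E_pt: "(q, s) \<in> E" if "q \<in> ?V" "c0 + Q x0 + ?\<sigma> * ?nm (xp + q - z0) < v + s" for q s
    using that pt by (auto simp: E_def)
  have "E \<noteq> {}" using E_pt[of 0 "c0 + Q x0 + ?\<sigma> * ?nm (xp + 0 - z0) - v + 1"] subspace_0[OF sub] by auto
  \<comment> \<open>The epigraph is strict and \<open>v\<close> is the minimum at
    \<open>xp\<close>.\<close>
  moreover have "0 \<notin> E"
  proof
    assume "0 \<in> E"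
    then obtain x y z c where *: "(x, y) \<in> feas P m" "z \<in> prev_states P t"
      "cost P m z y x = ereal c" "c + Q x + ?\<sigma> * ?nm (xp - z) < v" by (auto simp: E_def zero_prod_def)
    have "ereal v \<le> reg_objective P m xp (\<lambda>x. ereal (Q x)) (x, y, z)"
      unfolding v[symmetric] node_value_def using * by (intro INF_lower) (auto simp: subproblem_feasible_def)
    also have "\<dots> = ereal (c + Q x + ?\<sigma> * ?nm (xp - z))"
      using * pen_eq[OF prev_states_diff[OF t' xp *(2)]] by (simp add: reg_objective_def)
    finally show False using * by simp
  qed
  ultimately obtain a where a: "a \<in> span E" "a \<noteq> 0" "\<And>p. p \<in> E \<Longrightarrow> 0 \<le> a \<bullet> p"
    using separating_hyperplane_set_0_inspan by blast
  obtain l \<beta> where lb: "a = (l, \<beta>)" by (cases a)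
  \<comment> \<open>Multipliers must lie in the subspace; separating within \<open>span E\<close>
    ensures this.\<close>
  have "span E \<subseteq> ?V \<times> UNIV" by (rule span_minimal) (auto simp: E_def intro: subspace_Times sub subspace_UNIV)
  then have lV: "l \<in> ?V" using a(1) lb by auto
  have sep: "0 \<le> l \<bullet> q + \<beta> * s" if "(q, s) \<in> E" for q s using a(3)[OF that] lb by simp
  \<comment> \<open>\<open>E\<close> is unbounded upwards in \<open>s\<close>.\<close>
  have \<beta>0: "0 \<le> \<beta>"
  proof (rule ccontr)
    assume neg: "\<not> 0 \<le> \<beta>"
    let ?s = "\<bar>c0 + Q x0 + ?\<sigma> * ?nm (xp + 0 - z0) - v\<bar> + 1"
    have "0 \<le> \<beta> * ?s" using sep[OF E_pt[of 0 ?s]] subspace_0[OF sub] by auto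
    moreover have "0 < ?s" by (rule add_nonneg_pos) auto
    ultimately show False using neg by (simp add: zero_le_mult_iff)
  qed
  \<comment> \<open>A vertical hyperplane is impossible: above every \<open>q\<close> of the
    subspace, in particular above \<open>- l\<close>, there are points of \<open>E\<close>.\<close>
  have "\<beta> \<noteq> 0"
  proof
    assume "\<beta> = 0"
    then have "0 \<le> l \<bullet> (- l)"
      using sep[OF E_pt[of "- l" "c0 + Q x0 + ?\<sigma> * ?nm (xp + (- l) - z0) - v + 1"]] subspace_neg[OF sub lV] by auto
    then have "l \<bullet> l = 0" by (intro antisym inner_ge_zero) simp
    then have "l = 0" by simp
    then show False using \<open>\<beta> = 0\<close> a(2) lb by (simp add: zero_prod_def)
  qed
  then have \<beta>: "0 < \<beta>" using \<beta>0 by simp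
  define k where "k = - (1 / \<beta>) *\<^sub>R l"
  have kV: "k \<in> ?V" unfolding k_def by (rule subspace_scale[OF sub lV])
  have sep': "k \<bullet> q \<le> c + Q x + ?\<sigma> * ?nm (xp + q - z) - v"
    if "q \<in> ?V" "(x, y) \<in> feas P m" "z \<in> prev_states P t" "cost P m z y x = ereal c" for q x y z c
  proof (rule field_le_epsilon)
    fix e :: real assume "0 < e"
    then have "(q, c + Q x + ?\<sigma> * ?nm (xp + q - z) - v + e) \<in> E"
      unfolding E_def mem_Collect_eq prod.case
      by (intro conjI exI[of _ x] exI[of _ y] exI[of _ z] exI[of _ c]) (use that in simp_all)
    from sep[OF this] have "0 \<le> l \<bullet> q + \<beta> * (c + Q x + ?\<sigma> * ?nm (xp + q - z) - v + e)" .
    then show "k \<bullet> q \<le> c + Q x + ?\<sigma> * ?nm (xp + q - z) - v + e"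
      using \<beta> by (simp add: k_def field_simps)
  qed
  have "k \<bullet> w \<le> ?\<sigma> * ?nm w" if w: "w \<in> ?V" for w
  proof (rule ccontr)
    assume neg: "\<not> k \<bullet> w \<le> ?\<sigma> * ?nm w"
    \<comment> \<open>Along \<open>q = z0 - xp + n *\<^sub>R w\<close> the norm term is exactly
      \<open>n\<close> times the norm of \<open>w\<close>, so a slope above \<sigma> would violate
      the separation for large \<open>n\<close>; the \<open>n\<close> used below exceeds the limit
      by construction.\<close>
    let ?K = "c0 + Q x0 - v - k \<bullet> (z0 - xp)"
    have "n * (k \<bullet> w - ?\<sigma> * ?nm w) \<le> ?K" if n: "0 \<le> n" for n :: real
    proof -
      have "z0 - xp + n *\<^sub>R w \<in> ?V"
        using w xpV pt(1) prev_states_subset[OF t'] by (auto intro!: subspace_diff[OF sub] subspace_add[OF sub] subspace_scale[OF sub])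
      from sep'[OF this pt(2,1,3)] show ?thesis
        using norm_on_scaleR[OF sub nm w, of n] n by (simp add: algebra_simps inner_add_right)
    qed
    from this[of "(\<bar>?K\<bar> + 1) / (k \<bullet> w - ?\<sigma> * ?nm w)"] neg
    have "\<bar>?K\<bar> + 1 \<le> ?K" by (simp only: not_le nonzero_eq_divide_eq times_divide_eq_left) simp
    then show False by linarith
  qed
  then have dual: "dual_norm ?V ?nm k \<le> ?\<sigma>"
    using pen_factor_pos[OF t' m] by (intro dual_norm_leI[OF sub nm]) auto
  have "(k, 0) \<in> multipliers P t m"
    using dual kV bounds[OF t m] cp by (auto simp: multipliers_def)
  moreover have "ereal v \<le> inner_value P t m xp Q (k, 0)"
    unfolding inner_value_def prod.case
  proof (rule INF_greatest, clarify)
    fix x y z assume u: "(x, y, z) \<in> subproblem_feasible P t m"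
    then have f: "(x, y) \<in> feas P m" "z \<in> prev_states P t" by (auto simp: subproblem_feasible_def)
    show "ereal v \<le> cost P m z y x + ereal (k \<bullet> (xp - z) + 0 * pen P m (xp - z) + Q x)"
    proof (cases "cost P m z y x < \<infinity>")
      case True
      then obtain c where c: "cost P m z y x = ereal c" using cost_real f by blast
      \<comment> \<open>The perturbation that moves \<open>xp\<close> onto \<open>z\<close> removes
        the norm term and leaves the linear one.\<close>
      have "z - xp \<in> ?V" by (rule prev_states_diff[OF t' f(2) xp])
      from sep'[OF this f c] show ?thesis
        using c norm_on_zero[OF sub nm] by (simp add: inner_diff_right)
    qed simp
  qed
  ultimately show ?thesis using that v by metis
qed

text \<open>Outside the convex case with norm penalties the multiplier
  \<open>(0, pen_factor P m)\<close> is admissible and its inner problem is the regularized node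
  problem itself, so there is no gap.\<close>

lemma strong_duality:
  assumes t: "t \<in> {1..horizon P}" and m: "m \<in> nodes P t"
    and xp: "xp \<in> prev_states P t" and Q: "Q \<in> approximations P t"
  obtains u where "u \<in> multipliers P t m" "node_value P t m (\<lambda>x. ereal (Q x)) xp \<le> inner_value P t m xp Q u"
proof (cases "convex_problem P \<and> norm_penalties P")
  case True
  then show ?thesis using strong_duality_convex[OF _ _ assms] that by blast
next
  case False
  have t': "t \<le> horizon P" using t by simp
  have "dual_norm (prev_space P t) (prev_norm P t) 0 \<le> 0"
    by (intro dual_norm_leI[OF prev_space[OF t'] prev_norm[OF t']]) auto
  then have "(0, pen_factor P m) \<in> multipliers P t m"
    using False bounds[OF t m] bounds_nonneg[OF t m] pen_factor_pos[OF t' m] subspace_0[OF prev_space[OF t']]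
    by (auto simp: multipliers_def)
  moreover have "node_value P t m (\<lambda>x. ereal (Q x)) xp = inner_value P t m xp Q (0, pen_factor P m)"
    by (auto simp: node_value_def inner_value_def reg_objective_def add.assoc intro!: INF_cong)
  ultimately show ?thesis using that by simp
qed

text \<open>The optimal value is nonnegative by duality and finite by a point of finite cost, so the
  conversion to a real is faithful.\<close>

lemma dual_value_eq:
  assumes t: "t \<in> {1..horizon P}" and m: "m \<in> nodes P t"
    and xp: "xp \<in> prev_states P t" and Q: "Q \<in> approximations P t"
    and u: "is_arg_max (inner_value P t m xp Q) (\<lambda>u. u \<in> multipliers P t m) u"
  shows "inner_value P t m xp Q u = ereal (dual_value P t m xp Q)"
    and "node_value P t m (\<lambda>x. ereal (Q x)) xp \<le> ereal (dual_value P t m xp Q)"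
proof -
  have t': "t \<le> horizon P" using t by simp
  have max: "u \<in> multipliers P t m" "\<And>w. w \<in> multipliers P t m \<Longrightarrow> inner_value P t m xp Q w \<le> inner_value P t m xp Q u"
    using u by (auto simp: is_arg_max_linorder)
  then have sup: "(SUP w\<in>multipliers P t m. inner_value P t m xp Q w) = inner_value P t m xp Q u"
    by (intro antisym SUP_least SUP_upper) auto
  have ge: "node_value P t m (\<lambda>x. ereal (Q x)) xp \<le> inner_value P t m xp Q u"
    using strong_duality[OF t m xp Q] max(2) by (metis order.trans)
  have "0 \<le> node_value P t m (\<lambda>x. ereal (Q x)) xp"
    using approximations_nonneg[OF t' Q m] by (intro node_value_nonneg[OF t' m xp]) auto
  then have "0 \<le> inner_value P t m xp Q u" using ge by simp
  moreover obtain x y z where pt: "z \<in> prev_states P t" "(x, y) \<in> feas P m" "cost P m z y x < \<infinity>"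
    by (rule finite_cost_point[OF t' m])
  have "inner_value P t m xp Q u \<le> cost P m z y x + ereal (fst u \<bullet> (xp - z) + snd u * pen P m (xp - z) + Q x)"
    using pt by (auto simp: inner_value_def case_prod_unfold subproblem_feasible_def intro!: INF_lower2[of "(x, y, z)"])
  then have "inner_value P t m xp Q u < \<infinity>" using pt(3) by (auto simp: less_top[symmetric] top_ereal_def)
  ultimately show *: "inner_value P t m xp Q u = ereal (dual_value P t m xp Q)"
    unfolding dual_value_def sup by (cases "inner_value P t m xp Q u") auto
  show "node_value P t m (\<lambda>x. ereal (Q x)) xp \<le> ereal (dual_value P t m xp Q)" using ge * by simp
qed

lemma cut_self: "t \<le> horizon P \<Longrightarrow> m \<in> nodes P t \<Longrightarrow> cut P m xp u v xp = v"
  using pen_zero by (simp add: cut_def case_prod_unfold)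

text \<open>Choosing the copy \<open>z = x\<close> in the inner problem produces exactly the
  multiplier terms that the cut subtracts; no penalty remains.\<close>

lemma cut_valid:
  assumes t: "t \<in> {1..horizon P}" and m: "m \<in> nodes P t"
    and x: "x \<in> prev_states P t" "(x', y) \<in> feas P m"
    and v: "inner_value P t m xp Q u = ereal v"
  shows "ereal (cut P m xp u v x) \<le> cost P m x y x' + ereal (Q x')"
proof -
  have "ereal v \<le> cost P m x y x' + ereal (fst u \<bullet> (xp - x) + snd u * pen P m (xp - x) + Q x')"
    unfolding v[symmetric] using x
    by (auto simp: inner_value_def case_prod_unfold subproblem_feasible_def intro!: INF_lower2[of "(x', y, x)"])
  moreover have "0 \<le> cost P m x y x'" using t cost_nonneg[OF _ m x] by simp
  ultimately show ?thesis by (cases "cost P m x y x'") (auto simp: cut_def case_prod_unfold)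
qed

end

section \<open>The backward pass\<close>

lemma Max_insert_Max_insert:
  fixes a :: "'c::linorder"
  assumes "finite A" "finite B"
  shows "Max (insert (Max (insert a A)) B) = Max (insert a (A \<union> B))"
proof (cases "B = {}")
  case False
  have "Max (insert a (A \<union> B)) = Max (insert a A \<union> B)" by simp
  also have "\<dots> = max (Max (insert a A)) (Max B)" using assms False by (intro Max_Un) auto
  finally show ?thesis using assms False by simp
qed simp

lemma forward_state_cong:
  assumes "\<And>s. s \<in> {1..t} \<Longrightarrow> scen s = scen' s"
  shows "forward_state fo Q scen x0 t = forward_state fo Q scen' x0 t"
  using assms by (induction t) auto

lemma backward_approx_horizon: "horizon P \<le> t \<Longrightarrow> backward_approx P M bo Q xs t = (\<lambda>_. 0)"
  by (simp add: backward_approx.simps)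

lemma backward_approx_cong:
  assumes "\<And>j s. j \<in> {1..M} \<Longrightarrow> s < horizon P \<Longrightarrow> xs j s = xs' j s"
  shows "backward_approx P M bo Q xs t = backward_approx P M bo Q xs' t"
proof (induction "horizon P - t" arbitrary: t)
  case 0
  then show ?case by (simp add: backward_approx_horizon)
next
  case (Suc k)
  then have t: "t < horizon P" by simp
  have IH: "backward_approx P M bo Q xs (Suc t) = backward_approx P M bo Q xs' (Suc t)"
    using Suc by (intro Suc.hyps(1)) simp
  show ?case
    using t assms IH by (subst (1 2) backward_approx.simps) (simp cong: image_cong_simp)
qed

text \<open>Finitely many samples determine the run up to iteration \<open>k\<close>; without this
  it could not be counted.\<close>

lemma sddp_cong:
  assumes "\<And>i j t. i \<in> {1..k} \<Longrightarrow> j \<in> {1..M} \<Longrightarrow> t \<in> {1..horizon P} \<Longrightarrow> f i j t = g i j t"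
  shows "sddp P M fo bo ro f k = sddp P M fo bo ro g k"
  using assms
proof (induction k)
  case (Suc k)
  then have IH: "sddp P M fo bo ro f k = sddp P M fo bo ro g k" by simp
  obtain Q x0 y0 where s: "sddp P M fo bo ro g k = (Q, (x0, y0))" by (metis prod.exhaust)
  have "backward_approx P M (bo (Suc k)) Q (\<lambda>j. forward_state (fo (Suc k)) Q (f (Suc k) j) x0) =
      backward_approx P M (bo (Suc k)) Q (\<lambda>j. forward_state (fo (Suc k)) Q (g (Suc k) j) x0)"
    by (intro ext[of "backward_approx P M (bo (Suc k)) Q (\<lambda>j. forward_state (fo (Suc k)) Q (f (Suc k) j) x0)"]
        backward_approx_cong forward_state_cong Suc.prems) auto
  then show ?case by (simp add: IH s)
qed simp

context regularized_problem
begin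

text \<open>Oracles promise optimality only for inputs in \<open>approximations\<close>, so
  membership must be carried through all iterations.\<close>

definition admissible :: "(nat \<Rightarrow> 'a \<Rightarrow> real) \<Rightarrow> bool" where
  "admissible Q \<longleftrightarrow> (\<forall>t\<le>horizon P. Q t \<in> approximations P t)"

text \<open>The approximations underestimate the cost-to-go functions of the original problem, but not
  necessarily \<open>QR\<close>: the following inequality involves no penalty.\<close>

definition underestimating :: "(nat \<Rightarrow> 'a \<Rightarrow> real) \<Rightarrow> bool" where
  "underestimating Q \<longleftrightarrow> (\<forall>t<horizon P. \<forall>x\<in>states P t. \<forall>X Y.
     (\<forall>m\<in>nodes P (Suc t). (X m, Y m) \<in> feas P m) \<longrightarrow>
     ereal (Q t x) \<le> (\<Sum>m\<in>nodes P (Suc t). ereal (node_prob P t m) * (cost P m x (Y m) (X m) + ereal (Q (Suc t) (X m)))))"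

lemma admissibleD: "admissible Q \<Longrightarrow> t \<le> horizon P \<Longrightarrow> Q t \<in> approximations P t"
  by (simp add: admissible_def)

lemma admissible_horizon: "admissible Q \<Longrightarrow> Q (horizon P) = (\<lambda>_. 0)"
  using admissibleD[of Q "horizon P"] approximations_horizon by auto

lemma initial_approx_admissible: "admissible (initial_approx P)"
  by (auto simp: admissible_def initial_approx_def approximations_def intro!: exI[of _ "{}"])

lemma initial_approx_underestimating: "underestimating (initial_approx P)"
  unfolding underestimating_def
proof (intro allI impI ballI)
  fix t x and X :: "'n \<Rightarrow> 'a" and Y :: "'n \<Rightarrow> 'b"
  assume t: "t < horizon P" and x: "x \<in> states P t" and XY: "\<forall>m\<in>nodes P (Suc t). (X m, Y m) \<in> feas P m"
  have "0 \<le> (\<Sum>m\<in>nodes P (Suc t). ereal (node_prob P t m) * (cost P m x (Y m) (X m) + ereal (initial_approx P (Suc t) (X m))))"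
  proof (intro sum_nonneg ereal_0_le_mult add_nonneg_nonneg)
    fix m assume m: "m \<in> nodes P (Suc t)"
    show "0 \<le> ereal (node_prob P t m)" using node_prob_pos[OF t m] by simp
    show "0 \<le> cost P m x (Y m) (X m)" using t m x XY by (intro cost_nonneg[of "Suc t"]) auto
    have "(X m, Y m) \<in> feas P m" using XY m by simp
    then have "X m \<in> fst ` feas P m" by (metis fst_conv image_eqI)
    then show "0 \<le> ereal (initial_approx P (Suc t) (X m))"
      using approximations_nonneg[OF _ admissibleD[OF initial_approx_admissible] m] t by simp
  qed
  then show "ereal (initial_approx P t x) \<le> (\<Sum>m\<in>nodes P (Suc t). ereal (node_prob P t m) * (cost P m x (Y m) (X m) + ereal (initial_approx P (Suc t) (X m))))"
    using t x by (simp add: initial_approx_def zero_ereal_def)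
qed

text \<open>Compares with an original solution of value at most \<open>v_reg\<close>: along it the
  penalty-free inequality of \<open>underestimating\<close> telescopes.\<close>

lemma root_objective_le_v_reg:
  assumes Q: "admissible Q" "underestimating Q"
    and u: "is_arg_min (root_objective P (\<lambda>x. ereal (Q 0 x))) (\<lambda>u. u \<in> feas P (rootnode P)) u"
  shows "root_objective P (\<lambda>x. ereal (Q 0 x)) u \<le> v_reg P"
proof -
  obtain x y where xy: "tree_feasible P x y" "tree_objective P x y \<le> v_reg P" by (rule tree_objective_le_v_reg)
  define c where "c = (\<lambda>ns. cost P (tree_node P ns) (parent_state x ns) (y ns) (x ns))"
  have feas: "(x ns, y ns) \<in> feas P (tree_node P ns)" if "ns \<in> tree P" for ns
    using xy(1) that by (simp add: tree_feasible_def)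
  have c0: "0 \<le> c ns" if "ns \<in> tree P" for ns
    unfolding c_def
    by (rule cost_nonneg[OF tree_length_le[OF that] tree_node_in_nodes[OF that] parent_state_in_prev_states[OF xy(1) that] feas[OF that]])
  have xf: "x ns \<in> fst ` feas P (tree_node P ns)" if "ns \<in> tree P" for ns
    using feas[OF that] by (metis fst_conv image_eqI)
  have nil: "[] \<in> tree P" by (simp add: tree_def)
  have "root_objective P (\<lambda>x. ereal (Q 0 x)) u \<le> root_objective P (\<lambda>x. ereal (Q 0 x)) (x [], y [])"
    using u feas[OF nil] by (auto simp: is_arg_min_linorder tree_node_def)
  also have "\<dots> = c [] + ereal (Q (length ([] :: 'n list)) (x []))"
    by (simp add: root_objective_def c_def tree_node_def parent_state_def)
  also have "\<dots> \<le> (\<Sum>ns\<in>tree P. ereal (tree_prob P ns) * c ns)"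
  proof (rule tree_sum_ge[OF c0])
    fix ns assume ns: "ns \<in> tree P"
    show "0 \<le> ereal (Q (length ns) (x ns))"
      using approximations_nonneg[OF tree_length_le[OF ns] admissibleD[OF Q(1) tree_length_le[OF ns]] tree_node_in_nodes[OF ns] xf[OF ns]] by simp
    show "length ns = horizon P \<Longrightarrow> ereal (Q (length ns) (x ns)) = 0"
      using admissible_horizon[OF Q(1)] by (simp add: zero_ereal_def)
    assume l: "length ns < horizon P"
    have "x ns \<in> states P (length ns)" using xf[OF ns] feas_proj[OF l tree_node_in_nodes[OF ns]] by simp
    moreover have "(x (ns @ [m]), y (ns @ [m])) \<in> feas P m" if m: "m \<in> nodes P (Suc (length ns))" for m
    proof -
      have "ns @ [m] \<in> tree P" using ns l m by (auto simp: tree_def nth_append less_Suc_eq)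
      from feas[OF this] show ?thesis by (simp add: tree_node_def)
    qed
    ultimately show "ereal (Q (length ns) (x ns)) \<le> (\<Sum>m\<in>nodes P (Suc (length ns)). ereal (node_prob P (length ns) m) *
        (c (ns @ [m]) + ereal (Q (length (ns @ [m])) (x (ns @ [m])))))"
      using Q(2)[unfolded underestimating_def, rule_format, OF l, of "x ns" "\<lambda>m. x (ns @ [m])" "\<lambda>m. y (ns @ [m])"]
      by (simp add: c_def tree_node_def parent_state_def)
  qed
  also have "\<dots> \<le> v_reg P" using xy(2) by (simp add: tree_objective_def c_def)
  finally show ?thesis .
qed

text \<open>With a gap of at most \<epsilon> the true root objective would exceed the approximate
  optimum, itself at most \<open>v_reg\<close>, by no more than \<epsilon>.\<close>

lemma root_gap:
  assumes Q: "admissible Q" "underestimating Q"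
    and u: "is_arg_min (root_objective P (\<lambda>x. ereal (Q 0 x))) (\<lambda>u. u \<in> feas P (rootnode P)) u"
    and not_opt: "\<not> eps_optimal_root P \<epsilon> u"
  shows "\<epsilon> < qr 0 (fst u) - Q 0 (fst u)"
proof (rule ccontr)
  assume "\<not> \<epsilon> < qr 0 (fst u) - Q 0 (fst u)"
  then have le: "qr 0 (fst u) \<le> Q 0 (fst u) + \<epsilon>" by simp
  have f: "u \<in> feas P (rootnode P)" using u by (simp add: is_arg_min_def)
  obtain x y where xy: "u = (x, y)" by (cases u)
  have "x \<in> fst ` feas P (rootnode P)" using f xy by (metis fst_conv image_eqI)
  then have qr: "QR P 0 x = ereal (qr 0 x)" by (intro QR_eq_qr[OF _ root_node]) auto
  have "root_objective P (QR P 0) u \<le> cost P (rootnode P) 0 y x + (ereal (Q 0 x) + ereal \<epsilon>)"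
    unfolding xy root_objective_def prod.case qr using le xy by (intro add_left_mono) simp
  also have "\<dots> = root_objective P (\<lambda>x. ereal (Q 0 x)) u + ereal \<epsilon>"
    by (simp add: xy root_objective_def add.assoc)
  also have "\<dots> \<le> v_reg P + ereal \<epsilon>" by (intro add_right_mono root_objective_le_v_reg[OF Q u])
  finally show False using not_opt f by (simp add: eps_optimal_root_def)
qed

context
  fixes M :: nat and b :: "('n, 'a) bwd_oracle" and Q :: "nat \<Rightarrow> 'a \<Rightarrow> real" and xs :: "nat \<Rightarrow> nat \<Rightarrow> 'a"
  assumes b: "\<And>t n xp R. t \<in> {1..horizon P} \<Longrightarrow> n \<in> nodes P t \<Longrightarrow> xp \<in> states P (t - 1) \<Longrightarrow>
          R \<in> approximations P t \<Longrightarrow> is_arg_max (inner_value P t n xp R) (\<lambda>u. u \<in> multipliers P t n) (b t n xp R)"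
    and Q: "admissible Q"
    and xs: "\<And>j t. j \<in> {1..M} \<Longrightarrow> t < horizon P \<Longrightarrow> xs j t \<in> states P t"
begin

abbreviation Q' :: "nat \<Rightarrow> 'a \<Rightarrow> real" where
  "Q' \<equiv> backward_approx P M b Q xs"

definition new_cut :: "nat \<Rightarrow> nat \<Rightarrow> 'a \<Rightarrow> real" where
  "new_cut t j x = (\<Sum>m\<in>nodes P (Suc t). node_prob P t m *
            cut P m (xs j t) (b (Suc t) m (xs j t) (Q' (Suc t))) (dual_value P (Suc t) m (xs j t) (Q' (Suc t))) x)"

lemma backward_approx_eq:
  "t < horizon P \<Longrightarrow> Q' t = (\<lambda>x\<in>states P t. Max (insert (Q t x) ((\<lambda>j. new_cut t j x) ` {1..M})))"
  unfolding new_cut_def by (subst backward_approx.simps) simp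

text \<open>Induction from the last stage downwards, as cuts of stage \<open>t\<close> use the
  already updated approximation of stage \<open>Suc t\<close>. The new cuts just enlarge the finite
  set.\<close>

lemma backward_approx_admissible: "admissible Q'"
proof -
  have "t \<le> horizon P \<Longrightarrow> Q' t \<in> approximations P t" for t
  proof (induction "horizon P - t" arbitrary: t)
    case 0
    then have "t = horizon P" by simp
    then show ?case using approximations_horizon backward_approx_horizon[of P t M b Q xs] by simp
  next
    case (Suc k)
    then have t: "t < horizon P" by simp
    have IH: "Q' (Suc t) \<in> approximations P (Suc t)" using Suc t by (intro Suc.hyps(1)) auto
    obtain C where C: "finite C" "C \<subseteq> averaged_cuts P t" "Q t = (\<lambda>x\<in>states P t. Max (insert 0 ((\<lambda>c. c x) ` C)))"
      using admissibleD[OF Q, of t] t by (auto simp: approximations_def)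
    have "b (Suc t) m (xs j t) (Q' (Suc t)) \<in> multipliers P (Suc t) m"
      if "j \<in> {1..M}" "m \<in> nodes P (Suc t)" for j m
      using b[of "Suc t" m "xs j t" "Q' (Suc t)"] that t xs IH by (auto simp: is_arg_max_def)
    then have cuts: "new_cut t j \<in> averaged_cuts P t" if "j \<in> {1..M}" for j
      using that xs t unfolding averaged_cuts_def
      by (auto simp: new_cut_def fun_eq_iff
          intro!: exI[of _ "xs j t"] exI[of _ "\<lambda>m. b (Suc t) m (xs j t) (Q' (Suc t))"])
    have "Q' t = (\<lambda>x\<in>states P t. Max (insert 0 ((\<lambda>c. c x) ` (C \<union> new_cut t ` {1..M}))))"
      unfolding backward_approx_eq[OF t]
      using C(1) by (intro restrict_ext) (simp add: C(3) Max_insert_Max_insert image_Un image_image)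
    then show ?case using t C cuts
      by (auto simp: approximations_def intro!: exI[of _ "C \<union> new_cut t ` {1..M}"])
  qed
  then show ?thesis by (simp add: admissible_def)
qed

lemma backward_approx_ge: "t < horizon P \<Longrightarrow> x \<in> states P t \<Longrightarrow> Q t x \<le> Q' t x"
  by (simp add: backward_approx_eq)

lemma backward_approx_ge_cut: "t < horizon P \<Longrightarrow> x \<in> states P t \<Longrightarrow> j \<in> {1..M} \<Longrightarrow> new_cut t j x \<le> Q' t x"
  by (simp only: backward_approx_eq restrict_apply if_True) (rule Max_ge; simp)

lemma backward_approx_ge': "t \<le> horizon P \<Longrightarrow> m \<in> nodes P t \<Longrightarrow> x \<in> fst ` feas P m \<Longrightarrow> Q t x \<le> Q' t x"
  using backward_approx_ge[of t x] feas_proj[of t m] admissible_horizon[OF Q]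
  by (cases "t = horizon P") (auto simp: backward_approx_horizon)

lemma backward_dual:
  assumes t: "t < horizon P" and j: "j \<in> {1..M}" and m: "m \<in> nodes P (Suc t)"
  shows "inner_value P (Suc t) m (xs j t) (Q' (Suc t)) (b (Suc t) m (xs j t) (Q' (Suc t))) =
      ereal (dual_value P (Suc t) m (xs j t) (Q' (Suc t)))" (is ?A)
    and "node_value P (Suc t) m (\<lambda>x. ereal (Q' (Suc t) x)) (xs j t) \<le>
      ereal (dual_value P (Suc t) m (xs j t) (Q' (Suc t)))" (is ?B)
proof -
  have ap: "Q' (Suc t) \<in> approximations P (Suc t)" using admissibleD[OF backward_approx_admissible] t by simp
  have x: "xs j t \<in> prev_states P (Suc t)" using xs j t by simp
  have "is_arg_max (inner_value P (Suc t) m (xs j t) (Q' (Suc t))) (\<lambda>u. u \<in> multipliers P (Suc t) m)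
      (b (Suc t) m (xs j t) (Q' (Suc t)))"
    using t x m ap by (intro b) auto
  from dual_value_eq[OF _ m x ap this] show ?A ?B using t by auto
qed

text \<open>The maximum is attained either by the old value, whose upper bound can only have grown,
  or by a new cut, valid at each child.\<close>

lemma backward_approx_underestimating:
  assumes "underestimating Q"
  shows "underestimating Q'"
  unfolding underestimating_def
proof (intro allI impI ballI)
  fix t x and X :: "'n \<Rightarrow> 'a" and Y :: "'n \<Rightarrow> 'b"
  assume t: "t < horizon P" and x: "x \<in> states P t" and XY: "\<forall>m\<in>nodes P (Suc t). (X m, Y m) \<in> feas P m"
  let ?S = "\<lambda>R. \<Sum>m\<in>nodes P (Suc t). ereal (node_prob P t m) * (cost P m x (Y m) (X m) + ereal (R (Suc t) (X m)))"
  have p: "0 \<le> ereal (node_prob P t m)" if "m \<in> nodes P (Suc t)" for m using node_prob_pos[OF t that] by simp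
  have Xf: "X m \<in> fst ` feas P m" if "m \<in> nodes P (Suc t)" for m
    using bspec[OF XY that] by (metis fst_conv image_eqI)
  have "ereal (Q t x) \<le> ?S Q" using assms t x XY unfolding underestimating_def by blast
  also have "\<dots> \<le> ?S Q'"
    using backward_approx_ge'[of "Suc t"] Xf t p
    by (intro sum_mono ereal_mult_left_mono add_left_mono) auto
  finally have 1: "ereal (Q t x) \<le> ?S Q'" .
  have 2: "ereal (new_cut t j x) \<le> ?S Q'" if j: "j \<in> {1..M}" for j
  proof -
    have "ereal (new_cut t j x) = (\<Sum>m\<in>nodes P (Suc t). ereal (node_prob P t m) *
        ereal (cut P m (xs j t) (b (Suc t) m (xs j t) (Q' (Suc t))) (dual_value P (Suc t) m (xs j t) (Q' (Suc t))) x))"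
      by (simp add: new_cut_def)
    also have "\<dots> \<le> ?S Q'"
      using t x XY p
      by (intro sum_mono ereal_mult_left_mono cut_valid[OF _ _ _ _ backward_dual(1)[OF t j]]) auto
    finally show ?thesis .
  qed
  have "Q' t x \<in> insert (Q t x) ((\<lambda>j. new_cut t j x) ` {1..M})"
    using t x by (simp only: backward_approx_eq restrict_apply if_True) (rule Max_in; simp)
  then show "ereal (Q' t x) \<le> ?S Q'" using 1 2 by auto
qed

text \<open>At each child: the true node value is at most the regularized objective at the forward
  minimizer \<open>u\<close>, which is at most the old approximate node value plus \<open>g\<close>,
  hence the new one plus \<open>g\<close>, hence the dual value plus \<open>g\<close>. The average
  of the dual values is the value of the new cut at its own trial state. At the last stage
  \<open>QR\<close> and the approximation both vanish, so \<open>g = 0\<close> is reached.\<close>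

lemma backward_approx_progress:
  assumes t: "t < horizon P" and j: "j \<in> {1..M}" and g: "g = 0 \<or> Suc t < horizon P"
    and f: "\<And>m. Suc t < horizon P \<Longrightarrow> m \<in> nodes P (Suc t) \<Longrightarrow>
        \<exists>u. is_arg_min (reg_objective P m (xs j t) (\<lambda>x. ereal (Q (Suc t) x))) (\<lambda>u. u \<in> subproblem_feasible P (Suc t) m) u \<and>
            qr (Suc t) (fst u) - Q (Suc t) (fst u) \<le> g"
  shows "qr t (xs j t) - Q' t (xs j t) \<le> g"
proof -
  let ?x = "xs j t"
  have x: "?x \<in> states P t" using xs t j by simp
  let ?d = "\<lambda>m. dual_value P (Suc t) m ?x (Q' (Suc t))"
  let ?nv = "\<lambda>m. node_value P (Suc t) m (QR P (Suc t)) ?x"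
  have nv: "real_of_ereal (?nv m) \<le> ?d m + g" if m: "m \<in> nodes P (Suc t)" for m
  proof -
    have "?nv m \<le> ereal (?d m) + ereal g"
    proof (cases "Suc t < horizon P")
      case True
      obtain u where u: "is_arg_min (reg_objective P m ?x (\<lambda>x. ereal (Q (Suc t) x))) (\<lambda>u. u \<in> subproblem_feasible P (Suc t) m) u"
        "qr (Suc t) (fst u) - Q (Suc t) (fst u) \<le> g"
        using f[OF True m] by blast
      obtain a y z where uz: "u = (a, y, z)" by (cases u)
      have us: "u \<in> subproblem_feasible P (Suc t) m" using u(1) by (simp add: is_arg_min_def)
      then have a: "a \<in> states P (Suc t)" using uz feas_states[OF True m] by (auto simp: subproblem_feasible_def)
      have "?nv m \<le> reg_objective P m ?x (QR P (Suc t)) u" unfolding node_value_def using us by (rule INF_lower)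
      also have "\<dots> = cost P m z y a + ereal (pen_factor P m * pen P m (?x - z)) + ereal (qr (Suc t) a)"
        using QR_eq_qr'[OF True a] uz by (simp add: reg_objective_def)
      also have "\<dots> \<le> cost P m z y a + ereal (pen_factor P m * pen P m (?x - z)) + (ereal (Q (Suc t) a) + ereal g)"
        using u(2) uz by (intro add_left_mono) simp
      also have "\<dots> = reg_objective P m ?x (\<lambda>x. ereal (Q (Suc t) x)) u + ereal g"
        using uz by (simp add: reg_objective_def add.assoc)
      also have "reg_objective P m ?x (\<lambda>x. ereal (Q (Suc t) x)) u = node_value P (Suc t) m (\<lambda>x. ereal (Q (Suc t) x)) ?x"
        unfolding node_value_def using u(1) by (intro antisym INF_greatest INF_lower) (auto simp: is_arg_min_linorder)
      also have "\<dots> \<le> node_value P (Suc t) m (\<lambda>x. ereal (Q' (Suc t) x)) ?x"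
        using backward_approx_ge'[of "Suc t" m] True m by (intro node_value_mono) auto
      also have "\<dots> \<le> ereal (?d m)" by (rule backward_dual(2)[OF t j m])
      finally show ?thesis by (simp add: add_right_mono)
    next
      case False
      then have T: "Suc t = horizon P" using t by simp
      have "Q' (Suc t) = (\<lambda>_. 0)" by (rule backward_approx_horizon) (simp add: T)
      then have "?nv m = node_value P (Suc t) m (\<lambda>x. ereal (Q' (Suc t) x)) ?x"
        using QR_horizon T by (simp add: zero_ereal_def)
      also have "\<dots> \<le> ereal (?d m)" by (rule backward_dual(2)[OF t j m])
      finally show ?thesis using g False by simp
    qed
    then have "ereal (real_of_ereal (?nv m)) \<le> ereal (?d m) + ereal g"
      by (subst node_value_QR_real[OF t m x, symmetric])
    then show ?thesis by simp
  qed
  have "qr t ?x = (\<Sum>m\<in>nodes P (Suc t). node_prob P t m * real_of_ereal (?nv m))" by (rule qr_step[OF t x])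
  also have "\<dots> \<le> (\<Sum>m\<in>nodes P (Suc t). node_prob P t m * (?d m + g))"
    using nv node_prob_pos[OF t, THEN less_imp_le] by (intro sum_mono mult_left_mono)
  also have "\<dots> = (\<Sum>m\<in>nodes P (Suc t). node_prob P t m * ?d m) + g"
    using node_prob_sum[OF t] by (simp add: distrib_left sum.distrib sum_distrib_right[symmetric])
  also have "(\<Sum>m\<in>nodes P (Suc t). node_prob P t m * ?d m) = new_cut t j ?x"
    unfolding new_cut_def using cut_self[of "Suc t"] t by (intro sum.cong) auto
  also have "\<dots> \<le> Q' t ?x" by (rule backward_approx_ge_cut[OF t x j])
  finally show ?thesis by simp
qed

end

end

section \<open>The algorithm with fixed oracles\<close>

locale deterministic_sddp = regularized_problem P
  for P :: "('n, 'a::euclidean_space, 'b::euclidean_space) mssp" +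
  fixes fo :: "nat \<Rightarrow> ('n, 'a, 'b) fwd_oracle"
    and bo :: "nat \<Rightarrow> ('n, 'a) bwd_oracle"
    and ro :: "nat \<Rightarrow> ('a, 'b) root_oracle"
    and M :: nat
  assumes fo_optimal: "\<And>i t n xp Q. 1 \<le> i \<Longrightarrow> t \<in> {1..<horizon P} \<Longrightarrow>
          n \<in> nodes P t \<Longrightarrow> xp \<in> states P (t - 1) \<Longrightarrow> Q \<in> approximations P t \<Longrightarrow>
          is_arg_min (reg_objective P n xp (\<lambda>x. ereal (Q x)))
            (\<lambda>u. u \<in> subproblem_feasible P t n) (fo i t n xp Q)"
    and bo_optimal: "\<And>i t n xp Q. 1 \<le> i \<Longrightarrow> t \<in> {1..horizon P} \<Longrightarrow>
          n \<in> nodes P t \<Longrightarrow> xp \<in> states P (t - 1) \<Longrightarrow> Q \<in> approximations P t \<Longrightarrow>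
          is_arg_max (inner_value P t n xp Q) (\<lambda>u. u \<in> multipliers P t n) (bo i t n xp Q)"
    and ro_optimal: "\<And>i Q. Q \<in> approximations P 0 \<Longrightarrow>
          is_arg_min (root_objective P (\<lambda>x. ereal (Q x)))
            (\<lambda>u. u \<in> feas P (rootnode P)) (ro i Q)"
begin

definition path_array :: "nat \<Rightarrow> (nat \<Rightarrow> nat \<Rightarrow> nat \<Rightarrow> 'n) \<Rightarrow> bool" where
  "path_array k f \<longleftrightarrow> (\<forall>i\<in>{1..k}. \<forall>j\<in>{1..M}. \<forall>t\<in>{1..horizon P}. f i j t \<in> nodes P t)"

definition approx :: "(nat \<Rightarrow> nat \<Rightarrow> nat \<Rightarrow> 'n) \<Rightarrow> nat \<Rightarrow> nat \<Rightarrow> 'a \<Rightarrow> real" where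
  "approx f k = fst (sddp P M fo bo ro f k)"

definition root_solution :: "(nat \<Rightarrow> nat \<Rightarrow> nat \<Rightarrow> 'n) \<Rightarrow> nat \<Rightarrow> 'a \<times> 'b" where
  "root_solution f k = snd (sddp P M fo bo ro f k)"

text \<open>The states visited in iteration \<open>Suc k\<close>: they use the approximations and
  the root solution left behind by iteration \<open>k\<close>.\<close>

definition trial :: "(nat \<Rightarrow> nat \<Rightarrow> nat \<Rightarrow> 'n) \<Rightarrow> nat \<Rightarrow> nat \<Rightarrow> nat \<Rightarrow> 'a" where
  "trial f k j = forward_state (fo (Suc k)) (approx f k) (f (Suc k) j) (fst (root_solution f k))"

lemma approx_0: "approx f 0 = initial_approx P"
  by (simp add: approx_def)

lemma approx_Suc: "approx f (Suc k) = backward_approx P M (bo (Suc k)) (approx f k) (trial f k)"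
  by (simp add: approx_def trial_def[abs_def] root_solution_def case_prod_unfold Let_def)

lemma root_solution_eq: "root_solution f k = ro k (approx f k 0)"
  by (cases k) (simp_all add: approx_def root_solution_def case_prod_unfold Let_def)

lemma forward_state_in_states:
  assumes i: "1 \<le> i" and Q: "admissible Q" and x0: "x0 \<in> states P 0" and t: "t < horizon P"
    and scen: "\<And>s. s \<in> {1..t} \<Longrightarrow> scen s \<in> nodes P s"
  shows "forward_state (fo i) Q scen x0 t \<in> states P t"
  using t scen
proof (induction t)
  case (Suc t)
  let ?u = "fo i (Suc t) (scen (Suc t)) (forward_state (fo i) Q scen x0 t) (Q (Suc t))"
  have "is_arg_min (reg_objective P (scen (Suc t)) (forward_state (fo i) Q scen x0 t) (\<lambda>x. ereal (Q (Suc t) x)))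
      (\<lambda>u. u \<in> subproblem_feasible P (Suc t) (scen (Suc t))) ?u"
    using Suc i Q by (intro fo_optimal) (auto intro: admissibleD)
  then have "?u \<in> subproblem_feasible P (Suc t) (scen (Suc t))" by (simp add: is_arg_min_def)
  then have "(fst ?u, fst (snd ?u)) \<in> feas P (scen (Suc t))" by (auto simp: subproblem_feasible_def)
  then show ?case using feas_states[of "Suc t" "scen (Suc t)"] Suc.prems by simp
qed (use x0 in simp)

lemma root_arg_min:
  "admissible (approx f k) \<Longrightarrow> is_arg_min (root_objective P (\<lambda>x. ereal (approx f k 0 x)))
            (\<lambda>u. u \<in> feas P (rootnode P)) (root_solution f k)"
  unfolding root_solution_eq by (intro ro_optimal admissibleD) auto

lemma root_in_states: "admissible (approx f k) \<Longrightarrow> fst (root_solution f k) \<in> states P 0"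
  using root_arg_min[of f k] feas_states[OF _ root_node, of "fst (root_solution f k)" "snd (root_solution f k)"] horizon_pos
  by (auto simp: is_arg_min_def)

lemma trial_in_states':
  "admissible (approx f k) \<Longrightarrow> path_array (Suc k) f \<Longrightarrow> j \<in> {1..M} \<Longrightarrow> t < horizon P \<Longrightarrow> trial f k j t \<in> states P t"
  unfolding trial_def by (intro forward_state_in_states root_in_states) (auto simp: path_array_def)

text \<open>Both properties go together with feasibility of the trial states, which in turn needs
  admissible inputs for the forward oracle.\<close>

lemma approx_invariant:
  "path_array k f \<Longrightarrow> admissible (approx f k) \<and> underestimating (approx f k)"
proof (induction k)
  case 0
  then show ?case by (simp add: approx_0 initial_approx_admissible initial_approx_underestimating)
next
  case (Suc k)
  then have "path_array k f" by (auto simp: path_array_def)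
  then have IH: "admissible (approx f k)" "underestimating (approx f k)" using Suc.IH by auto
  have tr: "trial f k j t \<in> states P t" if "j \<in> {1..M}" "t < horizon P" for j t
    by (rule trial_in_states'[OF IH(1) Suc.prems that])
  show ?case unfolding approx_Suc
    using backward_approx_admissible[OF bo_optimal IH(1) tr]
      backward_approx_underestimating[OF bo_optimal IH(1) tr IH(2)] by auto
qed

lemma approx_admissible: "path_array k f \<Longrightarrow> admissible (approx f k)"
  and approx_underestimating: "path_array k f \<Longrightarrow> underestimating (approx f k)"
  using approx_invariant by auto

lemma path_array_mono: "i \<le> k \<Longrightarrow> path_array k f \<Longrightarrow> path_array i f"
  by (auto simp: path_array_def)

lemma trial_in_states:
  "path_array (Suc k) f \<Longrightarrow> j \<in> {1..M} \<Longrightarrow> t < horizon P \<Longrightarrow> trial f k j t \<in> states P t"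
  using trial_in_states' approx_admissible path_array_mono[of k "Suc k" f] by simp

lemma approx_mono:
  assumes "i \<le> k" "path_array k f" "t < horizon P" "x \<in> states P t"
  shows "approx f i t x \<le> approx f k t x"
  using assms
proof (induction k rule: dec_induct)
  case (step k)
  have "approx f k t x \<le> approx f (Suc k) t x"
    unfolding approx_Suc
    using backward_approx_ge[OF bo_optimal approx_admissible trial_in_states] step path_array_mono[of k "Suc k" f] by simp
  then show ?case using step path_array_mono[of k "Suc k" f] by simp
qed simp

lemma sddp_paths_cong:
  assumes "\<And>i j t. i \<in> {1..k} \<Longrightarrow> j \<in> {1..M} \<Longrightarrow> t \<in> {1..horizon P} \<Longrightarrow> f i j t = g i j t"
  shows "approx f k = approx g k" "root_solution f k = root_solution g k"
  using sddp_cong[of k M P f g, OF assms] by (simp_all add: approx_def root_solution_def)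

definition sampled_paths :: "(nat \<Rightarrow> nat \<Rightarrow> 'n) set" where
  "sampled_paths = (\<Pi>\<^sub>E j\<in>{1..M}. \<Pi>\<^sub>E t\<in>{1..horizon P}. nodes P t)"

lemma finite_sampled_paths: "finite sampled_paths"
  unfolding sampled_paths_def by (intro finite_PiE finite_nodes) auto

lemma path_arrayI:
  assumes "\<And>i. i \<in> {1..k} \<Longrightarrow> f i \<in> sampled_paths"
  shows "path_array k f"
  unfolding path_array_def
proof (intro ballI)
  fix i j t assume i: "i \<in> {1..k}" and j: "j \<in> {1..M}" and t: "t \<in> {1..horizon P}"
  have "f i j \<in> Pi\<^sub>E {1..horizon P} (nodes P)"
    using assms[OF i] j unfolding sampled_paths_def by (rule PiE_mem)
  then show "f i j t \<in> nodes P t" using t by (rule PiE_mem)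
qed

section \<open>Successful iterations: their frequency and their maximal number\<close>

context
  fixes \<delta> :: "nat \<Rightarrow> real" and \<epsilon> :: real
  assumes \<delta>_pos: "\<And>t. t < horizon P \<Longrightarrow> 0 < \<delta> t" and \<delta>_sum: "(\<Sum>t<horizon P. \<delta> t) = \<epsilon>"
begin

definition threshold :: "nat \<Rightarrow> real" where
  "threshold t = (\<Sum>s\<in>{t..<horizon P}. \<delta> s)"

lemma threshold_0: "threshold 0 = \<epsilon>"
  using \<delta>_sum by (simp add: threshold_def atLeast0LessThan)

lemma threshold_Suc: "t < horizon P \<Longrightarrow> threshold t = \<delta> t + threshold (Suc t)"
  by (simp add: threshold_def sum.atLeast_Suc_lessThan)

lemma threshold_horizon: "threshold (horizon P) = 0"
  by (simp add: threshold_def)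

text \<open>Iteration \<open>k\<close> starts from the root solution that iteration
  \<open>k - 1\<close> returned, so activity depends only on the samples before
  \<open>k\<close>.\<close>

definition active :: "nat \<Rightarrow> (nat \<Rightarrow> nat \<Rightarrow> nat \<Rightarrow> 'n) \<Rightarrow> bool" where
  "active k f \<longleftrightarrow> \<not> eps_optimal_root P \<epsilon> (root_solution f (k - 1))"

text \<open>The gap at one trial state drops by more than \<open>\<delta> t\<close>. Fixing the
  levels before and after, not just the drop, is what separates the successful states of a
  stage.\<close>

definition success :: "nat \<Rightarrow> (nat \<Rightarrow> nat \<Rightarrow> nat \<Rightarrow> 'n) \<Rightarrow> bool" where
  "success k f \<longleftrightarrow> (\<exists>j\<in>{1..M}. \<exists>t<horizon P.
     threshold t < qr t (trial f (k - 1) j t) - approx f (k - 1) t (trial f (k - 1) j t) \<and>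
     qr t (trial f (k - 1) j t) - approx f k t (trial f (k - 1) j t) \<le> threshold (Suc t))"

text \<open>Following a child with too large a gap as long as there is one ends in a state whose children all
  have small gaps.  The stages after the end of this path are filled up arbitrarily.\<close>

lemma critical_path:
  assumes i: "1 \<le> i" and Q: "admissible Q" and x0: "x0 \<in> states P 0"
    and t: "t < horizon P" and scen: "\<And>s. s \<in> {1..horizon P} \<Longrightarrow> scen s \<in> nodes P s"
    and gap: "threshold t < qr t (forward_state (fo i) Q scen x0 t) - Q t (forward_state (fo i) Q scen x0 t)"
  shows "\<exists>n. (\<forall>s\<in>{1..horizon P}. n s \<in> nodes P s) \<and> (\<exists>t'<horizon P.
    let x = forward_state (fo i) Q n x0 t' in threshold t' < qr t' x - Q t' x \<and>
      (Suc t' < horizon P \<longrightarrow> (\<forall>m\<in>nodes P (Suc t').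
         qr (Suc t') (fst (fo i (Suc t') m x (Q (Suc t')))) - Q (Suc t') (fst (fo i (Suc t') m x (Q (Suc t')))) \<le> threshold (Suc t'))))"
  using t scen gap
proof (induction "horizon P - t" arbitrary: t scen)
  case (Suc k)
  let ?x = "forward_state (fo i) Q scen x0 t"
  show ?case
  proof (cases "Suc t < horizon P \<longrightarrow> (\<forall>m\<in>nodes P (Suc t).
         qr (Suc t) (fst (fo i (Suc t) m ?x (Q (Suc t)))) - Q (Suc t) (fst (fo i (Suc t) m ?x (Q (Suc t)))) \<le> threshold (Suc t))")
    case True
    then show ?thesis using Suc.prems by (intro exI[of _ scen]) (auto simp: Let_def)
  next
    case False
    then obtain m where T: "Suc t < horizon P" and m: "m \<in> nodes P (Suc t)"
      and gap: "threshold (Suc t) < qr (Suc t) (fst (fo i (Suc t) m ?x (Q (Suc t)))) - Q (Suc t) (fst (fo i (Suc t) m ?x (Q (Suc t))))"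
      by auto
    let ?scen = "scen(Suc t := m)"
    have "forward_state (fo i) Q ?scen x0 t = ?x" by (rule forward_state_cong) auto
    then have fs: "forward_state (fo i) Q ?scen x0 (Suc t) = fst (fo i (Suc t) m ?x (Q (Suc t)))" by simp
    show ?thesis
    proof (rule Suc.hyps(1)[of "Suc t" ?scen])
      show "?scen s \<in> nodes P s" if "s \<in> {1..horizon P}" for s using that Suc.prems(2) m by auto
      show "threshold (Suc t) < qr (Suc t) (forward_state (fo i) Q ?scen x0 (Suc t)) - Q (Suc t) (forward_state (fo i) Q ?scen x0 (Suc t))"
        unfolding fs by (rule gap)
    qed (use Suc.hyps(2) T in auto)
  qed
qed simp

text \<open>The target path depends only on the history and the oracles, not on the samples of
  iteration \<open>k\<close>. Stage \<open>horizon P\<close> of the sample is irrelevant since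
  forward passes end one stage earlier.\<close>

lemma active_target:
  assumes k: "1 \<le> k" and f: "path_array (k - 1) f" and act: "active k f"
  obtains n where "\<And>s. s \<in> {1..horizon P} \<Longrightarrow> n s \<in> nodes P s"
    "\<And>w j. path_array k (f(k := w)) \<Longrightarrow> j \<in> {1..M} \<Longrightarrow> (\<And>s. s \<in> {1..<horizon P} \<Longrightarrow> w j s = n s) \<Longrightarrow> success k (f(k := w))"
proof -
  define i where "i = k - 1"
  have ki: "k = Suc i" using k by (simp add: i_def)
  let ?Q = "approx f i" and ?x0 = "fst (root_solution f i)"
  have Q: "admissible ?Q" "underestimating ?Q" using approx_invariant[OF f] by (auto simp: i_def)
  have x0: "?x0 \<in> states P 0" by (rule root_in_states[OF Q(1)])
  have gap: "threshold 0 < qr 0 ?x0 - ?Q 0 ?x0"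
    unfolding threshold_0
    by (rule root_gap[OF Q root_arg_min[OF Q(1)]]) (use act in \<open>simp add: active_def i_def\<close>)
  define a where "a = (\<lambda>s. SOME n. n \<in> nodes P s)"
  have a: "a s \<in> nodes P s" if "s \<in> {1..horizon P}" for s
    using that nodes_nonempty[of s] by (auto simp: a_def some_in_eq)
  from critical_path[of k ?Q ?x0 0 a, OF k Q(1) x0 _ a] gap horizon_pos
  obtain n t where n: "\<forall>s\<in>{1..horizon P}. n s \<in> nodes P s" and t: "t < horizon P"
    and crit: "threshold t < qr t (forward_state (fo k) ?Q n ?x0 t) - ?Q t (forward_state (fo k) ?Q n ?x0 t)"
      "Suc t < horizon P \<Longrightarrow> \<forall>m\<in>nodes P (Suc t).
         qr (Suc t) (fst (fo k (Suc t) m (forward_state (fo k) ?Q n ?x0 t) (?Q (Suc t)))) -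
         ?Q (Suc t) (fst (fo k (Suc t) m (forward_state (fo k) ?Q n ?x0 t) (?Q (Suc t)))) \<le> threshold (Suc t)"
    by (auto simp: Let_def)
  show ?thesis
  proof (rule that[of n])
    show "n s \<in> nodes P s" if "s \<in> {1..horizon P}" for s using n that by simp
    fix w j assume w: "path_array k (f(k := w))" and j: "j \<in> {1..M}" and wn: "\<And>s. s \<in> {1..<horizon P} \<Longrightarrow> w j s = n s"
    let ?f = "f(k := w)"
    have eq: "approx ?f i = ?Q" "root_solution ?f i = root_solution f i"
      by (rule sddp_paths_cong; simp add: ki)+
    have tr: "trial ?f i j t = forward_state (fo k) ?Q n ?x0 t"
      unfolding trial_def eq ki[symmetric] using t wn by (intro forward_state_cong) simp
    let ?x = "trial ?f i j t"
    have trs: "trial ?f i j t \<in> states P t" if "j \<in> {1..M}" "t < horizon P" for j t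
      by (rule trial_in_states[OF _ that]) (use w ki in simp)
    have "qr t ?x - approx ?f k t ?x \<le> threshold (Suc t)"
      unfolding approx_Suc[of ?f i, folded ki] eq
    proof (rule backward_approx_progress[OF bo_optimal Q(1) trs t j])
      show "threshold (Suc t) = 0 \<or> Suc t < horizon P"
        using t threshold_horizon by (cases "Suc t = horizon P") auto
      show "\<exists>u. is_arg_min (reg_objective P m ?x (\<lambda>x. ereal (?Q (Suc t) x))) (\<lambda>u. u \<in> subproblem_feasible P (Suc t) m) u \<and>
            qr (Suc t) (fst u) - ?Q (Suc t) (fst u) \<le> threshold (Suc t)"
        if T: "Suc t < horizon P" and m: "m \<in> nodes P (Suc t)" for m
      proof (intro exI conjI)
        show "is_arg_min (reg_objective P m ?x (\<lambda>x. ereal (?Q (Suc t) x))) (\<lambda>u. u \<in> subproblem_feasible P (Suc t) m)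
            (fo k (Suc t) m ?x (?Q (Suc t)))"
          using k T m trs[OF j t] admissibleD[OF Q(1)] by (intro fo_optimal) auto
        show "qr (Suc t) (fst (fo k (Suc t) m ?x (?Q (Suc t)))) - ?Q (Suc t) (fst (fo k (Suc t) m ?x (?Q (Suc t)))) \<le> threshold (Suc t)"
          using crit(2)[OF T] m unfolding tr by blast
      qed
    qed (use k in auto)
    then show "success k ?f"
      unfolding success_def i_def[symmetric] using j t crit(1) by (intro bexI[of _ j] exI[of _ t]) (simp_all add: eq tr)
  qed
qed

text \<open>In a failing sample each of the \<open>M\<close> paths misses the target prefix, and the
  paths range over a product set; this gives the power \<open>M\<close>.\<close>

lemma failure_fraction:
  assumes k: "1 \<le> k" and f: "\<And>i. i \<in> {1..<k} \<Longrightarrow> f i \<in> sampled_paths" and act: "active k f"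
  shows "real (card {w \<in> sampled_paths. \<not> success k (f(k := w))}) \<le>
    (1 - 1 / real (\<Prod>t=1..horizon P - 1. card (nodes P t))) ^ M * real (card sampled_paths)"
proof -
  let ?W = "\<Pi>\<^sub>E t\<in>{1..horizon P}. nodes P t" and ?N = "\<Prod>t=1..horizon P - 1. card (nodes P t)"
  have f': "path_array (k - 1) f" using f by (intro path_arrayI) auto
  obtain n where n: "\<And>s. s \<in> {1..horizon P} \<Longrightarrow> n s \<in> nodes P s"
    "\<And>w j. path_array k (f(k := w)) \<Longrightarrow> j \<in> {1..M} \<Longrightarrow> (\<And>s. s \<in> {1..<horizon P} \<Longrightarrow> w j s = n s) \<Longrightarrow> success k (f(k := w))"
    using active_target[OF k f' act] by metis
  \<comment> \<open>Paths with the target prefix. The last stage is free, so they form a fraction 1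
    over \<open>?N\<close> of all paths.\<close>
  let ?A = "\<Pi>\<^sub>E t\<in>{1..horizon P}. if t < horizon P then {n t} else nodes P t"
  have finW: "finite ?W" by (intro finite_PiE finite_nodes) auto
  have AW: "?A \<subseteq> ?W" using n(1) by (intro PiE_mono) auto
  have "{w \<in> sampled_paths. \<not> success k (f(k := w))} \<subseteq> (\<Pi>\<^sub>E j\<in>{1..M}. ?W - ?A)"
  proof
    fix w assume w: "w \<in> {w \<in> sampled_paths. \<not> success k (f(k := w))}"
    have pa: "path_array k (f(k := w))"
      using w f by (intro path_arrayI) auto
    have "w j \<notin> ?A" if j: "j \<in> {1..M}" for j
    proof
      assume "w j \<in> ?A"
      have "w j s = n s" if "s \<in> {1..<horizon P}" for s
        using PiE_mem[OF \<open>w j \<in> ?A\<close>, of s] that by simp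
      from n(2)[OF pa j this] w show False by simp
    qed
    moreover have "w j \<in> ?W" if "j \<in> {1..M}" for j
      using w that unfolding sampled_paths_def by (intro PiE_mem[of w "{1..M}"]) auto
    moreover have "w j = undefined" if "j \<notin> {1..M}" for j
      using w that unfolding sampled_paths_def by (intro PiE_arb[of w "{1..M}"]) auto
    ultimately show "w \<in> (\<Pi>\<^sub>E j\<in>{1..M}. ?W - ?A)" by (intro PiE_I) (simp_all only: Diff_iff, simp_all)
  qed
  then have "card {w \<in> sampled_paths. \<not> success k (f(k := w))} \<le> card (\<Pi>\<^sub>E j\<in>{1..M}. ?W - ?A)"
    using finW by (intro card_mono finite_PiE) auto
  also have "\<dots> = (card ?W - card ?A) ^ M"
    unfolding card_PiE[OF finite_atLeastAtMost] card_Diff_subset[OF finite_subset[OF AW finW] AW] by simp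
  finally have le: "card {w \<in> sampled_paths. \<not> success k (f(k := w))} \<le> (card ?W - card ?A) ^ M" .
  have T: "{1..horizon P} = insert (horizon P) {1..horizon P - 1}" using horizon_pos by auto
  have Tn: "horizon P \<notin> {1..horizon P - 1}" using horizon_pos by auto
  have cW: "card ?W = card (nodes P (horizon P)) * ?N"
    unfolding card_PiE[OF finite_atLeastAtMost] by (subst T, subst prod.insert) (use Tn in auto)
  have "(\<Prod>t=1..horizon P - 1. card (if t < horizon P then {n t} else nodes P t)) = 1"
    by (rule prod.neutral) (use horizon_pos in auto)
  then have cA: "card ?A = card (nodes P (horizon P))"
    unfolding card_PiE[OF finite_atLeastAtMost] by (subst T, subst prod.insert) (use Tn in auto)
  have N: "0 < ?N"
  proof (rule prod_pos)
    fix t assume "t \<in> {1..horizon P - 1}"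
    then have "t \<le> horizon P" unfolding atLeastAtMost_iff by arith
    then show "0 < card (nodes P t)" unfolding card_gt_0_iff using nodes_nonempty finite_nodes' by blast
  qed
  have "real (card ?W - card ?A) = real (card ?W) - real (card ?A)"
    by (rule of_nat_diff[OF card_mono[OF finW AW]])
  also have "\<dots> = (1 - 1 / real ?N) * real (card ?W)"
  proof -
    have "c * n - c = (1 - 1 / n) * (c * n)" if "n \<noteq> 0" for c n :: real using that by (simp add: field_simps)
    from this[of "real ?N" "real (card (nodes P (horizon P)))"] N show ?thesis
      unfolding cW cA of_nat_mult by linarith
  qed
  finally have "real ((card ?W - card ?A) ^ M) = (1 - 1 / real ?N) ^ M * real (card ?W) ^ M"
    by (simp only: of_nat_power power_mult_distrib)
  also have "real (card ?W) ^ M = real (card sampled_paths)"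
  proof -
    have "card sampled_paths = card ?W ^ M"
      unfolding sampled_paths_def card_PiE[OF finite_atLeastAtMost, of 1 M] by simp
    then show ?thesis by simp
  qed
  finally have *: "real ((card ?W - card ?A) ^ M) = (1 - 1 / real ?N) ^ M * real (card sampled_paths)" .
  show ?thesis unfolding *[symmetric] using le by (simp only: of_nat_le_iff)
qed

text \<open>Approximations increase, so the gap at \<open>x'\<close> after iteration
  \<open>i\<close> is still above \<open>threshold t\<close>, whereas that at \<open>x\<close> is at
  most \<open>threshold (Suc t)\<close>. Both \<open>qr t\<close> and the approximation are
  Lipschitz, which costs the constant twice.\<close>

lemma success_separated:
  assumes f: "path_array k f" and ik: "1 \<le> i" "i < k" and t: "t < horizon P"
    and x: "x \<in> states P t" "qr t x - approx f i t x \<le> threshold (Suc t)"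
    and x': "x' \<in> states P t" "threshold t < qr t x' - approx f (k - 1) t x'"
  shows "\<delta> t < 2 * lipschitz_bound P t * stage_norm P t (x - x')"
proof -
  have "approx f i t x' \<le> approx f (k - 1) t x'"
    using ik path_array_mono[of "k - 1" k f] f t x' by (intro approx_mono) auto
  then have "\<delta> t < (qr t x' - approx f i t x') - (qr t x - approx f i t x)"
    using x x' threshold_Suc[OF t] by linarith
  moreover have "\<bar>qr t x - qr t x'\<bar> \<le> lipschitz_bound P t * stage_norm P t (x - x')"
    by (rule qr_lipschitz[OF t x(1) x'(1)])
  moreover have "\<bar>approx f i t x - approx f i t x'\<bar> \<le> lipschitz_bound P t * stage_norm P t (x - x')"
    using admissibleD[OF approx_admissible[OF path_array_mono[of i k f]]] ik f t x x'
    by (intro approximations_lipschitz) auto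
  ultimately show ?thesis by linarith
qed

text \<open>Each success is charged to its stage and to a ball containing its trial state; within
  such a class the states are separated and the packing bound applies.\<close>

lemma card_success_le:
  fixes K :: "nat \<Rightarrow> nat" and D :: "nat \<Rightarrow> nat \<Rightarrow> real" and B :: "nat \<Rightarrow> nat \<Rightarrow> 'a set"
  assumes f: "path_array k f"
    and diameters: "\<And>t c. t < horizon P \<Longrightarrow> c \<in> {1..K t} \<Longrightarrow> 0 \<le> D t c"
    and balls: "\<And>t c. t < horizon P \<Longrightarrow> c \<in> {1..K t} \<Longrightarrow>
           ball_of_diameter (state_space P t) (stage_norm P t) (D t c) (B t c)"
    and cover: "\<And>t. t < horizon P \<Longrightarrow> states P t \<subseteq> (\<Union>c\<in>{1..K t}. B t c)"
  shows "real (card {i \<in> {2..k}. success i f}) \<le>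
    (\<Sum>t<horizon P. \<Sum>c=1..K t. (1 + 2 * lipschitz_bound P t * D t c / \<delta> t) ^ dim (state_space P t))"
proof -
  let ?J = "{i \<in> {2..k}. success i f}"
  let ?\<Phi> = "\<lambda>i j t. j \<in> {1..M} \<and> t < horizon P \<and>
     threshold t < qr t (trial f (i - 1) j t) - approx f (i - 1) t (trial f (i - 1) j t) \<and>
     qr t (trial f (i - 1) j t) - approx f i t (trial f (i - 1) j t) \<le> threshold (Suc t)"
  have "\<forall>i\<in>?J. \<exists>p. ?\<Phi> i (fst p) (snd p)"
    unfolding split_paired_Ex fst_conv snd_conv success_def by blast
  from bchoice[OF this] obtain p where p: "\<forall>i\<in>?J. ?\<Phi> i (fst (p i)) (snd (p i))" ..
  define j where "j = (\<lambda>i. fst (p i))"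
  define t where "t = (\<lambda>i. snd (p i))"
  define x where "x = (\<lambda>i. trial f (i - 1) (j i) (t i))"
  have jt: "j i \<in> {1..M}" "t i < horizon P"
    "threshold (t i) < qr (t i) (x i) - approx f (i - 1) (t i) (x i)"
    "qr (t i) (x i) - approx f i (t i) (x i) \<le> threshold (Suc (t i))" if "i \<in> ?J" for i
    using bspec[OF p that] unfolding j_def t_def x_def by blast+
  have pa: "path_array i f" "1 \<le> i" if "i \<in> ?J" for i
    using that path_array_mono[OF _ f, of i] by simp_all
  have xs: "x i \<in> states P (t i)" if "i \<in> ?J" for i
    unfolding x_def by (rule trial_in_states[OF _ jt(1,2)[OF that]]) (use pa[OF that] in simp)
  \<comment> \<open>The separation radius; \<open>D / r\<close> becomes
    \<open>2 * L * D / \<delta>\<close> in the packing bound.\<close>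
  define r where "r = (\<lambda>s. \<delta> s / (2 * lipschitz_bound P s))"
  have r: "0 < r s" if "s < horizon P" for s using \<delta>_pos lipschitz_bound_pos that by (simp add: r_def)
  have sep_less: "r (t i) \<le> stage_norm P (t i) (x i - x i')" if "i \<in> ?J" "i' \<in> ?J" "t i = t i'" "i < i'" for i i'
  proof -
    have "\<delta> (t i) < 2 * lipschitz_bound P (t i) * stage_norm P (t i) (x i - x i')"
      using jt(3)[OF that(2)] xs[OF that(2)] unfolding that(3)[symmetric]
      by (intro success_separated[OF pa(1)[OF that(2)] pa(2)[OF that(1)] that(4) jt(2)[OF that(1)] xs[OF that(1)] jt(4)[OF that(1)]])
    then show ?thesis using lipschitz_bound_pos[OF jt(2)[OF that(1)]] by (simp add: r_def field_simps)
  qed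
  have sep: "r (t i) \<le> stage_norm P (t i) (x i - x i')" if "i \<in> ?J" "i' \<in> ?J" "t i = t i'" "i \<noteq> i'" for i i'
  proof (cases "i < i'")
    case False
    note ti = jt(2)[OF that(1)]
    have "x i \<in> state_space P (t i)" "x i' \<in> state_space P (t i)"
      using xs[OF that(1)] xs[OF that(2)] that(3) states[OF ti] by auto
    then show ?thesis
      using sep_less[OF that(2,1)] that False
        norm_on_minus_commute[OF state_space[OF ti] stage_norm[OF ti], of "x i" "x i'"] by simp
  qed (use sep_less that in blast)
  define J where "J = (\<lambda>s c. {i \<in> ?J. t i = s \<and> x i \<in> B s c})"
  have cardJ: "real (card (J s c)) \<le> (1 + 2 * lipschitz_bound P s * D s c / \<delta> s) ^ dim (state_space P s)"
    if s: "s < horizon P" and c: "c \<in> {1..K s}" for s c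
  proof -
    note V = state_space[OF s] stage_norm[OF s]
    \<comment> \<open>Separation by a positive distance makes the states of different iterations
      distinct, so counting states counts iterations.\<close>
    have "inj_on x (J s c)"
    proof (rule inj_onI, rule ccontr)
      fix i i' assume *: "i \<in> J s c" "i' \<in> J s c" "x i = x i'" "i \<noteq> i'"
      then have "i \<in> ?J" "i' \<in> ?J" and ti: "t i = s" "t i' = s" by (simp_all only: J_def mem_Collect_eq)
      from sep[OF this(1,2) _ *(4)] have "r s \<le> stage_norm P s (x i - x i')" by (simp only: ti)
      also have "\<dots> = 0" unfolding *(3) by (simp add: norm_on_zero[OF V])
      finally show False using r[OF s] by simp
    qed
    then have "card (J s c) = card (x ` J s c)" by (simp add: card_image)
    moreover obtain z where z: "z \<in> state_space P s" and Bz: "B s c = {x \<in> state_space P s. stage_norm P s (x - z) \<le> D s c / 2} \<or>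
        B s c = {x \<in> state_space P s. stage_norm P s (x - z) < D s c / 2}"
      using balls[OF s c] unfolding ball_of_diameter_def by blast
    have "real (card (x ` J s c)) \<le> (1 + D s c / r s) ^ dim (state_space P s)"
    proof (rule packing_bound[OF V _ z])
      show "x ` J s c \<subseteq> {y \<in> state_space P s. stage_norm P s (y - z) \<le> D s c / 2}"
        using Bz by (auto simp: J_def)
      show "r s \<le> stage_norm P s (a - b)" if ab: "a \<in> x ` J s c" "b \<in> x ` J s c" "a \<noteq> b" for a b
      proof -
        obtain i i' where i: "i \<in> ?J" "t i = s" "a = x i" and i': "i' \<in> ?J" "t i' = s" "b = x i'"
          using ab by (auto simp: J_def)
        then have "i \<noteq> i'" using ab by auto
        from sep[OF i(1) i'(1) _ this] show ?thesis using i i' by simp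
      qed
    qed (use r[OF s] diameters[OF s c] in \<open>auto simp: J_def\<close>)
    moreover have "D s c / r s = 2 * lipschitz_bound P s * D s c / \<delta> s" by (simp add: r_def)
    ultimately show ?thesis by simp
  qed
  have "?J \<subseteq> (\<Union>s\<in>{..<horizon P}. \<Union>c\<in>{1..K s}. J s c)"
  proof
    fix i assume i: "i \<in> ?J"
    note jt(2)[OF i] xs[OF i]
    then show "i \<in> (\<Union>s\<in>{..<horizon P}. \<Union>c\<in>{1..K s}. J s c)" using i cover[of "t i"] by (auto simp: J_def)
  qed
  moreover have "finite (\<Union>s\<in>{..<horizon P}. \<Union>c\<in>{1..K s}. J s c)"
  proof -
    have "finite (J s c)" for s c by (rule finite_subset[of _ "{2..k}"]) (auto simp: J_def)
    then show ?thesis by (intro finite_UN_I) simp_all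
  qed
  ultimately have "card ?J \<le> card (\<Union>s\<in>{..<horizon P}. \<Union>c\<in>{1..K s}. J s c)" by (rule card_mono[rotated])
  also have "\<dots> \<le> (\<Sum>s<horizon P. card (\<Union>c\<in>{1..K s}. J s c))" by (intro card_UN_le) auto
  also have "\<dots> \<le> (\<Sum>s<horizon P. \<Sum>c=1..K s. card (J s c))" by (intro sum_mono card_UN_le) auto
  finally have "real (card ?J) \<le> (\<Sum>s<horizon P. \<Sum>c=1..K s. real (card (J s c)))"
    unfolding of_nat_sum[symmetric] of_nat_le_iff .
  also have "\<dots> \<le> (\<Sum>t<horizon P. \<Sum>c=1..K t. (1 + 2 * lipschitz_bound P t * D t c / \<delta> t) ^ dim (state_space P t))"
    by (intro sum_mono cardJ) auto
  finally show ?thesis .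
qed

lemma active_cong:
  assumes "\<And>i. i \<in> {1..<k} \<Longrightarrow> f i = g i"
  shows "active k f = active k g"
proof -
  have "f i = g i" if "i \<in> {1..k - 1}" for i by (rule assms) (use that in auto)
  then have "root_solution f (k - 1) = root_solution g (k - 1)" by (intro sddp_paths_cong) simp
  then show ?thesis by (simp add: active_def)
qed

lemma success_cong:
  assumes k: "1 \<le> k" and fg: "\<And>i. i \<in> {1..k} \<Longrightarrow> f i = g i"
  shows "success k f = success k g"
proof -
  have eq: "approx f (k - 1) = approx g (k - 1)" "root_solution f (k - 1) = root_solution g (k - 1)"
    "approx f k = approx g k"
  proof -
    have "f i = g i" if "i \<in> {1..k - 1}" for i by (rule fg) (use that in auto)
    then show "approx f (k - 1) = approx g (k - 1)" "root_solution f (k - 1) = root_solution g (k - 1)"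
      by (intro sddp_paths_cong; simp)+
    show "approx f k = approx g k" using fg by (intro sddp_paths_cong) simp
  qed
  moreover have "trial f (k - 1) = trial g (k - 1)"
    unfolding trial_def[abs_def] eq using fg[of k] k by simp
  ultimately show ?thesis unfolding success_def by simp
qed

lemma card_active_le:
  fixes K :: "nat \<Rightarrow> nat" and D :: "nat \<Rightarrow> nat \<Rightarrow> real" and B :: "nat \<Rightarrow> nat \<Rightarrow> 'a set"
  assumes diameters: "\<And>t c. t < horizon P \<Longrightarrow> c \<in> {1..K t} \<Longrightarrow> 0 \<le> D t c"
    and balls: "\<And>t c. t < horizon P \<Longrightarrow> c \<in> {1..K t} \<Longrightarrow>
           ball_of_diameter (state_space P t) (stage_norm P t) (D t c) (B t c)"
    and cover: "\<And>t. t < horizon P \<Longrightarrow> states P t \<subseteq> (\<Union>c\<in>{1..K t}. B t c)"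
    and I: "I = (\<Sum>t<horizon P. \<Sum>c=1..K t. (1 + 2 * lipschitz_bound P t * D t c / \<delta> t) ^ dim (state_space P t))" "0 \<le> I"
    and \<nu>: "\<nu> = 1 - (1 - 1 / real (\<Prod>t=1..horizon P - 1. card (nodes P t))) ^ M" "0 < \<nu>" "\<nu> \<le> 1"
    and \<kappa>: "1 < \<kappa>" and m: "\<kappa> * I / \<nu> \<le> real m"
  shows "real (card {f \<in> Pi\<^sub>E {1..Suc m} (\<lambda>_. sampled_paths).
        \<forall>k\<in>{2..Suc m}. \<not> eps_optimal_root P \<epsilon> (root_solution f (k - 1))})
      \<le> real (card sampled_paths) ^ Suc m * exp (- (I * \<nu> * (\<kappa> - 1)\<^sup>2) / (16 * \<kappa>))"
  unfolding active_def[symmetric]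
proof (rule few_successes_bound[OF finite_sampled_paths active_cong success_cong _ _ \<nu>(2,3) \<kappa> I(2) m])
  show "real (card {w \<in> sampled_paths. \<not> success k (f(k := w))})
      \<le> (1 - 1 / real (\<Prod>t=1..horizon P - 1. card (nodes P t))) ^ M * real (card sampled_paths)"
    if "2 \<le> k" "\<And>i. i \<in> {1..<k} \<Longrightarrow> f i \<in> sampled_paths" "active k f" for k f
    using that(1) by (intro failure_fraction that(2,3)) auto
  show "(1 - 1 / real (\<Prod>t=1..horizon P - 1. card (nodes P t))) ^ M = 1 - \<nu>" by (simp add: \<nu>(1))
  show "real (card {k \<in> {2..Suc m}. success k f}) \<le> I" if f: "f \<in> Pi\<^sub>E {1..Suc m} (\<lambda>_. sampled_paths)" for f
  proof -
    have "path_array (Suc m) f" using f by (intro path_arrayI) (rule PiE_mem)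
    then show ?thesis unfolding I(1) by (rule card_success_le[OF _ diameters balls cover])
  qed
qed assumption+

end

end

section \<open>Measurability\<close>

lemma measurable_oracleD:
  assumes "measurable_oracle A X D \<Q> orc" "x \<in> borel_measurable A"
    "\<And>\<omega>. \<omega> \<in> space A \<Longrightarrow> x \<omega> \<in> X" "\<And>\<omega>. \<omega> \<in> space A \<Longrightarrow> Q \<omega> \<in> \<Q>"
    "\<And>d. d \<in> D \<Longrightarrow> (\<lambda>\<omega>. Q \<omega> d) \<in> borel_measurable A"
  shows "(\<lambda>\<omega>. orc \<omega> (x \<omega>) (Q \<omega>)) \<in> borel_measurable A"
  using assms unfolding measurable_oracle_def by blast

lemma borel_measurable_fst:
  fixes f :: "'w \<Rightarrow> 'a::topological_space \<times> 'b::topological_space"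
  shows "f \<in> borel_measurable A \<Longrightarrow> (\<lambda>\<omega>. fst (f \<omega>)) \<in> borel_measurable A"
  by (erule measurable_compose) (intro borel_measurable_continuous_onI continuous_intros)

lemma borel_measurable_snd:
  fixes f :: "'w \<Rightarrow> 'a::topological_space \<times> 'b::topological_space"
  shows "f \<in> borel_measurable A \<Longrightarrow> (\<lambda>\<omega>. snd (f \<omega>)) \<in> borel_measurable A"
  by (erule measurable_compose) (intro borel_measurable_continuous_onI continuous_intros)

lemma borel_measurable_continuous_on_compose:
  assumes "continuous_on S f" "g \<in> borel_measurable A" "\<And>\<omega>. \<omega> \<in> space A \<Longrightarrow> g \<omega> \<in> S"
  shows "(\<lambda>\<omega>. f (g \<omega>)) \<in> borel_measurable A"
  by (rule measurable_compose[OF measurable_restrict_space2 borel_measurable_continuous_on_restrict[OF assms(1)]])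
    (use assms(2,3) in simp_all)

lemma borel_measurable_Max_insert:
  fixes a :: "'w \<Rightarrow> real"
  assumes "finite I" "a \<in> borel_measurable A" "\<And>i. i \<in> I \<Longrightarrow> f i \<in> borel_measurable A"
  shows "(\<lambda>\<omega>. Max (insert (a \<omega>) ((\<lambda>i. f i \<omega>) ` I))) \<in> borel_measurable A"
proof (cases "I = {}")
  case False
  then have "(\<lambda>\<omega>. Max (insert (a \<omega>) ((\<lambda>i. f i \<omega>) ` I))) = (\<lambda>\<omega>. max (a \<omega>) (Max ((\<lambda>i. f i \<omega>) ` I)))"
    using assms(1) by simp
  then show ?thesis using assms by (simp add: borel_measurable_max borel_measurable_Max)
qed (use assms in simp)

context regularized_problem
begin

lemma borel_measurable_pen:
  assumes t: "t \<le> horizon P" and m: "m \<in> nodes P t" and z: "z \<in> prev_states P t"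
    and x: "x \<in> borel_measurable A" "\<And>\<omega>. \<omega> \<in> space A \<Longrightarrow> x \<omega> \<in> prev_states P t"
  shows "(\<lambda>\<omega>. pen P m (x \<omega> - z)) \<in> borel_measurable A"
proof (rule borel_measurable_continuous_on_compose[OF continuous_on_pen[OF t m]])
  show "(\<lambda>\<omega>. x \<omega> - z) \<in> borel_measurable A" by (intro borel_measurable_diff borel_measurable_const x(1))
  show "x \<omega> - z \<in> {a - b | a b. a \<in> prev_states P t \<and> b \<in> prev_states P t}" if "\<omega> \<in> space A" for \<omega>
    using x(2)[OF that] z by blast
qed

text \<open>The constant must not depend on multipliers, state or approximation: these are random
  later, while the regularized cost built from \<open>R\<close> has to be deterministic.\<close>

lemma inner_problem_lipschitz:
  assumes t: "t \<in> {1..horizon P}" and m: "m \<in> nodes P t"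
  obtains R where "0 < R" "\<And>l r xp Q x y z x' y' z'. (l, r) \<in> multipliers P t m \<Longrightarrow> xp \<in> prev_states P t \<Longrightarrow>
     Q \<in> approximations P t \<Longrightarrow> (x, y, z) \<in> subproblem_feasible P t m \<Longrightarrow> (x', y', z') \<in> subproblem_feasible P t m \<Longrightarrow>
     \<bar>(l \<bullet> (xp - z) + r * pen P m (xp - z) + Q x) - (l \<bullet> (xp - z') + r * pen P m (xp - z') + Q x')\<bar>
       \<le> R * dist (x, y, z) (x', y', z')"
proof -
  have t': "t \<le> horizon P" using t by simp
  obtain C where C: "0 < C" "\<And>x. x \<in> prev_space P t \<Longrightarrow> prev_norm P t x \<le> C * norm x"
    using norm_on_upper[OF prev_space[OF t'] prev_norm[OF t']] by blast
  have "\<exists>E\<ge>0. \<forall>Q\<in>approximations P t. \<forall>x\<in>fst ` feas P m. \<forall>x'\<in>fst ` feas P m. \<bar>Q x - Q x'\<bar> \<le> E * norm (x - x')"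
  proof (cases "t = horizon P")
    case True
    then show ?thesis by (intro exI[of _ 0]) (auto simp: approximations_horizon)
  next
    case False
    then have T: "t < horizon P" using t' by simp
    obtain C' where C': "0 < C'" "\<And>x. x \<in> state_space P t \<Longrightarrow> stage_norm P t x \<le> C' * norm x"
      using norm_on_upper[OF state_space[OF T] stage_norm[OF T]] by blast
    have "\<bar>Q x - Q x'\<bar> \<le> lipschitz_bound P t * C' * norm (x - x')"
      if "Q \<in> approximations P t" "x \<in> states P t" "x' \<in> states P t" for Q x x'
    proof -
      have "\<bar>Q x - Q x'\<bar> \<le> lipschitz_bound P t * stage_norm P t (x - x')"
        by (rule approximations_lipschitz[OF T that])
      also have "\<dots> \<le> lipschitz_bound P t * (C' * norm (x - x'))"
        using lipschitz_bound_pos[OF T] C'(2) states_diff[OF T that(2,3)] by (intro mult_left_mono) auto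
      finally show ?thesis by (simp add: mult.assoc)
    qed
    then show ?thesis
      unfolding feas_proj[OF T m] using lipschitz_bound_pos[OF T] C'(1)
      by (intro exI[of _ "lipschitz_bound P t * C'"]) auto
  qed
  then obtain E where E0: "0 \<le> E" and E1: "\<forall>Q\<in>approximations P t. \<forall>x\<in>fst ` feas P m. \<forall>x'\<in>fst ` feas P m.
      \<bar>Q x - Q x'\<bar> \<le> E * norm (x - x')" by blast
  let ?b = "bound_lambda P m + bound_rho P m"
  have b: "0 \<le> ?b" using bounds_nonneg[OF t m] by simp
  show ?thesis
  proof (rule that[of "?b * C + E + 1"])
    have "0 \<le> ?b * C" using b C(1) by (intro mult_nonneg_nonneg) simp_all
    then show "0 < ?b * C + E + 1" using E0 by linarith
    fix l r xp Q x y z x' y' z'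
    assume u: "(l, r) \<in> multipliers P t m" and xp: "xp \<in> prev_states P t" and Q: "Q \<in> approximations P t"
      and f: "(x, y, z) \<in> subproblem_feasible P t m" "(x', y', z') \<in> subproblem_feasible P t m"
    have z: "z \<in> prev_states P t" "z' \<in> prev_states P t" and xy: "(x, y) \<in> feas P m" "(x', y') \<in> feas P m"
      using f by (auto simp: subproblem_feasible_def)
    have x: "x \<in> fst ` feas P m" "x' \<in> fst ` feas P m"
      by (rule rev_image_eqI[OF xy(1)], simp) (rule rev_image_eqI[OF xy(2)], simp)
    have d: "dist x x' \<le> dist (x, y, z) (x', y', z')" "dist z z' \<le> dist (x, y, z) (x', y', z')"
      using dist_fst_le[of "(x, y, z)" "(x', y', z')"] dist_snd_le[of "(x, y, z)" "(x', y', z')"]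
        dist_snd_le[of "(y, z)" "(y', z')"] by auto
    have 1: "\<bar>(l \<bullet> (xp - z) + r * pen P m (xp - z)) - (l \<bullet> (xp - z') + r * pen P m (xp - z'))\<bar> \<le> ?b * C * dist (x, y, z) (x', y', z')"
    proof -
      have "\<bar>(l \<bullet> (xp - z) + r * pen P m (xp - z)) - (l \<bullet> (xp - z') + r * pen P m (xp - z'))\<bar> \<le> ?b * prev_norm P t (z - z')"
        by (rule multiplier_term_lipschitz[OF t m u xp z])
      also have "\<dots> \<le> ?b * (C * dist z z')"
        using C(2)[OF prev_states_diff[OF t' z]] b by (intro mult_left_mono) (auto simp: dist_norm)
      also have "\<dots> \<le> ?b * (C * dist (x, y, z) (x', y', z'))"
        using d(2) b C(1) by (intro mult_left_mono) auto
      finally show ?thesis by (simp only: mult.assoc)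
    qed
    have 2: "\<bar>Q x - Q x'\<bar> \<le> E * dist (x, y, z) (x', y', z')"
      using bspec[OF bspec[OF bspec[OF E1 Q] x(1)] x(2)] mult_left_mono[OF d(1) E0] unfolding dist_norm by linarith
    have "\<bar>(l \<bullet> (xp - z) + r * pen P m (xp - z) + Q x) - (l \<bullet> (xp - z') + r * pen P m (xp - z') + Q x')\<bar>
       \<le> ?b * C * dist (x, y, z) (x', y', z') + E * dist (x, y, z) (x', y', z')"
      using 1 2 by linarith
    also have "\<dots> \<le> (?b * C + E + 1) * dist (x, y, z) (x', y', z')"
      by (simp add: distrib_right)
    finally show "\<bar>(l \<bullet> (xp - z) + r * pen P m (xp - z) + Q x) - (l \<bullet> (xp - z') + r * pen P m (xp - z') + Q x')\<bar>
       \<le> (?b * C + E + 1) * dist (x, y, z) (x', y', z')" .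
  qed
qed

text \<open>The oracle's maximizer is measurable and removes the supremum over multipliers;
  Lipschitz regularization replaces the infimum by one over a countable dense set.\<close>

lemma borel_measurable_dual_value:
  fixes A :: "'w measure"
  assumes t: "t \<in> {1..horizon P}" and m: "m \<in> nodes P t"
    and x: "x \<in> borel_measurable A" "\<And>\<omega>. \<omega> \<in> space A \<Longrightarrow> x \<omega> \<in> prev_states P t"
    and Q: "\<And>\<omega>. \<omega> \<in> space A \<Longrightarrow> Q \<omega> \<in> approximations P t"
      "\<And>d. d \<in> fst ` feas P m \<Longrightarrow> (\<lambda>\<omega>. Q \<omega> d) \<in> borel_measurable A"
    and u: "u \<in> borel_measurable A"
      "\<And>\<omega>. \<omega> \<in> space A \<Longrightarrow> is_arg_max (inner_value P t m (x \<omega>) (Q \<omega>)) (\<lambda>u. u \<in> multipliers P t m) (u \<omega>)"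
  shows "(\<lambda>\<omega>. dual_value P t m (x \<omega>) (Q \<omega>)) \<in> borel_measurable A"
proof -
  have t': "t \<le> horizon P" using t by simp
  obtain R where R: "0 < R" "\<And>l r xp Q x y z x' y' z'. (l, r) \<in> multipliers P t m \<Longrightarrow> xp \<in> prev_states P t \<Longrightarrow>
     Q \<in> approximations P t \<Longrightarrow> (x, y, z) \<in> subproblem_feasible P t m \<Longrightarrow> (x', y', z') \<in> subproblem_feasible P t m \<Longrightarrow>
     \<bar>(l \<bullet> (xp - z) + r * pen P m (xp - z) + Q x) - (l \<bullet> (xp - z') + r * pen P m (xp - z') + Q x')\<bar>
       \<le> R * dist (x, y, z) (x', y', z')"
    by (rule inner_problem_lipschitz[OF t m]) blast
  let ?S = "subproblem_feasible P t m"
  obtain D where D: "countable D" "D \<subseteq> ?S" "?S \<subseteq> closure D" by (rule separable)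
  define c where "c = (\<lambda>(x, y, z). cost P m z y x)"
  define g where "g = (\<lambda>\<omega> (v, y :: 'b, z). fst (u \<omega>) \<bullet> (x \<omega> - z) + snd (u \<omega>) * pen P m (x \<omega> - z) + Q \<omega> v)"
  have "dual_value P t m (x \<omega>) (Q \<omega>) =
      real_of_ereal (INF v\<in>D. (INF w\<in>?S. c w + ereal (R * dist w v)) + ereal (g \<omega> v))"
    if \<omega>: "\<omega> \<in> space A" for \<omega>
  proof -
    have um: "(fst (u \<omega>), snd (u \<omega>)) \<in> multipliers P t m" using u(2)[OF \<omega>] by (simp add: is_arg_max_def)
    have lip: "\<bar>g \<omega> v - g \<omega> w\<bar> \<le> R * dist v w" if "v \<in> ?S" "w \<in> ?S" for v w
      using R(2)[OF um x(2)[OF \<omega>] Q(1)[OF \<omega>]] that by (cases v, cases w) (simp add: g_def)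
    have "ereal (dual_value P t m (x \<omega>) (Q \<omega>)) = inner_value P t m (x \<omega>) (Q \<omega>) (u \<omega>)"
      by (rule dual_value_eq(1)[OF t m x(2)[OF \<omega>] Q(1)[OF \<omega>] u(2)[OF \<omega>], symmetric])
    also have "\<dots> = (INF v\<in>?S. c v + ereal (g \<omega> v))"
      by (simp add: inner_value_def c_def g_def case_prod_unfold)
    also have "\<dots> = (INF v\<in>D. (INF w\<in>?S. c w + ereal (R * dist w v)) + ereal (g \<omega> v))"
      by (rule INF_lipschitz_regularization[OF D(2,3) R(1) lip])
    finally have "real_of_ereal (ereal (dual_value P t m (x \<omega>) (Q \<omega>))) =
        real_of_ereal (INF v\<in>D. (INF w\<in>?S. c w + ereal (R * dist w v)) + ereal (g \<omega> v))"
      by (rule arg_cong)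
    then show ?thesis by simp
  qed
  moreover have "(\<lambda>\<omega>. real_of_ereal (INF v\<in>D. (INF w\<in>?S. c w + ereal (R * dist w v)) + ereal (g \<omega> v))) \<in> borel_measurable A"
  proof (rule borel_measurable_real_of_ereal, rule borel_measurable_INF[OF D(1)],
      rule borel_measurable_ereal_add[OF borel_measurable_const], rule borel_measurable_ereal)
    fix v assume "v \<in> D"
    then obtain a b z where v: "v = (a, b, z)" and f: "(a, b) \<in> feas P m" "z \<in> prev_states P t"
      using D(2) by (cases v) (auto simp: subproblem_feasible_def)
    have a: "a \<in> fst ` feas P m" using f by (metis fst_conv image_eqI)
    show "(\<lambda>\<omega>. g \<omega> v) \<in> borel_measurable A"
      unfolding g_def v prod.case
      by (intro borel_measurable_add borel_measurable_times borel_measurable_inner borel_measurable_diff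
          borel_measurable_const borel_measurable_fst borel_measurable_snd u x(1) Q(2) a
          borel_measurable_pen[OF t' m f(2) x])
  qed
  ultimately show ?thesis by (subst measurable_cong) auto
qed

lemma borel_measurable_cut:
  fixes A :: "'w measure"
  assumes t: "t \<le> horizon P" and m: "m \<in> nodes P t" and d: "d \<in> prev_states P t"
    and x: "x \<in> borel_measurable A" "\<And>\<omega>. \<omega> \<in> space A \<Longrightarrow> x \<omega> \<in> prev_states P t"
    and u: "u \<in> borel_measurable A" and v: "v \<in> borel_measurable A"
  shows "(\<lambda>\<omega>. cut P m (x \<omega>) (u \<omega>) (v \<omega>) d) \<in> borel_measurable A"
  unfolding cut_def case_prod_unfold
  by (intro borel_measurable_add borel_measurable_times borel_measurable_inner borel_measurable_diff borel_measurable_uminus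
      borel_measurable_const borel_measurable_fst borel_measurable_snd u x(1) v borel_measurable_pen[OF t m d x])

text \<open>Semicontinuity is given for triples \<open>(z, x, y)\<close>, so the sublevel set is
  compact there and is then projected. Closedness makes \<epsilon>-optimality of a measurable root
  solution an event.\<close>

lemma closed_sublevel_root_objective: "closed {u \<in> feas P (rootnode P). root_objective P (QR P 0) u \<le> c}"
proof -
  let ?r = "rootnode P"
  let ?S = "prev_states P 0 \<times> feas P ?r"
  have lsc: "lsc_on ?S (\<lambda>s. (\<lambda>(z, x, y). cost P ?r z y x) s + ereal (qr 0 (fst (snd s))))"
  proof (intro lsc_on_add_continuous cost_lsc[OF _ root_node] continuous_on_compose2[OF continuous_on_qr[OF _ root_node]])
    show "continuous_on ?S (\<lambda>s. fst (snd s))" by (intro continuous_intros)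
  qed (auto intro: imageI)
  have "compact ?S" using compact_prev_states[of 0] feas_compact[OF _ root_node] by (intro compact_Times) auto
  then have "compact (?S \<inter> {s \<in> ?S. (\<lambda>(z, x, y). cost P ?r z y x) s + ereal (qr 0 (fst (snd s))) \<le> c})"
    using lsc compact_imp_closed by (intro compact_Int_closed lsc_on_closed_sublevel) auto
  then have "compact (snd ` (?S \<inter> {s \<in> ?S. (\<lambda>(z, x, y). cost P ?r z y x) s + ereal (qr 0 (fst (snd s))) \<le> c}))"
    by (intro compact_continuous_image continuous_intros)
  also have "snd ` (?S \<inter> {s \<in> ?S. (\<lambda>(z, x, y). cost P ?r z y x) s + ereal (qr 0 (fst (snd s))) \<le> c}) =
      {u \<in> feas P ?r. root_objective P (QR P 0) u \<le> c}"
  proof -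
    have q: "QR P 0 x = ereal (qr 0 x)" if "(x, y) \<in> feas P ?r" for x y
    proof (rule QR_eq_qr[OF _ root_node])
      show "x \<in> fst ` feas P ?r" using that by (metis fst_conv image_eqI)
    qed simp
    show ?thesis by (auto simp: root_objective_def q intro!: image_eqI[of _ snd "(0, _)"])
  qed
  finally show ?thesis by (rule compact_imp_closed)
qed

end

locale sampled_sddp = regularized_problem P + uniform_sampling \<mu> \<Sigma> P fo bo ro M scen
  for P :: "('n, 'a::euclidean_space, 'b::euclidean_space) mssp"
    and \<mu> :: "'w measure" and \<Sigma> :: "nat \<Rightarrow> 'w measure" and fo bo ro M scen
begin

lemma deterministic_sddp: "\<omega> \<in> space \<mu> \<Longrightarrow> deterministic_sddp P (\<lambda>i. fo i \<omega>) (\<lambda>i. bo i \<omega>) (\<lambda>i. ro i \<omega>)"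
  by unfold_locales (auto intro: fo_optimal bo_optimal ro_optimal)

lemma measurable_\<Sigma>_mono: "i \<le> j \<Longrightarrow> f \<in> borel_measurable (\<Sigma> i) \<Longrightarrow> f \<in> borel_measurable (\<Sigma> j)"
  by (rule measurable_from_subalg[of "\<Sigma> j" "\<Sigma> i"]) (auto simp: subalgebra_def space_F sets_F_mono)

section \<open>The algorithm along a fixed path array with random oracles\<close>

context
  fixes f :: "nat \<Rightarrow> nat \<Rightarrow> nat \<Rightarrow> 'n"
begin

definition rapprox :: "nat \<Rightarrow> 'w \<Rightarrow> nat \<Rightarrow> 'a \<Rightarrow> real" where
  "rapprox k \<omega> = fst (sddp P M (\<lambda>i. fo i \<omega>) (\<lambda>i. bo i \<omega>) (\<lambda>i. ro i \<omega>) f k)"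

definition rroot :: "nat \<Rightarrow> 'w \<Rightarrow> 'a \<times> 'b" where
  "rroot k \<omega> = snd (sddp P M (\<lambda>i. fo i \<omega>) (\<lambda>i. bo i \<omega>) (\<lambda>i. ro i \<omega>) f k)"

definition rtrial :: "nat \<Rightarrow> 'w \<Rightarrow> nat \<Rightarrow> nat \<Rightarrow> 'a" where
  "rtrial k \<omega> j = forward_state (fo (Suc k) \<omega>) (rapprox k \<omega>) (f (Suc k) j) (fst (rroot k \<omega>))"

abbreviation path_array' :: "nat \<Rightarrow> bool" where
  "path_array' k \<equiv> (\<forall>i\<in>{1..k}. \<forall>j\<in>{1..M}. \<forall>t\<in>{1..horizon P}. f i j t \<in> nodes P t)"

lemma rapprox_Suc: "rapprox (Suc k) \<omega> = backward_approx P M (bo (Suc k) \<omega>) (rapprox k \<omega>) (rtrial k \<omega>)"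
  by (simp add: rapprox_def rtrial_def[abs_def] rroot_def case_prod_unfold Let_def)

lemma rroot_eq: "rroot k \<omega> = ro k \<omega> (rapprox k \<omega> 0)"
  by (cases k) (simp_all add: rapprox_def rroot_def case_prod_unfold Let_def)

lemma rapprox_approximations:
  assumes "\<omega> \<in> space \<mu>" "path_array' k" "t \<le> horizon P"
  shows "rapprox k \<omega> t \<in> approximations P t"
proof -
  interpret d: deterministic_sddp P "\<lambda>i. fo i \<omega>" "\<lambda>i. bo i \<omega>" "\<lambda>i. ro i \<omega>" M
    by (rule deterministic_sddp[OF assms(1)])
  show ?thesis using d.approx_admissible[of k f] assms
    by (auto simp: d.path_array_def d.approx_def rapprox_def intro: admissibleD)
qed

lemma rtrial_states:
  assumes "\<omega> \<in> space \<mu>" "path_array' (Suc k)" "j \<in> {1..M}" "t < horizon P"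
  shows "rtrial k \<omega> j t \<in> states P t"
proof -
  interpret d: deterministic_sddp P "\<lambda>i. fo i \<omega>" "\<lambda>i. bo i \<omega>" "\<lambda>i. ro i \<omega>" M
    by (rule deterministic_sddp[OF assms(1)])
  show ?thesis using d.trial_in_states[of k f j t] assms
    by (simp add: d.path_array_def d.trial_def d.approx_def d.root_solution_def rtrial_def rapprox_def rroot_def)
qed

lemma rtrial_Suc: "rtrial k \<omega> j (Suc t) =
    fst (fo (Suc k) \<omega> (Suc t) (f (Suc k) j (Suc t)) (rtrial k \<omega> j t) (rapprox k \<omega> (Suc t)))"
  by (simp add: rtrial_def)

lemma space_\<Sigma>: "space (\<Sigma> k) = space \<mu>"
  by (rule space_F)

lemma rroot_measurable:
  assumes f: "path_array' k" and Q: "\<And>d. d \<in> states P 0 \<Longrightarrow> (\<lambda>\<omega>. rapprox k \<omega> 0 d) \<in> borel_measurable (\<Sigma> k)"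
  shows "rroot k \<in> borel_measurable (\<Sigma> k)"
proof -
  have "(\<lambda>\<omega>. ro k \<omega> (rapprox k \<omega> 0)) \<in> borel_measurable (\<Sigma> k)"
    using measurable_oracleD[OF ro_measurable[of k], of "\<lambda>_. 0" "\<lambda>\<omega>. rapprox k \<omega> 0"] Q
      rapprox_approximations[OF _ f, of _ 0]
    by (simp add: space_\<Sigma>)
  then show ?thesis by (simp add: rroot_eq[abs_def])
qed

text \<open>Each oracle is evaluated at states and approximations that are random themselves, so the
  induction relies on \<open>measurable_oracle\<close> admitting measurable arguments.\<close>

lemma rtrial_measurable:
  assumes f: "path_array' (Suc k)" and j: "j \<in> {1..M}" and t: "t < horizon P"
    and Q: "\<And>t d. t < horizon P \<Longrightarrow> d \<in> states P t \<Longrightarrow> (\<lambda>\<omega>. rapprox k \<omega> t d) \<in> borel_measurable (\<Sigma> (Suc k))"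
    and r: "rroot k \<in> borel_measurable (\<Sigma> (Suc k))"
  shows "(\<lambda>\<omega>. rtrial k \<omega> j t) \<in> borel_measurable (\<Sigma> (Suc k))"
  using t
proof (induction t)
  case 0
  have "rtrial k \<omega> j 0 = fst (rroot k \<omega>)" for \<omega> by (simp add: rtrial_def)
  then show ?case using borel_measurable_fst[OF r] by simp
next
  case (Suc t)
  have n: "f (Suc k) j (Suc t) \<in> nodes P (Suc t)" using f j Suc.prems by auto
  have f': "path_array' k" using f by auto
  show ?case
    unfolding rtrial_Suc
  proof (rule borel_measurable_fst, rule measurable_oracleD[OF fo_measurable])
    show "(\<lambda>\<omega>. rtrial k \<omega> j t) \<in> borel_measurable (\<Sigma> (Suc k))" using Suc by simp
    show "rtrial k \<omega> j t \<in> states P (Suc t - 1)" if "\<omega> \<in> space (\<Sigma> (Suc k))" for \<omega>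
      using rtrial_states[OF _ f j, of \<omega> t] Suc.prems that by (simp add: space_\<Sigma>)
    show "rapprox k \<omega> (Suc t) \<in> approximations P (Suc t)" if "\<omega> \<in> space (\<Sigma> (Suc k))" for \<omega>
      using rapprox_approximations[OF _ f', of \<omega> "Suc t"] Suc.prems that by (simp add: space_\<Sigma>)
    show "(\<lambda>\<omega>. rapprox k \<omega> (Suc t) d) \<in> borel_measurable (\<Sigma> (Suc k))" if "d \<in> states P (Suc t)" for d
      using Q Suc.prems that by blast
  qed (use n Suc.prems in auto)
qed

lemma rapprox_Suc_eq:
  assumes "t < horizon P" "d \<in> states P t"
  shows "rapprox (Suc k) \<omega> t d = Max (insert (rapprox k \<omega> t d) ((\<lambda>j. \<Sum>m\<in>nodes P (Suc t). node_prob P t m *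
      cut P m (rtrial k \<omega> j t) (bo (Suc k) \<omega> (Suc t) m (rtrial k \<omega> j t) (rapprox (Suc k) \<omega> (Suc t)))
        (dual_value P (Suc t) m (rtrial k \<omega> j t) (rapprox (Suc k) \<omega> (Suc t))) d) ` {1..M}))"
  unfolding rapprox_Suc using assms by (subst backward_approx.simps) simp

lemma rapprox_horizon: "path_array' k \<Longrightarrow> \<omega> \<in> space \<mu> \<Longrightarrow> rapprox k \<omega> (horizon P) = (\<lambda>_. 0)"
  using rapprox_approximations[of \<omega> k "horizon P"] by (simp add: approximations_horizon)

text \<open>Backward induction over stages: the new cuts of stage \<open>t\<close> depend on the
  updated approximation of the next stage, both directly and through the dual value.\<close>

lemma rapprox_Suc_measurable:
  assumes f: "path_array' (Suc k)"
    and Q: "\<And>t d. t < horizon P \<Longrightarrow> d \<in> states P t \<Longrightarrow> (\<lambda>\<omega>. rapprox k \<omega> t d) \<in> borel_measurable (\<Sigma> (Suc k))"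
    and r: "rroot k \<in> borel_measurable (\<Sigma> (Suc k))"
    and t: "t < horizon P" and d: "d \<in> states P t"
  shows "(\<lambda>\<omega>. rapprox (Suc k) \<omega> t d) \<in> borel_measurable (\<Sigma> (Suc k))"
  using t d
proof (induction "horizon P - t" arbitrary: t d)
  case (Suc n)
  note t = \<open>t < horizon P\<close> and d = \<open>d \<in> states P t\<close>
  let ?A = "\<Sigma> (Suc k)" and ?R = "\<lambda>\<omega>. rapprox (Suc k) \<omega> (Suc t)"
  have ap: "?R \<omega> \<in> approximations P (Suc t)" if "\<omega> \<in> space ?A" for \<omega>
    using rapprox_approximations[OF _ f, of \<omega> "Suc t"] t that by (simp add: space_\<Sigma>)
  \<comment> \<open>At the horizon the approximation is constantly 0, so \<open>e\<close> is
    arbitrary there.\<close>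
  have R: "(\<lambda>\<omega>. ?R \<omega> e) \<in> borel_measurable ?A" if "Suc t < horizon P \<Longrightarrow> e \<in> states P (Suc t)" for e
  proof (cases "Suc t < horizon P")
    case True
    then show ?thesis using Suc.hyps that by simp
  next
    case False
    then have T: "Suc t = horizon P" using t by simp
    show ?thesis
      by (subst measurable_cong[of _ _ "\<lambda>_. 0"]) (simp_all add: T rapprox_horizon[OF f] space_\<Sigma>)
  qed
  have "(\<lambda>\<omega>. \<Sum>m\<in>nodes P (Suc t). node_prob P t m *
      cut P m (rtrial k \<omega> j t) (bo (Suc k) \<omega> (Suc t) m (rtrial k \<omega> j t) (?R \<omega>))
        (dual_value P (Suc t) m (rtrial k \<omega> j t) (?R \<omega>)) d) \<in> borel_measurable ?A"
    if j: "j \<in> {1..M}" for j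
  proof (intro borel_measurable_sum borel_measurable_times borel_measurable_const)
    fix m assume m: "m \<in> nodes P (Suc t)"
    have x: "(\<lambda>\<omega>. rtrial k \<omega> j t) \<in> borel_measurable ?A"
      by (rule rtrial_measurable[OF f j t Q r])
    have xs: "rtrial k \<omega> j t \<in> prev_states P (Suc t)" if "\<omega> \<in> space ?A" for \<omega>
      using rtrial_states[OF _ f j t, of \<omega>] that by (simp add: space_\<Sigma>)
    have u: "(\<lambda>\<omega>. bo (Suc k) \<omega> (Suc t) m (rtrial k \<omega> j t) (?R \<omega>)) \<in> borel_measurable ?A"
      by (rule measurable_oracleD[OF bo_measurable]) (use t m x xs ap R in auto)
    have opt: "is_arg_max (inner_value P (Suc t) m (rtrial k \<omega> j t) (?R \<omega>)) (\<lambda>u. u \<in> multipliers P (Suc t) m)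
        (bo (Suc k) \<omega> (Suc t) m (rtrial k \<omega> j t) (?R \<omega>))" if "\<omega> \<in> space ?A" for \<omega>
      using that t m xs[OF that] ap[OF that] by (intro bo_optimal) (auto simp: space_\<Sigma>)
    have Rm: "(\<lambda>\<omega>. ?R \<omega> e) \<in> borel_measurable ?A" if "e \<in> fst ` feas P m" for e
      using that feas_proj[OF _ m] by (intro R) simp
    have v: "(\<lambda>\<omega>. dual_value P (Suc t) m (rtrial k \<omega> j t) (?R \<omega>)) \<in> borel_measurable ?A"
      by (rule borel_measurable_dual_value[OF _ m x xs ap Rm u opt]) (use t in auto)
    show "(\<lambda>\<omega>. cut P m (rtrial k \<omega> j t) (bo (Suc k) \<omega> (Suc t) m (rtrial k \<omega> j t) (?R \<omega>))
        (dual_value P (Suc t) m (rtrial k \<omega> j t) (?R \<omega>)) d) \<in> borel_measurable ?A"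
      by (rule borel_measurable_cut[OF _ m _ x xs u v]) (use t d in auto)
  qed
  then show ?case
    unfolding rapprox_Suc_eq[OF t d] by (intro borel_measurable_Max_insert Q t d) auto
qed simp

text \<open>Approximations are random functions, and \<open>measurable_oracle\<close> asks for
  measurability of exactly their values at single states.\<close>

lemma sddp_measurable:
  "path_array' k \<Longrightarrow> (\<forall>t<horizon P. \<forall>d\<in>states P t. (\<lambda>\<omega>. rapprox k \<omega> t d) \<in> borel_measurable (\<Sigma> k)) \<and>
     rroot k \<in> borel_measurable (\<Sigma> k)"
proof (induction k)
  case 0
  have "(\<lambda>\<omega>. rapprox 0 \<omega> t d) \<in> borel_measurable (\<Sigma> 0)" for t d by (simp add: rapprox_def)
  then show ?case using rroot_measurable[of 0] by simp
next
  case (Suc k)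
  have f: "path_array' k" using Suc.prems by auto
  have Q: "(\<lambda>\<omega>. rapprox k \<omega> t d) \<in> borel_measurable (\<Sigma> (Suc k))" if "t < horizon P" "d \<in> states P t" for t d
    using Suc.IH[OF f] that by (intro measurable_\<Sigma>_mono[of k "Suc k"]) auto
  have r: "rroot k \<in> borel_measurable (\<Sigma> (Suc k))"
    using Suc.IH[OF f] by (intro measurable_\<Sigma>_mono[of k "Suc k"]) auto
  have Q': "(\<lambda>\<omega>. rapprox (Suc k) \<omega> t d) \<in> borel_measurable (\<Sigma> (Suc k))" if "t < horizon P" "d \<in> states P t" for t d
    by (rule rapprox_Suc_measurable[OF Suc.prems Q r that])
  show ?case
    using Q' rroot_measurable[OF Suc.prems] horizon_pos by simp
qed

lemma eps_optimal_event:
  assumes "path_array' k" "k \<le> n"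
  shows "{\<omega> \<in> space \<mu>. eps_optimal_root P \<epsilon> (rroot k \<omega>)} \<in> sets (\<Sigma> n)"
proof -
  have "rroot k -` {u \<in> feas P (rootnode P). root_objective P (QR P 0) u \<le> v_reg P + ereal \<epsilon>} \<inter> space (\<Sigma> n) \<in> sets (\<Sigma> n)"
    using closed_sublevel_root_objective sddp_measurable[OF assms(1)] measurable_\<Sigma>_mono[OF assms(2)]
    by (intro measurable_sets[of _ _ borel] borel_closed) auto
  moreover have "rroot k -` {u \<in> feas P (rootnode P). root_objective P (QR P 0) u \<le> v_reg P + ereal \<epsilon>} \<inter> space (\<Sigma> n) =
      {\<omega> \<in> space \<mu>. eps_optimal_root P \<epsilon> (rroot k \<omega>)}"
    by (auto simp: eps_optimal_root_def space_\<Sigma>)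
  ultimately show ?thesis by simp
qed

end

end

section \<open>Sampling\<close>

context sampled_sddp
begin

lemma scen_event:
  assumes "(i, j, t) \<in> sample_indices P M" "A \<subseteq> nodes P t"
  shows "scen i j t -` A \<inter> space \<mu> \<in> sets \<mu>"
  using measurable_sets[OF path_measurable[OF assms(1)]] assms(2) by auto

lemma scen_in_nodes: "(i, j, t) \<in> sample_indices P M \<Longrightarrow> \<omega> \<in> space \<mu> \<Longrightarrow> scen i j t \<omega> \<in> nodes P t"
  using measurable_space[OF path_measurable] by force

lemma sets_\<Sigma>_subset: "sets (\<Sigma> i) \<subseteq> sets \<mu>"
  using oracle_subalgebra by (auto simp: subalgebra_def)

lemma other_information_generator_subset:
  "(\<Union>i. sets (\<Sigma> i)) \<union>
      {scen i j t -` A \<inter> space \<mu> | i j t A. (i, j, t) \<in> sample_indices P M - {k} \<and> A \<subseteq> nodes P t} \<subseteq> sets \<mu>"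
  using sets_\<Sigma>_subset scen_event by blast

lemma space_other_information: "space (other_information \<mu> \<Sigma> P M scen k) = space \<mu>"
  unfolding other_information_def by (rule space_measure_of_conv)

lemma sets_other_information:
  "sets (other_information \<mu> \<Sigma> P M scen k) = sigma_sets (space \<mu>) ((\<Union>i. sets (\<Sigma> i)) \<union>
      {scen i j t -` A \<inter> space \<mu> | i j t A. (i, j, t) \<in> sample_indices P M - {k} \<and> A \<subseteq> nodes P t})"
  unfolding other_information_def
  by (rule sets_measure_of[OF order.trans[OF other_information_generator_subset sets.space_closed]])

lemma subalgebra_other_information: "subalgebra \<mu> (other_information \<mu> \<Sigma> P M scen k)"
  unfolding subalgebra_def space_other_information sets_other_information
  by (intro conjI refl sets.sigma_sets_subset other_information_generator_subset)

lemma oracle_event_other_information: "A \<in> sets (\<Sigma> l) \<Longrightarrow> A \<in> sets (other_information \<mu> \<Sigma> P M scen k)"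
  unfolding sets_other_information by (rule sigma_sets.Basic) blast

lemma scen_event_other_information:
  assumes "(i, j, t) \<in> sample_indices P M" "(i, j, t) \<noteq> k" "n \<in> nodes P t"
  shows "{\<omega> \<in> space \<mu>. scen i j t \<omega> = n} \<in> sets (other_information \<mu> \<Sigma> P M scen k)"
proof -
  have "scen i j t -` {n} \<inter> space \<mu> \<in> sets (other_information \<mu> \<Sigma> P M scen k)"
    unfolding sets_other_information by (rule sigma_sets.Basic) (use assms in blast)
  moreover have "scen i j t -` {n} \<inter> space \<mu> = {\<omega> \<in> space \<mu>. scen i j t \<omega> = n}" by auto
  ultimately show ?thesis by simp
qed

text \<open>Integrates the constant conditional probability over an event of the conditioning
  \<sigma>-algebra.\<close>

lemma prob_sample:
  assumes k: "(i, j, t) \<in> sample_indices P M" and n: "n \<in> nodes P t"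
    and A: "A \<in> sets (other_information \<mu> \<Sigma> P M scen (i, j, t))"
  shows "prob (A \<inter> {\<omega> \<in> space \<mu>. scen i j t \<omega> = n}) = prob A / real (card (nodes P t))"
proof -
  let ?F = "other_information \<mu> \<Sigma> P M scen (i, j, t)" and ?E = "{\<omega> \<in> space \<mu>. scen i j t \<omega> = n}"
  interpret F: finite_measure_subalgebra \<mu> ?F
    by unfold_locales (rule subalgebra_other_information)
  have A': "A \<in> sets \<mu>"
    using A subalgebra_other_information[of "(i, j, t)"] unfolding subalgebra_def by blast
  have "scen i j t -` {n} \<inter> space \<mu> \<in> sets \<mu>" using n by (intro scen_event[OF k]) auto
  moreover have "scen i j t -` {n} \<inter> space \<mu> = ?E" by auto
  ultimately have E: "?E \<in> sets \<mu>" by simp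
  have int: "integrable \<mu> (indicator ?E :: _ \<Rightarrow> real)" using E by (simp add: emeasure_finite less_top[symmetric])
  have "prob (A \<inter> ?E) = (\<integral>\<omega>. indicator (A \<inter> ?E) \<omega> \<partial>\<mu>)" using A' E by simp
  also have "\<dots> = (\<integral>\<omega>\<in>A. indicator ?E \<omega> \<partial>\<mu>)"
    unfolding set_lebesgue_integral_def by (simp add: indicator_inter_arith)
  also have "\<dots> = (\<integral>\<omega>\<in>A. real_cond_exp \<mu> ?F (indicator ?E) \<omega> \<partial>\<mu>)"
    by (rule F.real_cond_exp_intA[OF int A])
  also have "\<dots> = (\<integral>\<omega>. indicator A \<omega> * (1 / real (card (nodes P t))) \<partial>\<mu>)"
    unfolding set_lebesgue_integral_def using path_uniform[OF k n] A'
    by (intro integral_cong_AE) auto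
  also have "\<dots> = prob A / real (card (nodes P t))" using A' by simp
  finally show ?thesis .
qed

text \<open>Samples are split off one at a time: the remaining ones and the oracle event belong to
  the other information of the one removed. The index \<open>l\<close> is arbitrary, so oracles of
  later iterations are included.\<close>

lemma prob_samples:
  assumes "finite K" "K \<subseteq> sample_indices P M" "\<And>i j t. (i, j, t) \<in> K \<Longrightarrow> f i j t \<in> nodes P t" "A \<in> sets (\<Sigma> l)"
  shows "prob (A \<inter> {\<omega> \<in> space \<mu>. \<forall>(i, j, t)\<in>K. scen i j t \<omega> = f i j t}) =
    prob A * (\<Prod>(i, j, t)\<in>K. 1 / real (card (nodes P t)))"
  using assms
proof (induction K rule: finite_induct)
  case empty
  have "A \<inter> space \<mu> = A" using empty sets.sets_into_space[of A "\<Sigma> l"] by (auto simp: space_\<Sigma>)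
  then show ?case by simp
next
  case (insert k K)
  obtain i j t where k: "k = (i, j, t)" by (metis prod.exhaust)
  let ?B = "\<lambda>K. {\<omega> \<in> space \<mu>. \<forall>(i, j, t)\<in>K. scen i j t \<omega> = f i j t}"
  let ?F = "other_information \<mu> \<Sigma> P M scen (i, j, t)"
  have "?B K = (\<Inter>k'\<in>K. {\<omega> \<in> space \<mu>. scen (fst k') (fst (snd k')) (snd (snd k')) \<omega> = f (fst k') (fst (snd k')) (snd (snd k'))}) \<inter> space \<mu>"
    by (auto simp: case_prod_unfold)
  moreover have "{\<omega> \<in> space \<mu>. scen (fst k') (fst (snd k')) (snd (snd k')) \<omega> = f (fst k') (fst (snd k')) (snd (snd k'))} \<in> sets ?F"
    if "k' \<in> K" for k'
    using insert.prems insert.hyps(2) that k by (intro scen_event_other_information) auto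
  moreover have "space \<mu> \<in> sets ?F" using sets.top[of ?F] by (simp add: space_other_information)
  ultimately have B: "?B K \<in> sets ?F"
    using insert.hyps(1) by (cases "K = {}") (auto intro!: sets.Int sets.finite_INT)
  have "A \<inter> ?B (insert k K) = (A \<inter> ?B K) \<inter> {\<omega> \<in> space \<mu>. scen i j t \<omega> = f i j t}" by (auto simp: k)
  then have "prob (A \<inter> ?B (insert k K)) = prob (A \<inter> ?B K) / real (card (nodes P t))"
    using prob_sample[of i j t "f i j t" "A \<inter> ?B K"] insert.prems B oracle_event_other_information[OF insert.prems(3)]
    by (auto simp: k)
  also have "\<dots> = prob A * (\<Prod>(i, j, t)\<in>insert k K. 1 / real (card (nodes P t)))"
    using insert by (simp add: k)
  finally show ?case .
qed

text \<open>Restricted in every argument, so that its values lie in the finite set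
  \<open>arrays n\<close>.\<close>

definition observed :: "nat \<Rightarrow> 'w \<Rightarrow> nat \<Rightarrow> nat \<Rightarrow> nat \<Rightarrow> 'n" where
  "observed n \<omega> = (\<lambda>i\<in>{1..n}. \<lambda>j\<in>{1..M}. \<lambda>t\<in>{1..horizon P}. scen i j t \<omega>)"

definition array_event :: "nat \<Rightarrow> (nat \<Rightarrow> nat \<Rightarrow> nat \<Rightarrow> 'n) \<Rightarrow> 'w set" where
  "array_event n f = {\<omega> \<in> space \<mu>. \<forall>(i, j, t)\<in>{1..n} \<times> {1..M} \<times> {1..horizon P}. scen i j t \<omega> = f i j t}"

definition arrays :: "nat \<Rightarrow> (nat \<Rightarrow> nat \<Rightarrow> nat \<Rightarrow> 'n) set" where
  "arrays n = (\<Pi>\<^sub>E i\<in>{1..n}. \<Pi>\<^sub>E j\<in>{1..M}. \<Pi>\<^sub>E t\<in>{1..horizon P}. nodes P t)"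

lemma finite_arrays: "finite (arrays n)"
  unfolding arrays_def by (intro finite_PiE finite_atLeastAtMost finite_nodes)

lemma arrays_nodes:
  assumes "f \<in> arrays n" "i \<in> {1..n}" "j \<in> {1..M}" "t \<in> {1..horizon P}"
  shows "f i j t \<in> nodes P t"
proof -
  have "f i \<in> (\<Pi>\<^sub>E j\<in>{1..M}. \<Pi>\<^sub>E t\<in>{1..horizon P}. nodes P t)" using assms(1,2) unfolding arrays_def by (rule PiE_mem)
  then have "f i j \<in> (\<Pi>\<^sub>E t\<in>{1..horizon P}. nodes P t)" using assms(3) by (rule PiE_mem)
  then show ?thesis using assms(4) by (rule PiE_mem)
qed

lemma observed_in_arrays: "\<omega> \<in> space \<mu> \<Longrightarrow> observed n \<omega> \<in> arrays n"
  unfolding observed_def arrays_def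
  by (intro restrict_PiE_iff[THEN iffD2] ballI scen_in_nodes) (simp_all add: sample_indices_def)

lemma in_array_event_observed: "\<omega> \<in> space \<mu> \<Longrightarrow> \<omega> \<in> array_event n (observed n \<omega>)"
  by (simp add: array_event_def observed_def)

text \<open>The array of samples is uniform and independent of every oracle event.\<close>

lemma prob_array_event:
  assumes "f \<in> arrays n" "A \<in> sets (\<Sigma> l)"
  shows "prob (A \<inter> array_event n f) = prob A / real (card (arrays n))"
proof -
  let ?K = "{1..n} \<times> {1..M} \<times> {1..horizon P}"
  have "prob (A \<inter> array_event n f) = prob A * (\<Prod>(i, j, t)\<in>?K. 1 / real (card (nodes P t)))"
    unfolding array_event_def using arrays_nodes[OF assms(1)] assms(2)
    by (intro prob_samples) (auto simp: sample_indices_def)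
  also have "(\<Prod>(i, j, t)\<in>?K. 1 / real (card (nodes P t))) = 1 / real (card (arrays n))"
    unfolding arrays_def card_PiE[OF finite_atLeastAtMost]
    by (simp add: prod.cartesian_product[symmetric] prod_dividef power_one_over)
  finally show ?thesis by simp
qed

lemma array_event_sets: "f \<in> arrays n \<Longrightarrow> array_event n f \<in> sets \<mu>"
proof -
  assume f: "f \<in> arrays n"
  have "{\<omega> \<in> space \<mu>. case k of (i, j, t) \<Rightarrow> scen i j t \<omega> = f i j t} \<in> sets \<mu>"
    if "k \<in> {1..n} \<times> {1..M} \<times> {1..horizon P}" for k
  proof -
    obtain i j t where k: "k = (i, j, t)" by (metis prod.exhaust)
    have "scen i j t -` {f i j t} \<inter> space \<mu> \<in> sets \<mu>"
      using that arrays_nodes[OF f] by (intro scen_event) (auto simp: sample_indices_def k)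
    moreover have "scen i j t -` {f i j t} \<inter> space \<mu> = {\<omega> \<in> space \<mu>. scen i j t \<omega> = f i j t}" by auto
    ultimately show ?thesis by (simp add: k)
  qed
  then show ?thesis unfolding array_event_def by (intro sets.sets_Collect_finite_All) auto
qed

lemma rroot_array_event:
  assumes "\<omega> \<in> array_event n f" "k \<le> n"
  shows "snd (sddp P M (\<lambda>i. fo i \<omega>) (\<lambda>i. bo i \<omega>) (\<lambda>i. ro i \<omega>) (\<lambda>i j t. scen i j t \<omega>) k) = rroot f k \<omega>"
  unfolding rroot_def
  by (rule arg_cong[of _ _ snd], rule sddp_cong) (use assms in \<open>auto simp: array_event_def\<close>)

text \<open>Split by the finitely many observed arrays; on each piece the run follows a fixed array
  and its event is known to be measurable.\<close>

lemma eps_optimal_iteration_event: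
  "{\<omega> \<in> space \<mu>. eps_optimal_root P \<epsilon> (snd (sddp P M (\<lambda>i. fo i \<omega>) (\<lambda>i. bo i \<omega>) (\<lambda>i. ro i \<omega>) (\<lambda>i j t. scen i j t \<omega>) k))} \<in> sets \<mu>"
    (is "?E \<in> _")
proof -
  have "?E = (\<Union>f\<in>arrays k. array_event k f \<inter> {\<omega> \<in> space \<mu>. eps_optimal_root P \<epsilon> (rroot f k \<omega>)})"
  proof (intro equalityI subsetI)
    fix \<omega> assume \<omega>: "\<omega> \<in> ?E"
    then show "\<omega> \<in> (\<Union>f\<in>arrays k. array_event k f \<inter> {\<omega> \<in> space \<mu>. eps_optimal_root P \<epsilon> (rroot f k \<omega>)})"
      using rroot_array_event[OF in_array_event_observed, of \<omega> k k]
      by (intro UN_I[of "observed k \<omega>"] observed_in_arrays IntI in_array_event_observed) auto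
  next
    fix \<omega> assume "\<omega> \<in> (\<Union>f\<in>arrays k. array_event k f \<inter> {\<omega> \<in> space \<mu>. eps_optimal_root P \<epsilon> (rroot f k \<omega>)})"
    then obtain f where "\<omega> \<in> array_event k f" "\<omega> \<in> space \<mu>" "eps_optimal_root P \<epsilon> (rroot f k \<omega>)" by blast
    then show "\<omega> \<in> ?E" using rroot_array_event[of \<omega> k f k] by simp
  qed
  moreover have "{\<omega> \<in> space \<mu>. eps_optimal_root P \<epsilon> (rroot f k \<omega>)} \<in> sets \<mu>" if "f \<in> arrays k" for f
    using eps_optimal_event[of k f k] arrays_nodes[OF that] sets_\<Sigma>_subset by blast
  ultimately show ?thesis
    using finite_arrays array_event_sets by (simp only:) (intro sets.finite_UN sets.Int; blast)
qed

text \<open>The index set of the infimum is random; assigning \<infinity> to the indices that fail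
  makes it a fixed countable one.\<close>

lemma first_optimal_iteration_measurable:
  "(\<lambda>\<omega>. first_optimal_iteration P M (\<lambda>i. fo i \<omega>) (\<lambda>i. bo i \<omega>) (\<lambda>i. ro i \<omega>) (\<lambda>i j t. scen i j t \<omega>) \<epsilon>)
     \<in> measurable \<mu> (count_space UNIV)"
proof -
  let ?opt = "\<lambda>k \<omega>. eps_optimal_root P \<epsilon> (snd (sddp P M (\<lambda>i. fo i \<omega>) (\<lambda>i. bo i \<omega>) (\<lambda>i. ro i \<omega>) (\<lambda>i j t. scen i j t \<omega>) k))"
  have "first_optimal_iteration P M (\<lambda>i. fo i \<omega>) (\<lambda>i. bo i \<omega>) (\<lambda>i. ro i \<omega>) (\<lambda>i j t. scen i j t \<omega>) \<epsilon>
      = (INF k\<in>{1..}. if ?opt k \<omega> then enat k else \<infinity>)" for \<omega>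
    unfolding first_optimal_iteration_def
  proof (intro antisym INF_greatest)
    fix k :: nat assume "k \<in> {1..}"
    then show "(INF i\<in>{i. 1 \<le> i \<and> ?opt i \<omega>}. enat i) \<le> (if ?opt k \<omega> then enat k else \<infinity>)"
      by (auto intro: INF_lower)
  next
    fix k assume "k \<in> {i. 1 \<le> i \<and> ?opt i \<omega>}"
    then show "(INF k\<in>{1..}. if ?opt k \<omega> then enat k else \<infinity>) \<le> enat k"
      by (intro INF_lower2[of k]) auto
  qed
  moreover have "(\<lambda>\<omega>. INF k\<in>{1..}. if ?opt k \<omega> then enat k else \<infinity>) \<in> measurable \<mu> (count_space UNIV)"
    by (intro measurable_INF measurable_If eps_optimal_iteration_event) auto
  ultimately show ?thesis by simp
qed

lemma first_optimal_iteration_tail: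
  fixes \<delta> :: "nat \<Rightarrow> real" and K :: "nat \<Rightarrow> nat" and D :: "nat \<Rightarrow> nat \<Rightarrow> real" and B :: "nat \<Rightarrow> nat \<Rightarrow> 'a set"
  assumes M: "1 \<le> M"
    and \<delta>: "\<And>t. t < horizon P \<Longrightarrow> 0 < \<delta> t" "(\<Sum>t<horizon P. \<delta> t) = \<epsilon>"
    and diameters: "\<And>t c. t < horizon P \<Longrightarrow> c \<in> {1..K t} \<Longrightarrow> 0 \<le> D t c"
    and balls: "\<And>t c. t < horizon P \<Longrightarrow> c \<in> {1..K t} \<Longrightarrow>
           ball_of_diameter (state_space P t) (stage_norm P t) (D t c) (B t c)"
    and cover: "\<And>t. t < horizon P \<Longrightarrow> states P t \<subseteq> (\<Union>c\<in>{1..K t}. B t c)"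
    and I: "I = (\<Sum>t<horizon P. \<Sum>c=1..K t. (1 + 2 * lipschitz_bound P t * D t c / \<delta> t) ^ dim (state_space P t))"
    and N: "N = (\<Prod>t=1..horizon P - 1. card (nodes P t))"
    and \<nu>: "\<nu> = 1 - (1 - 1 / real N) ^ M"
    and \<kappa>: "1 < \<kappa>"
  shows "prob {\<omega> \<in> space \<mu>. ereal (1 + \<kappa> * I / \<nu>) \<le> ereal_of_enat (first_optimal_iteration P M
        (\<lambda>i. fo i \<omega>) (\<lambda>i. bo i \<omega>) (\<lambda>i. ro i \<omega>) (\<lambda>i j t. scen i j t \<omega>) \<epsilon>)}
      \<le> exp (- (I * \<nu> * (\<kappa> - 1)\<^sup>2) / (16 * \<kappa>))" (is "prob ?E \<le> ?q")
proof -
  have N0: "0 < N" unfolding N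
  proof (rule prod_pos)
    fix t assume "t \<in> {1..horizon P - 1}"
    then have "t \<le> horizon P" unfolding atLeastAtMost_iff by arith
    then show "0 < card (nodes P t)" unfolding card_gt_0_iff using nodes_nonempty finite_nodes' by blast
  qed
  then have p: "0 \<le> 1 - 1 / real N" "1 - 1 / real N < 1" by (simp_all add: field_simps)
  then have "(1 - 1 / real N) ^ M < 1" using M by (simp add: power_less_one_iff)
  then have \<nu>01: "0 < \<nu>" "\<nu> \<le> 1" using p unfolding \<nu> by simp_all
  have I0: "0 \<le> I" unfolding I
    using diameters \<delta>(1) lipschitz_bound_pos by (intro sum_nonneg zero_le_power add_nonneg_nonneg divide_nonneg_pos mult_nonneg_nonneg) (auto intro: less_imp_le)
  \<comment> \<open>On \<open>?E\<close> the bound \<open>m < 1 + \<kappa> * I / \<nu>\<close>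
    excludes the iterations 1 to \<open>m\<close>; lying above \<open>\<kappa> * I / \<nu>\<close>,
    \<open>m\<close> is large enough for the counting bound.\<close>
  define m where "m = nat \<lceil>\<kappa> * I / \<nu>\<rceil>"
  have m: "\<kappa> * I / \<nu> \<le> real m" "real m < \<kappa> * I / \<nu> + 1"
    using I0 \<nu>01 \<kappa> by (auto simp: m_def) linarith+
  let ?n = "Suc m"
  \<comment> \<open>The run along the prescribed array \<open>f\<close>, whatever was sampled: this
    depends on the oracles only.\<close>
  define A where "A = (\<lambda>f. {\<omega> \<in> space \<mu>. \<forall>k\<in>{2..?n}. \<not> eps_optimal_root P \<epsilon> (rroot f (k - 1) \<omega>)})"
  have A: "A f \<in> sets (\<Sigma> ?n)" if f: "f \<in> arrays ?n" for f
  proof -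
    have "{\<omega> \<in> space \<mu>. eps_optimal_root P \<epsilon> (rroot f (k - 1) \<omega>)} \<in> sets (\<Sigma> ?n)" if "k \<in> {2..?n}" for k
      using arrays_nodes[OF f] that by (intro eps_optimal_event) auto
    then have "space (\<Sigma> ?n) - (\<Union>k\<in>{2..?n}. {\<omega> \<in> space \<mu>. eps_optimal_root P \<epsilon> (rroot f (k - 1) \<omega>)}) \<in> sets (\<Sigma> ?n)"
      by (intro sets.compl_sets sets.finite_UN) auto
    moreover have "space (\<Sigma> ?n) - (\<Union>k\<in>{2..?n}. {\<omega> \<in> space \<mu>. eps_optimal_root P \<epsilon> (rroot f (k - 1) \<omega>)}) = A f"
      by (auto simp: A_def space_\<Sigma>)
    ultimately show ?thesis by simp
  qed
  have A': "A f \<in> sets \<mu>" if "f \<in> arrays ?n" for f using A[OF that] sets_\<Sigma>_subset by blast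
  have sub: "?E \<subseteq> (\<Union>f\<in>arrays ?n. A f \<inter> array_event ?n f)"
  proof
    fix \<omega> assume \<omega>E: "\<omega> \<in> ?E"
    then have \<omega>: "\<omega> \<in> space \<mu>" by simp
    have "\<not> eps_optimal_root P \<epsilon> (rroot (observed ?n \<omega>) (k - 1) \<omega>)" if k: "k \<in> {2..?n}" for k
    proof
      assume opt: "eps_optimal_root P \<epsilon> (rroot (observed ?n \<omega>) (k - 1) \<omega>)"
      let ?\<iota> = "first_optimal_iteration P M (\<lambda>i. fo i \<omega>) (\<lambda>i. bo i \<omega>) (\<lambda>i. ro i \<omega>) (\<lambda>i j t. scen i j t \<omega>) \<epsilon>"
      have "?\<iota> \<le> enat (k - 1)"
        unfolding first_optimal_iteration_def
        using opt k rroot_array_event[OF in_array_event_observed[OF \<omega>], of "k - 1" ?n]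
        by (intro INF_lower) auto
      then have "ereal_of_enat ?\<iota> \<le> ereal_of_enat (enat (k - 1))" by (simp only: ereal_of_enat_le_iff)
      also have "\<dots> = ereal (real (k - 1))" by simp
      also have "\<dots> \<le> ereal (real m)" using k by auto
      also have "\<dots> < ereal (1 + \<kappa> * I / \<nu>)" using m(2) by simp
      finally show False using \<omega>E by auto
    qed
    then have "\<omega> \<in> A (observed ?n \<omega>)" using \<omega> by (simp add: A_def)
    then show "\<omega> \<in> (\<Union>f\<in>arrays ?n. A f \<inter> array_event ?n f)"
      using observed_in_arrays[OF \<omega>] in_array_event_observed[OF \<omega>] by blast
  qed
  \<comment> \<open>Counting for one fixed outcome: with the oracles fixed, only the arrays
    vary.\<close>
  have count: "(\<Sum>f\<in>arrays ?n. indicator (A f) \<omega>) \<le> real (card (arrays ?n)) * ?q" if \<omega>: "\<omega> \<in> space \<mu>" for \<omega>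
  proof -
    interpret d: deterministic_sddp P "\<lambda>i. fo i \<omega>" "\<lambda>i. bo i \<omega>" "\<lambda>i. ro i \<omega>" M
      by (rule deterministic_sddp[OF \<omega>])
    have arr: "arrays ?n = Pi\<^sub>E {1..?n} (\<lambda>_. d.sampled_paths)" by (simp add: arrays_def d.sampled_paths_def)
    let ?act = "\<lambda>k f. \<not> eps_optimal_root P \<epsilon> (d.root_solution f (k - 1))"
    have rr: "d.root_solution f k = rroot f k \<omega>" for k f
      by (simp add: d.root_solution_def rroot_def)
    have "real (card {f \<in> Pi\<^sub>E {1..?n} (\<lambda>_. d.sampled_paths). \<forall>k\<in>{2..?n}. ?act k f})
        \<le> real (card d.sampled_paths) ^ ?n * ?q"
      by (rule d.card_active_le[OF \<delta>(1,2) diameters balls cover I I0 \<nu>[unfolded N] \<nu>01 \<kappa> m(1)])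
    moreover have "(\<Sum>f\<in>arrays ?n. indicator (A f) \<omega>) = real (card {f \<in> arrays ?n. \<forall>k\<in>{2..?n}. ?act k f})"
    proof -
      have "(\<Sum>f\<in>arrays ?n. indicator (A f) \<omega>) = (\<Sum>f\<in>arrays ?n. if \<forall>k\<in>{2..?n}. ?act k f then 1 else 0 :: real)"
        using \<omega> by (intro sum.cong) (auto simp: A_def rr indicator_def)
      then show ?thesis using finite_arrays by (simp add: sum.inter_filter[symmetric])
    qed
    moreover have "real (card (arrays ?n)) = real (card d.sampled_paths) ^ ?n"
      unfolding arr card_PiE[OF finite_atLeastAtMost] by simp
    ultimately show ?thesis using arr by simp
  qed
  have cpos: "0 < card (arrays ?n)"
    using observed_in_arrays finite_arrays not_empty by (auto simp: card_gt_0_iff)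
  have "prob ?E \<le> prob (\<Union>f\<in>arrays ?n. A f \<inter> array_event ?n f)"
    using sub A' array_event_sets finite_arrays by (intro finite_measure_mono sets.finite_UN sets.Int) auto
  also have "\<dots> \<le> (\<Sum>f\<in>arrays ?n. prob (A f \<inter> array_event ?n f))"
    using A' array_event_sets finite_arrays by (intro finite_measure_subadditive_finite) auto
  \<comment> \<open>Independence turns the sum into the expected fraction of arrays that are bad for
    the outcome, and that fraction is bounded outcome by outcome.\<close>
  also have "\<dots> = (\<Sum>f\<in>arrays ?n. prob (A f) / real (card (arrays ?n)))"
    using A by (intro sum.cong refl prob_array_event)
  also have "\<dots> = (\<Sum>f\<in>arrays ?n. prob (A f)) / real (card (arrays ?n))" by (simp add: sum_divide_distrib)
  also have "(\<Sum>f\<in>arrays ?n. prob (A f)) = (\<Sum>f\<in>arrays ?n. \<integral>\<omega>. indicator (A f) \<omega> \<partial>\<mu>)"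
    using A' by (intro sum.cong) auto
  also have "\<dots> = (\<integral>\<omega>. (\<Sum>f\<in>arrays ?n. indicator (A f) \<omega>) \<partial>\<mu>)"
    using A' by (intro Bochner_Integration.integral_sum[symmetric]) (auto simp: emeasure_finite less_top[symmetric])
  also have "\<dots> \<le> (\<integral>\<omega>. real (card (arrays ?n)) * ?q \<partial>\<mu>)"
    using A' count by (intro integral_mono) (auto simp: emeasure_finite less_top[symmetric] intro!: Bochner_Integration.integrable_sum)
  also have "\<dots> = real (card (arrays ?n)) * ?q" by (simp add: prob_space)
  finally show ?thesis using cpos by (simp add: divide_right_mono)
qed

end

theorem theorem3:
  fixes P :: "('n, 'a::euclidean_space, 'b::euclidean_space) mssp"
    and \<mu> :: "'w measure"
    and \<Sigma> :: "nat \<Rightarrow> 'w measure"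
    and fo :: "nat \<Rightarrow> 'w \<Rightarrow> ('n, 'a, 'b) fwd_oracle"
    and bo :: "nat \<Rightarrow> 'w \<Rightarrow> ('n, 'a) bwd_oracle"
    and ro :: "nat \<Rightarrow> 'w \<Rightarrow> ('a, 'b) root_oracle"
    and M T N :: nat
    and scen :: "nat \<Rightarrow> nat \<Rightarrow> nat \<Rightarrow> 'w \<Rightarrow> 'n"
    and \<epsilon> I \<nu> \<kappa> :: real
    and \<delta> L :: "nat \<Rightarrow> real"
    and d K :: "nat \<Rightarrow> nat"
    and B :: "nat \<Rightarrow> nat \<Rightarrow> 'a set"
    and D :: "nat \<Rightarrow> nat \<Rightarrow> real"
    and \<iota> :: "'w \<Rightarrow> enat"
  assumes problem: "regularized_problem P"
    and sampling: "uniform_sampling \<mu> \<Sigma> P fo bo ro M scen"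
    and M_pos: "1 \<le> M"
    and T: "T = horizon P"
    and d: "\<forall>t<T. d t = dim (state_space P t)"
    and L: "\<forall>t<T. L t = lipschitz_bound P t"
    and \<epsilon>_pos: "0 < \<epsilon>"
    and \<delta>_pos: "\<forall>t<T. 0 < \<delta> t"
    and \<delta>_sum: "(\<Sum>t<T. \<delta> t) = \<epsilon>"
    and diameters: "\<forall>t<T. \<forall>k\<in>{1..K t}. 0 \<le> D t k"
    and balls: "\<forall>t<T. \<forall>k\<in>{1..K t}.
           ball_of_diameter (state_space P t) (stage_norm P t) (D t k) (B t k)"
    and cover: "\<forall>t<T. states P t \<subseteq> (\<Union>k\<in>{1..K t}. B t k)"
    and I: "I = (\<Sum>t<T. \<Sum>k=1..K t. (1 + 2 * L t * D t k / \<delta> t) ^ d t)"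
    and N: "N = (if 2 \<le> T then \<Prod>t=1..T - 1. card (nodes P t) else 1)"
    and \<nu>: "\<nu> = 1 - (1 - 1 / real N) ^ M"
    and \<iota>: "\<forall>\<omega>\<in>space \<mu>. \<iota> \<omega> = first_optimal_iteration P M (\<lambda>i. fo i \<omega>) (\<lambda>i. bo i \<omega>) (\<lambda>i. ro i \<omega>)
           (\<lambda>i j t. scen i j t \<omega>) \<epsilon>"
    and \<kappa>: "1 < \<kappa>"
  shows "\<iota> \<in> measurable \<mu> (count_space UNIV) \<and>
    measure \<mu> {\<omega> \<in> space \<mu>. ereal (1 + \<kappa> * I / \<nu>) \<le> ereal_of_enat (\<iota> \<omega>)}
      \<le> exp (- (I * \<nu> * (\<kappa> - 1)\<^sup>2) / (16 * \<kappa>))"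
proof -
  interpret sampled_sddp P \<mu> \<Sigma> fo bo ro M scen
    by (intro sampled_sddp.intro problem sampling)
  have "\<iota> \<in> measurable \<mu> (count_space UNIV)"
    using first_optimal_iteration_measurable by (subst measurable_cong[OF bspec[OF \<iota>]]) auto
  moreover have "I = (\<Sum>t<horizon P. \<Sum>c=1..K t. (1 + 2 * lipschitz_bound P t * D t c / \<delta> t) ^ dim (state_space P t))"
    unfolding I T using d L T by (intro sum.cong) auto
  \<comment> \<open>For horizon 1 the product is empty, which agrees with the separate case in the
    definition of \<open>N\<close>.\<close>
  moreover have "N = (\<Prod>t=1..horizon P - 1. card (nodes P t))"
    using N T by auto
  moreover have "{\<omega> \<in> space \<mu>. ereal (1 + \<kappa> * I / \<nu>) \<le> ereal_of_enat (\<iota> \<omega>)} =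
      {\<omega> \<in> space \<mu>. ereal (1 + \<kappa> * I / \<nu>) \<le> ereal_of_enat (first_optimal_iteration P M
        (\<lambda>i. fo i \<omega>) (\<lambda>i. bo i \<omega>) (\<lambda>i. ro i \<omega>) (\<lambda>i j t. scen i j t \<omega>) \<epsilon>)}"
    using \<iota> by auto
  ultimately show ?thesis
    using first_optimal_iteration_tail[of \<delta> \<epsilon> K D B I N \<nu> \<kappa>] M_pos \<delta>_pos \<delta>_sum diameters balls cover \<nu> \<kappa> T
    by simp
qed

end
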